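(* Assume that $t\mapsto g(t)/t^{q-1}$ is non-increasing on $(0,\infty)$. Let $\Omega,\Omega'$ be bounded open subsets of $\mathbb R^n$ with $\Omega\Subset\Omega'$, let $\psi:\Omega\to[-\infty,\infty]$ and $\vartheta\in W^{s,G}(\Omega,\Omega')\cap L^g_s(\mathbb R^n)$. If $\mathcal K_{\psi,\vartheta}(\Omega,\Omega')$ is non-empty, then there exists a unique solution to the obstacle problem in $\mathcal K_{\psi,\vartheta}(\Omega,\Omega')$. Moreover, the solution to the obstacle problem is a supersolution of $\mathcal Lu=0$ in $\Omega$.
   Context: Fix $n\in\mathbb N$, $s\in(0,1)$, $\Lambda\ge1$. $G(t)=\int_0^tg$ is a differentiable Young function with $g=G'$ strictly increasing, $G(1)=1$, and $1<p\le q$ with $pG(t)\le tg(t)\le qG(t)$ for $t\ge0$. $k$ measurable with $\Lambda^{-1}\le k(x,y)=k(y,x)\le\Lambda$ a.e. $D^su(x,y)=(u(x)-u(y))/|x-y|^s$. $\|u\|_{L^G(\Omega)}=\inf\{\lambda>0:\int_\Omega G(|u|/\lambda)\le1\}$. $W^{s,G}(\Omega,\Omega')$ is the set of measurable $u$ with $\int_\Omega G(|u|)<\infty$ and $\int_\Omega\int_{\Omega'}G(|D^su|)|x-y|^{-n}dydx<\infty$, with norm $\|u\|_{L^G(\Omega)}+\inf\{\lambda>0:\int_\Omega\int_{\Omega'}G(|D^su|/\lambda)|x-y|^{-n}dydx\le1\}$; $W^{s,G}_0(\Omega,\Omega')$ is the closure of $C_c^\infty(\Omega)$ in this norm. $W^{s,G}_{\mathrm{loc}}(\Omega)$: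 $\int_DG(|u|)+\int_D\int_DG(|D^su|)|x-y|^{-n}<\infty$ for every open $D\Subset\Omega$. $L^g_s(\mathbb R^n)$: measurable $u$ with $g(|u|)$ locally integrable and $\int g(|u(x)|/(1+|x|)^s)(1+|x|)^{-n-s}dx<\infty$. $\mathcal E(u,v)=\int_{\mathbb R^n}\int_{\mathbb R^n}g(|D^su|)\frac{D^su}{|D^su|}D^sv\frac{k(x,y)}{|x-y|^n}dydx$. $\mathcal K_{\psi,\vartheta}(\Omega,\Omega')=\{u\in W^{s,G}(\Omega,\Omega'):u\ge\psi\text{ a.e. in }\Omega,\ u-\vartheta\in W^{s,G}_0(\Omega,\Omega')\}$; $u\in\mathcal K_{\psi,\vartheta}(\Omega,\Omega')$ is a solution to the obstacle problem if $\mathcal E(u,v-u)\ge0$ for all $v\in\mathcal K_{\psi,\vartheta}(\Omega,\Omega')$. A supersolution of $\mathcal Lu=0$ in $\Omega$ is $u\in W^{s,G}_{\mathrm{loc}}(\Omega)$ with $u_-\in L^g_s(\mathbb R^n)$ and $\mathcal E(u,\varphi)\ge0$ for all nonnegative $\varphi\in C_c^\infty(\Omega)$. *)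

theory Defs
  imports "HOL-Analysis.Analysis"
begin

text \<open>Data (G, g, p, q): G(t) = integral of g over [0,t], G differentiable on [0,inf) with
  G' = g, g strictly increasing, g(0) = 0 (part of the notion of Young function),
  G(1) = 1, 1 < p <= q and p G(t) <= t g(t) <= q G(t) for t >= 0.\<close>

definition young_data :: "(real \<Rightarrow> real) \<Rightarrow> (real \<Rightarrow> real) \<Rightarrow> real \<Rightarrow> real \<Rightarrow> bool" where
  "young_data G g p q \<longleftrightarrow>
     (\<forall>t\<ge>0. G t = integral {0..t} g) \<and>
     (\<forall>t\<ge>0. (G has_real_derivative g t) (at t within {0..})) \<and>
     g 0 = 0 \<and>
     strict_mono_on {0..} g \<and>
     G 1 = 1 \<and> 1 < p \<and> p \<le> q \<and>
     (\<forall>t\<ge>0. p * G t \<le> t * g t \<and> t * g t \<le> q * G t)"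

definition Ds :: "real \<Rightarrow> ('a::euclidean_space \<Rightarrow> real) \<Rightarrow> 'a \<Rightarrow> 'a \<Rightarrow> real" where
  "Ds s u x y = (u x - u y) / (dist x y powr s)"

definition modG :: "(real \<Rightarrow> real) \<Rightarrow> 'a::euclidean_space set \<Rightarrow> ('a \<Rightarrow> real) \<Rightarrow> ennreal" where
  "modG G A u = (\<integral>\<^sup>+ x. ennreal (G \<bar>u x\<bar>) * indicator A x \<partial>lebesgue)"

definition modGs :: "(real \<Rightarrow> real) \<Rightarrow> real \<Rightarrow> 'a::euclidean_space set \<Rightarrow> 'a set \<Rightarrow> ('a \<Rightarrow> real) \<Rightarrow> ennreal" where
  "modGs G s A B u = (\<integral>\<^sup>+ x. (\<integral>\<^sup>+ y. ennreal (G \<bar>Ds s u x y\<bar> / dist x y ^ DIM('a))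
                          * indicator B y \<partial>lebesgue) * indicator A x \<partial>lebesgue)"

definition luxG :: "(real \<Rightarrow> real) \<Rightarrow> 'a::euclidean_space set \<Rightarrow> ('a \<Rightarrow> real) \<Rightarrow> real" where
  "luxG G A u = Inf {c::real. c > 0 \<and> modG G A (\<lambda>x. u x / c) \<le> 1}"

definition luxGs :: "(real \<Rightarrow> real) \<Rightarrow> real \<Rightarrow> 'a::euclidean_space set \<Rightarrow> 'a set \<Rightarrow> ('a \<Rightarrow> real) \<Rightarrow> real" where
  "luxGs G s A B u = Inf {c::real. c > 0 \<and> modGs G s A B (\<lambda>x. u x / c) \<le> 1}"

definition WsG :: "(real \<Rightarrow> real) \<Rightarrow> real \<Rightarrow> 'a::euclidean_space set \<Rightarrow> 'a set \<Rightarrow> ('a \<Rightarrow> real) set" where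
  "WsG G s \<Omega> \<Omega>' = {u. u \<in> borel_measurable lebesgue \<and> modG G \<Omega> u < \<infinity> \<and> modGs G s \<Omega> \<Omega>' u < \<infinity>}"

definition WsG_norm :: "(real \<Rightarrow> real) \<Rightarrow> real \<Rightarrow> 'a::euclidean_space set \<Rightarrow> 'a set \<Rightarrow> ('a \<Rightarrow> real) \<Rightarrow> real" where
  "WsG_norm G s \<Omega> \<Omega>' u = luxG G \<Omega> u + luxGs G s \<Omega> \<Omega>' u"

text \<open>C^infinity functions: differentiable everywhere, with all partial derivatives again
  C^infinity (greatest fixed point = derivatives of every order exist).\<close>

coinductive smooth_fun :: "('a::euclidean_space \<Rightarrow> real) \<Rightarrow> bool" where
  "(\<forall>x. f differentiable (at x)) \<Longrightarrow>
   (\<forall>i\<in>Basis. smooth_fun (\<lambda>x. frechet_derivative f (at x) i)) \<Longrightarrow> smooth_fun f"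

definition test_fun :: "'a::euclidean_space set \<Rightarrow> ('a \<Rightarrow> real) \<Rightarrow> bool" where
  "test_fun \<Omega> \<phi> \<longleftrightarrow> smooth_fun \<phi> \<and> compact (closure {x. \<phi> x \<noteq> 0})
                         \<and> closure {x. \<phi> x \<noteq> 0} \<subseteq> \<Omega>"

definition WsG0 :: "(real \<Rightarrow> real) \<Rightarrow> real \<Rightarrow> 'a::euclidean_space set \<Rightarrow> 'a set \<Rightarrow> ('a \<Rightarrow> real) set" where
  "WsG0 G s \<Omega> \<Omega>' = {w. w \<in> WsG G s \<Omega> \<Omega>' \<and> (AE x in lebesgue. x \<notin> \<Omega> \<longrightarrow> w x = 0) \<and>
      (\<exists>\<phi>::nat \<Rightarrow> 'a \<Rightarrow> real. (\<forall>j. test_fun \<Omega> (\<phi> j)) \<and>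
          (\<lambda>j. WsG_norm G s \<Omega> \<Omega>' (\<lambda>x. w x - \<phi> j x)) \<longlonglongrightarrow> 0)}"

definition WsG_loc :: "(real \<Rightarrow> real) \<Rightarrow> real \<Rightarrow> 'a::euclidean_space set \<Rightarrow> ('a \<Rightarrow> real) set" where
  "WsG_loc G s \<Omega> = {u. u \<in> borel_measurable lebesgue \<and>
      (\<forall>D. open D \<and> bounded D \<and> closure D \<subseteq> \<Omega> \<longrightarrow> modG G D u < \<infinity> \<and> modGs G s D D u < \<infinity>)}"

definition Lgs :: "(real \<Rightarrow> real) \<Rightarrow> real \<Rightarrow> ('a::euclidean_space \<Rightarrow> real) set" where
  "Lgs g s = {u. u \<in> borel_measurable lebesgue \<and>
      (\<forall>K. compact K \<longrightarrow> (\<integral>\<^sup>+ x. ennreal (g \<bar>u x\<bar>) * indicator K x \<partial>lebesgue) < \<infinity>) \<and>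
      (\<integral>\<^sup>+ x. ennreal (g (\<bar>u x\<bar> / (1 + norm x) powr s) / (1 + norm x) powr (real DIM('a) + s))
           \<partial>lebesgue) < \<infinity>}"

definition energy :: "(real \<Rightarrow> real) \<Rightarrow> real \<Rightarrow> ('a::euclidean_space \<Rightarrow> 'a \<Rightarrow> real)
                      \<Rightarrow> ('a \<Rightarrow> real) \<Rightarrow> ('a \<Rightarrow> real) \<Rightarrow> real" where
  "energy g s k u v = (\<integral>z. (case z of (x, y) \<Rightarrow>
        g \<bar>Ds s u x y\<bar> * sgn (Ds s u x y) * Ds s v x y * k x y / dist x y ^ DIM('a))
      \<partial>(lebesgue \<Otimes>\<^sub>M lebesgue))"

definition Kclass :: "(real \<Rightarrow> real) \<Rightarrow> real \<Rightarrow> 'a::euclidean_space set \<Rightarrow> 'a set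
                      \<Rightarrow> ('a \<Rightarrow> ereal) \<Rightarrow> ('a \<Rightarrow> real) \<Rightarrow> ('a \<Rightarrow> real) set" where
  "Kclass G s \<Omega> \<Omega>' \<psi> \<theta> = {u. u \<in> WsG G s \<Omega> \<Omega>' \<and>
      (AE x in lebesgue. x \<in> \<Omega> \<longrightarrow> \<psi> x \<le> ereal (u x)) \<and>
      (\<lambda>x. u x - \<theta> x) \<in> WsG0 G s \<Omega> \<Omega>'}"

definition obstacle_solution :: "(real \<Rightarrow> real) \<Rightarrow> (real \<Rightarrow> real) \<Rightarrow> real \<Rightarrow> ('a::euclidean_space \<Rightarrow> 'a \<Rightarrow> real)
      \<Rightarrow> 'a set \<Rightarrow> 'a set \<Rightarrow> ('a \<Rightarrow> ereal) \<Rightarrow> ('a \<Rightarrow> real) \<Rightarrow> ('a \<Rightarrow> real) \<Rightarrow> bool" where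
  "obstacle_solution G g s k \<Omega> \<Omega>' \<psi> \<theta> u \<longleftrightarrow> u \<in> Kclass G s \<Omega> \<Omega>' \<psi> \<theta> \<and>
      (\<forall>v\<in>Kclass G s \<Omega> \<Omega>' \<psi> \<theta>. energy g s k u (\<lambda>x. v x - u x) \<ge> 0)"

definition supersolution :: "(real \<Rightarrow> real) \<Rightarrow> (real \<Rightarrow> real) \<Rightarrow> real \<Rightarrow> ('a::euclidean_space \<Rightarrow> 'a \<Rightarrow> real)
      \<Rightarrow> 'a set \<Rightarrow> ('a \<Rightarrow> real) \<Rightarrow> bool" where
  "supersolution G g s k \<Omega> u \<longleftrightarrow> u \<in> WsG_loc G s \<Omega> \<and> (\<lambda>x. max (- u x) 0) \<in> Lgs g s \<and>
      (\<forall>\<phi>. test_fun \<Omega> \<phi> \<and> (\<forall>x. \<phi> x \<ge> 0) \<longrightarrow> energy g s k u \<phi> \<ge> 0)"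

definition kernel_ok :: "real \<Rightarrow> ('a::euclidean_space \<Rightarrow> 'a \<Rightarrow> real) \<Rightarrow> bool" where
  "kernel_ok \<Lambda> k \<longleftrightarrow> (\<lambda>(x, y). k x y) \<in> borel_measurable (lebesgue \<Otimes>\<^sub>M lebesgue) \<and>
      (AE z in lebesgue \<Otimes>\<^sub>M lebesgue. case z of (x, y) \<Rightarrow>
          1 / \<Lambda> \<le> k x y \<and> k x y \<le> \<Lambda> \<and> k x y = k y x)"

end

theory Submission
  imports Defs
begin

text \<open>The solution is obtained by minimising the convex functional
  \<open>J v = \<integral>\<integral> (G(|D\<^sup>s v|) - G(|D\<^sup>s \<theta>|)) k |x-y|\<^sup>-\<^sup>n dy dx\<close> over \<open>K\<close>. Compactness does not use weak convergence:
  \<open>\<Phi>(t) = \<integral>\<^sub>0\<^sup>t G(\<tau>)/\<tau> d\<tau>\<close> is comparable to \<open>G\<close> and uniformly convex because \<open>p > 1\<close>, so choosing in each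
  sublevel set \<open>{J \<le> inf J + 1/n}\<close> a near-minimiser of the \<open>\<Phi>\<close>-modular of \<open>D\<^sup>s(v - \<theta>)\<close> gives a sequence
  that is minimising for \<open>J\<close> and Cauchy in the modular. Everything rests on the estimate
  \<open>\<integral>\<integral> g(|D\<^sup>s u|) |D\<^sup>s w| |x-y|\<^sup>-\<^sup>n \<le> a + b \<integral>\<integral>\<^bsub>\<Omega>\<times>\<Omega>'\<^esub> G(|D\<^sup>s w|) |x-y|\<^sup>-\<^sup>n\<close> for \<open>w\<close> vanishing outside \<open>\<Omega>\<close>,
  where \<open>a\<close>, \<open>b\<close> depend on \<open>u\<close> only; rescaling \<open>w\<close> turns it into coercivity and continuity. Dominated
  convergence along \<open>u + t (v - u)\<close> then gives the variational inequality, and strict monotonicity of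
  \<open>t \<mapsto> g(|t|) sgn t\<close> gives uniqueness.\<close>

section \<open>Young functions\<close>

text \<open>Lower semicontinuity is not taken from Fatou, since the integrand of \<open>J\<close>
  has no sign. At the limit u0 the subgradient inequality J u0 + E u0 (u_n - u0) \<le> J u_n is used
  instead, and the linear functional \<open>E u0\<close> tends to 0 along any sequence that is null
  in the modular. The same inequality yields midpoint convexity of \<open>J\<close> and replaces its
  differentiation in the variational inequality. The Luxemburg norm occurs in the definition of the
  closure of the test functions. Since G(2 t) \<le> 2^q G(t), being null in norm and being null in
  the modular coincide, so the estimates are written for modulars, with a factor 2^q in place of the
  triangle inequality. The monotonicity of g(t)/t^(q-1) yields continuity of \<open>g\<close> on (0,
  \<infinity>), hence pointwise convergence of the energy integrand when the direction of
  differentiation is shrunk to 0.\<close>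

locale young_fun =
  fixes G g :: "real \<Rightarrow> real" and p q :: real
  assumes young: "young_data G g p q"
    and noninc: "\<forall>t1 t2. 0 < t1 \<and> t1 \<le> t2 \<longrightarrow> g t2 / t2 powr (q - 1) \<le> g t1 / t1 powr (q - 1)"
begin

section \<open>Growth, scaling and convexity of \<open>G\<close> and \<open>g\<close>\<close>

lemma p_gt1: "1 < p" and p_le_q: "p \<le> q" and q_gt1: "1 < q"
  and g_0 [simp]: "g 0 = 0" and G_1 [simp]: "G 1 = 1"
  using young by (auto simp: young_data_def)

lemma pG_le: "0 \<le> t \<Longrightarrow> p * G t \<le> t * g t" and qG_ge: "0 \<le> t \<Longrightarrow> t * g t \<le> q * G t"
  using young by (auto simp: young_data_def)

lemma G_0 [simp]: "G 0 = 0"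
  using young by (auto simp: young_data_def)

lemma g_less: "0 \<le> x \<Longrightarrow> x < y \<Longrightarrow> g x < g y"
  using young by (auto simp: young_data_def strict_mono_on_def)

lemma g_mono: "0 \<le> x \<Longrightarrow> x \<le> y \<Longrightarrow> g x \<le> g y"
  using g_less[of x y] by (cases "x = y") auto

lemma g_nonneg [simp]: "0 \<le> t \<Longrightarrow> 0 \<le> g t"
  using g_mono[of 0 t] by simp

lemma g_pos: "0 < t \<Longrightarrow> 0 < g t"
  using g_less[of 0 t] by simp

lemma G_deriv: "0 \<le> t \<Longrightarrow> (G has_real_derivative g t) (at t within {0..})"
  using young by (auto simp: young_data_def)

lemma G_deriv_at: "0 < t \<Longrightarrow> (G has_real_derivative g t) (at t)"
proof -
  assume "0 < t"
  then have "t \<in> interior {0..}" by (auto simp: interior_real_atLeast)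
  then show ?thesis using G_deriv[of t] \<open>0 < t\<close> at_within_interior[of t "{0..}"] by simp
qed

lemma G_cont: "continuous_on {0..} G"
  using G_deriv by (meson DERIV_continuous atLeast_iff continuous_on_eq_continuous_within)

lemma G_mvt:
  assumes "0 \<le> x" "x < y"
  obtains z where "x < z" "z < y" "G y - G x = (y - x) * g z"
proof -
  have "\<exists>l z. x < z \<and> z < y \<and> (G has_real_derivative l) (at z) \<and> G y - G x = (y - x) * l"
  proof (rule MVT[OF assms(2)])
    show "continuous_on {x..y} G"
      using assms by (intro continuous_on_subset[OF G_cont]) auto
    show "G differentiable (at z)" if "x < z" "z < y" for z
      using G_deriv_at[of z] that assms by (auto simp: real_differentiable_def)
  qed
  then obtain l z where z: "x < z" "z < y" "(G has_real_derivative l) (at z)" "G y - G x = (y - x) * l"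
    by blast
  moreover have "l = g z" using z assms G_deriv_at[of z] DERIV_unique by fastforce
  ultimately show ?thesis using that by blast
qed

text \<open>The mean value point z lies between x and y, so monotonicity of \<open>g\<close>
  compares g z with g x with the right sign in both orders.\<close>

lemma G_subgrad:
  assumes "0 \<le> x" "0 \<le> y"
  shows "g x * (y - x) \<le> G y - G x"
proof -
  consider "x < y" | "x = y" | "y < x" by linarith
  then show ?thesis
  proof cases
    case 1
    then obtain z where "x < z" "G y - G x = (y - x) * g z" using G_mvt assms by metis
    then show ?thesis using g_mono[of x z] assms 1 by (simp add: mult.commute mult_left_mono)
  next
    case 3
    then obtain z where z: "y < z" "z < x" "G x - G y = (x - y) * g z" using G_mvt assms by metis
    then have "(x - y) * g z \<le> (x - y) * g x" using g_mono[of z x] assms 3 by (intro mult_left_mono) auto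
    then show ?thesis using z by (simp add: algebra_simps)
  qed simp
qed

lemma G_mono: "0 \<le> x \<Longrightarrow> x \<le> y \<Longrightarrow> G x \<le> G y"
  using G_subgrad[of x y] by (smt (verit) g_nonneg mult_nonneg_nonneg)

lemma G_nonneg [simp]: "0 \<le> t \<Longrightarrow> 0 \<le> G t"
  using G_mono[of 0 t] by simp

text \<open>The growth conditions say that the logarithmic derivative of \<open>G\<close> lies
  between p/t and q/t, so dividing by t^p or t^q leaves a quotient whose derivative has a fixed
  sign.\<close>

lemma G_powr_mono:
  assumes "0 < x" "x \<le> y"
  shows "G x / x powr p \<le> G y / y powr p" "G y / y powr q \<le> G x / x powr q"
proof -
  have d: "((\<lambda>t. G t / t powr r) has_real_derivative (t * g t - r * G t) / (t powr (r + 1))) (at t)"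
    if "0 < t" for t r
    using that
    by (auto intro!: derivative_eq_intros G_deriv_at simp: field_simps powr_add power2_eq_square powr_diff)
  show "G x / x powr p \<le> G y / y powr p"
  proof (rule DERIV_nonneg_imp_nondecreasing[OF assms(2)])
    fix t assume "x \<le> t" "t \<le> y"
    then show "\<exists>z. ((\<lambda>t. G t / t powr p) has_real_derivative z) (at t) \<and> 0 \<le> z"
      using assms d[of t p] pG_le[of t] by (intro exI conjI) auto
  qed
  show "G y / y powr q \<le> G x / x powr q"
  proof (rule DERIV_nonpos_imp_nonincreasing[OF assms(2)])
    fix t assume "x \<le> t" "t \<le> y"
    then show "\<exists>z. ((\<lambda>t. G t / t powr q) has_real_derivative z) (at t) \<and> z \<le> 0"
      using assms d[of t q] qG_ge[of t] by (intro exI conjI) (auto simp: divide_nonpos_nonneg)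
  qed
qed

lemma G_scale_lower: "1 \<le> c \<Longrightarrow> 0 \<le> t \<Longrightarrow> c powr p * G t \<le> G (c * t)"
  and G_scale_upper: "1 \<le> c \<Longrightarrow> 0 \<le> t \<Longrightarrow> G (c * t) \<le> c powr q * G t"
proof -
  assume c: "1 \<le> c" and "0 \<le> t"
  show "c powr p * G t \<le> G (c * t)"
  proof (cases "t = 0")
    case False
    then have t: "0 < t" "t \<le> c * t" using c \<open>0 \<le> t\<close> by (auto simp: mult_le_cancel_right1)
    from G_powr_mono(1)[OF t] t(1) c show ?thesis by (simp add: powr_mult field_simps)
  qed simp
  show "G (c * t) \<le> c powr q * G t"
  proof (cases "t = 0")
    case False
    then have t: "0 < t" "t \<le> c * t" using c \<open>0 \<le> t\<close> by (auto simp: mult_le_cancel_right1)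
    from G_powr_mono(2)[OF t] t(1) c show ?thesis by (simp add: powr_mult field_simps)
  qed simp
qed

lemma G_scale_small_p:
  assumes "0 < c" "c \<le> 1" "0 \<le> t"
  shows "G (c * t) \<le> c powr p * G t"
  using G_scale_lower[of "1/c" "c * t"] assms by (simp add: powr_divide field_simps)

lemma G_scale_small:
  assumes "0 \<le> c" "c \<le> 1" "0 \<le> t"
  shows "G (c * t) \<le> c * G t"
proof (cases "c = 0")
  case False
  have "c powr p \<le> c powr 1" using assms p_gt1 by (intro powr_mono') auto
  then have "c powr p * G t \<le> c * G t" using assms by (intro mult_right_mono) auto
  then show ?thesis using G_scale_small_p[of c t] assms False by auto
qed simp

text \<open>Doubling takes over from the triangle inequality: |a + b| is at most twice the larger of
  |a| and |b|.\<close>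

lemma G_add: "G \<bar>a + b\<bar> \<le> 2 powr q * (G \<bar>a\<bar> + G \<bar>b\<bar>)"
proof -
  have "G \<bar>a + b\<bar> \<le> G (2 * max \<bar>a\<bar> \<bar>b\<bar>)" by (intro G_mono) auto
  also have "\<dots> \<le> 2 powr q * G (max \<bar>a\<bar> \<bar>b\<bar>)" by (intro G_scale_upper) auto
  also have "\<dots> \<le> 2 powr q * (G \<bar>a\<bar> + G \<bar>b\<bar>)" by (intro mult_left_mono) (auto simp: max_def)
  finally show ?thesis .
qed

lemma G_diff: "G \<bar>a - b\<bar> \<le> 2 powr q * (G \<bar>a\<bar> + G \<bar>b\<bar>)"
  using G_add[of a "- b"] by simp

text \<open>Goes through \<open>G\<close>, where scaling is known: g(c t) \<le> c g(c t) \<le> q G(c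
  t)/t \<le> q c^q G(t)/t \<le> q c^q g(t).\<close>

lemma g_scale:
  assumes "1 \<le> c" "0 \<le> t"
  shows "g (c * t) \<le> q * c powr q * g t"
proof (cases "t = 0")
  case False
  then have t: "0 < t" "0 < c" using assms by auto
  have "g (c * t) \<le> c * g (c * t)" using assms mult_right_mono[of 1 c "g (c * t)"] by simp
  also have "\<dots> \<le> q * G (c * t) / t" using qG_ge[of "c * t"] t by (simp add: field_simps)
  also have "\<dots> \<le> q * (c powr q * G t) / t"
    using G_scale_upper[of c t] assms t q_gt1 by (intro divide_right_mono mult_left_mono) auto
  also have "\<dots> \<le> q * (c powr q * g t)"
  proof -
    have "1 * G t \<le> p * G t" using p_gt1 assms by (intro mult_right_mono) auto
    then have "G t / t \<le> g t" using pG_le[of t] t by (simp add: field_simps)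
    then have "q * c powr q * (G t / t) \<le> q * c powr q * g t" using q_gt1 by (intro mult_left_mono) auto
    then show ?thesis by (simp add: field_simps)
  qed
  finally show ?thesis by simp
qed simp

lemma g_add_le:
  assumes "0 \<le> a" "0 \<le> b"
  shows "g (a + b) \<le> g (2 * a) + g (2 * b)"
proof (cases "a \<le> b")
  case True
  then show ?thesis using g_mono[of "a+b" "2*b"] assms by (smt (verit) g_nonneg)
next
  case False
  then show ?thesis using g_mono[of "a+b" "2*a"] assms by (smt (verit) g_nonneg)
qed

text \<open>Young's inequality without the conjugate function: with m the larger of a and b, g a * b
  \<le> m * g m \<le> q * G m.\<close>

lemma g_mult_le:
  assumes "0 \<le> a" "0 \<le> b"
  shows "g a * b \<le> q * (G a + G b)"
proof (cases "b \<le> a")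
  case True
  then have "g a * b \<le> a * g a" using assms by (simp add: mult.commute mult_right_mono)
  also have "\<dots> \<le> q * G a" using qG_ge assms by simp
  finally show ?thesis using assms q_gt1 by (smt (verit) G_nonneg mult_left_mono)
next
  case False
  then have "g a * b \<le> b * g b" using assms g_mono[of a b] by (simp add: mult.commute mult_right_mono)
  also have "\<dots> \<le> q * G b" using qG_ge assms by simp
  finally show ?thesis using assms q_gt1 by (smt (verit) G_nonneg mult_left_mono)
qed

text \<open>Turns finiteness of the \<open>G\<close>-modular on the bounded set \<Omega> into
  integrability of g(|u|) there, which the tail and \<open>Lgs\<close> require.\<close>

lemma g_le_G: "0 \<le> t \<Longrightarrow> g t \<le> g 1 + q * G t"
proof (cases "t \<le> 1")
  case False
  then have "1 * g t \<le> t * g t" by (intro mult_right_mono) auto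
  then show ?thesis using qG_ge[of t] False by (smt (verit) g_nonneg)
next
  case True
  moreover assume "0 \<le> t"
  ultimately show ?thesis using g_mono[of t 1] q_gt1 by (smt (verit) G_nonneg mult_nonneg_nonneg)
qed

text \<open>For t \<ge> 1 compare \<open>G\<close> with its tangent at 1, whose slope g 1 is at
  least p > 1. On sets of finite measure this makes the modular control the L^1 norm.\<close>

lemma le_G: "0 \<le> t \<Longrightarrow> t \<le> 1 + G t"
  using G_subgrad[of 1 t] pG_le[of 1] p_gt1
  by (smt (verit) G_1 G_nonneg mult_le_cancel_right1 mult_cancel_left2)

section \<open>The derivative \<open>A\<close> of G(|t|): monotonicity and continuity\<close>

definition A :: "real \<Rightarrow> real" where "A t = g \<bar>t\<bar> * sgn t"

lemma A_subgrad: "A a * (b - a) \<le> G \<bar>b\<bar> - G \<bar>a\<bar>"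
proof -
  have "sgn a * (b - a) \<le> \<bar>b\<bar> - \<bar>a\<bar>" by (auto simp: sgn_if abs_if)
  then have "A a * (b - a) \<le> g \<bar>a\<bar> * (\<bar>b\<bar> - \<bar>a\<bar>)" 
    unfolding A_def mult.assoc by (intro mult_left_mono) auto
  then show ?thesis using G_subgrad[of "\<bar>a\<bar>" "\<bar>b\<bar>"] by simp
qed

lemma abs_A: "\<bar>A a\<bar> = g \<bar>a\<bar>"
  by (auto simp: A_def abs_mult sgn_if)

lemma A_less: "a < b \<Longrightarrow> A a < A b"
  using g_less[of a b] g_less[of "-b" "-a"] g_pos[of b] g_pos[of "-a"]
  by (cases "a > 0"; cases "b > 0"; cases "a = 0"; cases "b = 0") (auto simp: A_def sgn_if abs_if)

lemma A_monotone: "0 \<le> (A a - A b) * (a - b)" "(A a - A b) * (a - b) = 0 \<Longrightarrow> a = b"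
  using A_less[of a b] A_less[of b a]
  by (cases a b rule: linorder_cases; simp add: mult_nonpos_nonpos)+

text \<open>The subgradient inequalities at a and at b bound the difference from both sides.\<close>

lemma G_diff_le: "\<bar>G \<bar>a\<bar> - G \<bar>b\<bar>\<bar> \<le> (g \<bar>a\<bar> + g \<bar>b\<bar>) * \<bar>a - b\<bar>"
proof -
  have "\<bar>A a * (b - a)\<bar> = g \<bar>a\<bar> * \<bar>a - b\<bar>" "\<bar>A b * (a - b)\<bar> = g \<bar>b\<bar> * \<bar>a - b\<bar>"
    by (auto simp: abs_mult abs_A)
  moreover have "0 \<le> g \<bar>a\<bar> * \<bar>a - b\<bar>" "0 \<le> g \<bar>b\<bar> * \<bar>a - b\<bar>" by auto
  ultimately show ?thesis using A_subgrad[of a b] A_subgrad[of b a] by (simp add: algebra_simps abs_if split: if_splits)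
qed

text \<open>\<open>g\<close> increases while g(t)/t^(q-1) does not, and these two facts pull in
  opposite directions: g y is squeezed between multiples of g t whose factors tend to 1 as y tends
  to t.\<close>

lemma g_isCont_pos:
  assumes "0 < t" shows "isCont g t"
proof -
  \<comment> \<open>The \<open>min\<close> and \<open>max\<close> with 1 let one pair of bounds
    serve both y \<le> t and y > t.\<close>
  have b: "min 1 ((y / t) powr (q - 1)) * g t \<le> g y \<and> g y \<le> max 1 ((y / t) powr (q - 1)) * g t"
    if "0 < y" for y
  proof (cases "y \<le> t")
    case True
    then have "g t / t powr (q - 1) \<le> g y / y powr (q - 1)" using noninc that by auto
    then have "(y / t) powr (q - 1) * g t \<le> g y" using that assms by (simp add: powr_divide field_simps)
    moreover have "g y \<le> g t" using g_mono True that by simp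
    moreover have "g t \<le> max 1 ((y / t) powr (q - 1)) * g t"
      using assms mult_right_mono[of 1 "max 1 ((y / t) powr (q - 1))" "g t"] by simp
    moreover have "min 1 ((y / t) powr (q - 1)) * g t \<le> (y / t) powr (q - 1) * g t"
      using assms by (intro mult_right_mono; simp)
    ultimately show ?thesis by linarith
  next
    case False
    then have "g y / y powr (q - 1) \<le> g t / t powr (q - 1)" using noninc assms by auto
    then have "g y \<le> (y / t) powr (q - 1) * g t" using that assms by (simp add: powr_divide field_simps)
    moreover have "g t \<le> g y" using g_mono False assms by simp
    moreover have "min 1 ((y / t) powr (q - 1)) * g t \<le> 1 * g t"
      "(y / t) powr (q - 1) * g t \<le> max 1 ((y / t) powr (q - 1)) * g t"
      using assms by (intro mult_right_mono; simp)+
    ultimately show ?thesis by linarith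
  qed
  have ev: "eventually (\<lambda>y. 0 < y) (at t)"
    using assms by (auto simp: eventually_at dist_real_def intro!: exI[of _ t])
  have c: "((\<lambda>y. (y / t) powr (q - 1)) \<longlongrightarrow> (t / t) powr (q - 1)) (at t)"
    using assms by (intro tendsto_intros) auto
  have lo: "((\<lambda>y. min 1 ((y / t) powr (q - 1)) * g t) \<longlongrightarrow> g t) (at t)"
    using tendsto_mult_right[OF tendsto_min[OF tendsto_const[of 1] c], of "g t"] assms by simp
  have hi: "((\<lambda>y. max 1 ((y / t) powr (q - 1)) * g t) \<longlongrightarrow> g t) (at t)"
    using tendsto_mult_right[OF tendsto_max[OF tendsto_const[of 1] c], of "g t"] assms by simp
  have "(g \<longlongrightarrow> g t) (at t)"
    by (rule tendsto_sandwich[OF _ _ lo hi]; rule eventually_mono[OF ev]; use b in blast)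
  then show ?thesis by (simp add: isCont_def)
qed

lemma A_isCont: "isCont A t"
proof (cases "t = 0")
  case True
  \<comment> \<open>Continuity at 0 comes from |y| g(|y|) \<le> q G(|y|) \<le> q |y|^p, where G 1 =
    1 enters; after division the exponent p - 1 is positive.\<close>
  have "\<bar>A y\<bar> \<le> q * \<bar>y\<bar> powr (p - 1)" if "\<bar>y\<bar> \<le> 1" for y
  proof (cases "y = 0")
    case False
    have "\<bar>y\<bar> * g \<bar>y\<bar> \<le> q * G \<bar>y\<bar>" by (intro qG_ge) auto
    also have "\<dots> \<le> q * \<bar>y\<bar> powr p" using G_scale_small_p[of "\<bar>y\<bar>" 1] that False q_gt1
      by (intro mult_left_mono) auto
    finally show ?thesis using False by (simp add: abs_A powr_diff field_simps)
  qed (simp add: A_def)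
  moreover have "eventually (\<lambda>y. \<bar>y\<bar> \<le> 1) (at (0::real))"
    by (auto simp: eventually_at intro!: exI[of _ 1])
  ultimately have ev: "eventually (\<lambda>y. norm (A y) \<le> q * \<bar>y\<bar> powr (p - 1)) (at 0)"
    by (auto elim: eventually_mono)
  have "((\<lambda>y::real. q * \<bar>y\<bar> powr (p - 1)) \<longlongrightarrow> q * \<bar>0\<bar> powr (p - 1)) (at 0)"
    using p_gt1 by (intro tendsto_intros tendsto_powr') auto
  then have "(A \<longlongrightarrow> 0) (at 0)"
    using Lim_null_comparison[OF ev] by simp
  then show ?thesis using True by (simp add: isCont_def A_def)
next
  case False
  then have "isCont (\<lambda>t. g \<bar>t\<bar> * sgn t) t"
    by (intro continuous_intros isCont_o2[where f = abs and g = g] g_isCont_pos) auto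
  then show ?thesis by (simp add: A_def[abs_def])
qed

lemma A_measurable [measurable]: "A \<in> borel_measurable borel"
  by (intro borel_measurable_continuous_onI continuous_at_imp_continuous_on) (auto intro: A_isCont)

lemma g_abs_measurable [measurable]: "(\<lambda>t. g \<bar>t\<bar>) \<in> borel_measurable borel"
  unfolding abs_A[symmetric] by measurable

lemma G_abs_continuous: "continuous_on UNIV (\<lambda>t. G \<bar>t\<bar>)"
  by (rule continuous_on_compose2[OF G_cont]) (auto intro!: continuous_intros)

lemma G_abs_measurable [measurable]: "(\<lambda>t. G \<bar>t\<bar>) \<in> borel_measurable borel"
  by (intro borel_measurable_continuous_onI G_abs_continuous)

section \<open>A uniformly convex function comparable to \<open>G\<close>\<close>

definition h :: "real \<Rightarrow> real" where "h t = G t / t"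

text \<open>Shrinking the argument by a fixed factor shrinks \<open>h\<close> by a fixed factor
  because p > 1; for factors close to 1 this can fail for \<open>g\<close>. The case t = 0 holds
  because division by zero gives h 0 = 0.\<close>

lemma h_scale:
  assumes "0 < c" "c \<le> 1" "0 \<le> t"
  shows "h (c * t) \<le> c powr (p - 1) * h t"
proof (cases "t = 0")
  case False
  have "G (c * t) / (c * t) \<le> c powr p * G t / (c * t)"
    using assms by (intro divide_right_mono G_scale_small_p) auto
  also have "\<dots> = c powr (p - 1) * (G t / t)"
    using assms False by (simp add: powr_diff field_simps)
  finally show ?thesis by (simp add: h_def)
qed (simp add: h_def)

lemma h_nonneg [simp]: "0 \<le> t \<Longrightarrow> 0 \<le> h t"
  by (simp add: h_def)

lemma h_mono: "0 \<le> x \<Longrightarrow> x \<le> y \<Longrightarrow> h x \<le> h y"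
proof (cases "x = 0")
  case False
  assume "0 \<le> x" "x \<le> y"
  with False have *: "0 < x / y" "x / y \<le> 1" "0 \<le> y" by auto
  have "h x \<le> (x / y) powr (p - 1) * h y" using h_scale[OF *] * False by (cases "y = 0") auto
  also have "\<dots> \<le> 1 * h y" using * p_gt1 by (intro mult_right_mono powr_le1) auto
  finally show ?thesis by simp
qed (simp add: h_def)

text \<open>The function \<open>G\<close> itself need not be uniformly convex (\<open>g\<close> may be nearly constant on long
  intervals). Averaging it to \<open>\<integral> G(\<tau>)/\<tau> d\<tau>\<close> gives a comparable function whose derivative
  \<open>h\<close> has controlled growth, and that one is uniformly convex.\<close>

definition Phi :: "real \<Rightarrow> real" where "Phi t = integral {0..t} h"

text \<open>Monotonicity of \<open>h\<close> gives both its integrability and the comparison of its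
  integral between x and y with the constant h x.\<close>

lemma Phi_subgrad:
  assumes "0 \<le> x" "0 \<le> y"
  shows "h x * (y - x) \<le> Phi y - Phi x"
proof -
  have int: "h integrable_on {a..b}" if "0 \<le> a" for a b
    using that by (intro integrable_on_mono_on) (auto simp: mono_on_def intro: h_mono)
  have split: "Phi b - Phi a = integral {a..b} h" if "0 \<le> a" "a \<le> b" for a b
    using Henstock_Kurzweil_Integration.integral_combine[of 0 a b h] int that by (simp add: Phi_def)
  show ?thesis
  proof (cases "x \<le> y")
    case True
    have "integral {x..y} (\<lambda>_. h x) \<le> integral {x..y} h"
      using assms int by (intro integral_le) (auto intro: h_mono)
    then show ?thesis using split[of x y] assms True by (simp add: mult.commute)
  next
    case False
    have "integral {y..x} h \<le> integral {y..x} (\<lambda>_. h x)"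
      using assms int by (intro integral_le) (auto intro: h_mono)
    then show ?thesis using split[of y x] assms False by (simp add: algebra_simps)
  qed
qed

lemma Phi_0 [simp]: "Phi 0 = 0"
  by (simp add: Phi_def)

lemma Phi_nonneg [simp]: "0 \<le> t \<Longrightarrow> 0 \<le> Phi t"
  using Phi_subgrad[of 0 t] by (simp add: h_def)

lemma Phi_mono: "0 \<le> x \<Longrightarrow> x \<le> y \<Longrightarrow> Phi x \<le> Phi y"
  using Phi_subgrad[of x y] by (smt (verit) h_nonneg mult_nonneg_nonneg)

text \<open>The subgradient inequality at t, evaluated at 0, reads - G t \<le> - Phi t.\<close>

lemma Phi_le_G: "0 \<le> t \<Longrightarrow> Phi t \<le> G t"
  using Phi_subgrad[of t 0] by (cases "t = 0") (auto simp: h_def)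

lemma G_le_Phi: "0 \<le> t \<Longrightarrow> G t \<le> 2 powr q * Phi t"
proof -
  assume t: "0 \<le> t"
  have "G t \<le> 2 powr q * G (t / 2)" using G_scale_upper[of 2 "t/2"] t by simp
  moreover have "G (t / 2) \<le> Phi t"
  proof -
    \<comment> \<open>Subgradient at t/2 evaluated at t: the slope times the increment is h(t/2) *
      (t/2) = G(t/2).\<close>
    have "G (t / 2) \<le> Phi t - Phi (t / 2)"
      using Phi_subgrad[of "t/2" t] t by (cases "t = 0") (simp_all add: h_def)
    moreover have "0 \<le> Phi (t / 2)" using t by simp
    ultimately show ?thesis by linarith
  qed
  ultimately show ?thesis by (elim order_trans) (intro mult_left_mono, auto)
qed

text \<open>Measures how far \<open>Phi\<close> rises above its tangent at m when b is larger by a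
  definite ratio. Between m and the midpoint m' of m and b the slope \<open>h\<close> grows by a
  definite factor, and that extra slope acts on the whole second half of the interval.\<close>

lemma Phi_gap:
  assumes "0 < \<kappa>" "\<kappa> < 1"
  obtains c where "0 < c" "\<And>m b. 0 \<le> m \<Longrightarrow> m \<le> \<kappa> * b \<Longrightarrow> 0 < b \<Longrightarrow> c * G b \<le> Phi b - Phi m - h m * (b - m)"
proof -
  \<comment> \<open>The largest possible ratio m / m' for m' = (m + b) / 2, attained at m = \<kappa>
    b.\<close>
  define l where "l = 2 * \<kappa> / (\<kappa> + 1)"
  have l: "0 < l" "l < 1" using assms by (auto simp: l_def field_simps)
  have lp: "l powr (p - 1) < 1" using l p_gt1 powr_less_mono2[of "p-1" l 1] by simp
  \<comment> \<open>The three factors come from the growth of the slope between m and m', from b - m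
    \<ge> (1 - \<kappa>) b, and from comparing G(b/2) with G b.\<close>
  define c where "c = (1 - l powr (p - 1)) * (1 - \<kappa>) * 2 powr (- q)"
  have "c * G b \<le> Phi b - Phi m - h m * (b - m)" if m: "0 \<le> m" "m \<le> \<kappa> * b" and b: "0 < b" for m b
  proof -
    define m' where "m' = (m + b) / 2"
    have "\<kappa> * b \<le> 1 * b" using assms b by (intro mult_right_mono) auto
    then have mb: "m \<le> b" using m by simp
    have m': "0 \<le> m'" "b / 2 \<le> m'" "m \<le> m'" using m b mb by (auto simp: m'_def)
    have "m \<le> l * m'"
      using m assms b by (simp add: l_def m'_def field_simps)
    then have "h m \<le> h (l * m')" using m by (intro h_mono) auto
    also have "\<dots> \<le> l powr (p - 1) * h m'" using l m' by (intro h_scale) auto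
    finally have 1: "(1 - l powr (p - 1)) * h m' \<le> h m' - h m" by (simp add: algebra_simps)
    have "2 powr (- q) * G b \<le> G (b / 2)"
      using G_scale_upper[of 2 "b/2"] b by (simp add: powr_minus field_simps)
    also have "\<dots> \<le> h m' * (b / 2)"
      using h_mono[of "b/2" m'] m' b by (simp add: h_def field_simps)
    finally have 2: "2 powr (- q) * G b \<le> h m' * (b / 2)" .
    have 3: "(1 - \<kappa>) * b \<le> b - m" using m by (simp add: algebra_simps)
    have "c * G b = (1 - l powr (p - 1)) * (1 - \<kappa>) * (2 powr (- q) * G b)" by (simp add: c_def)
    also have "\<dots> \<le> (1 - l powr (p - 1)) * (1 - \<kappa>) * (h m' * (b / 2))"
      using lp assms 2 by (intro mult_left_mono) auto
    also have "\<dots> = ((1 - l powr (p - 1)) * h m') * (((1 - \<kappa>) * b) / 2)" by simp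
    also have "\<dots> \<le> (h m' - h m) * ((b - m) / 2)"
      using 1 3 m' m h_mono[of m m'] assms b by (intro mult_mono) auto
    also have "\<dots> \<le> Phi b - Phi m - h m * (b - m)"
    proof -
      have "h m' * (b - m') \<le> Phi b - Phi m'" "h m * (m' - m) \<le> Phi m' - Phi m"
        using m m' b by (auto intro!: Phi_subgrad)
      then show ?thesis by (simp add: m'_def field_simps)
    qed
    finally show ?thesis .
  qed
  moreover have "0 < c" using lp assms by (simp add: c_def)
  ultimately show ?thesis using that by blast
qed

lemma Phi_midpoint: "2 * Phi \<bar>(a + b) / 2\<bar> \<le> Phi \<bar>a\<bar> + Phi \<bar>b\<bar>"
proof -
  let ?m = "(\<bar>a\<bar> + \<bar>b\<bar>) / 2"
  have "Phi \<bar>(a + b) / 2\<bar> \<le> Phi ?m" by (intro Phi_mono) auto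
  moreover have "h ?m * (\<bar>a\<bar> - ?m) \<le> Phi \<bar>a\<bar> - Phi ?m" "h ?m * (\<bar>b\<bar> - ?m) \<le> Phi \<bar>b\<bar> - Phi ?m"
    by (auto intro!: Phi_subgrad)
  moreover have "h ?m * (\<bar>a\<bar> - ?m) + h ?m * (\<bar>b\<bar> - ?m) = 0" by (simp add: algebra_simps)
  ultimately show ?thesis by linarith
qed

text \<open>A Clarkson-type inequality for modulars. Either |a - b| is at most \<epsilon> times the
  larger argument and G(|a - b|) is small by itself, or the midpoint lies a definite ratio below the
  larger argument and \<open>Phi_gap\<close> bounds the convexity defect from below.\<close>

lemma Phi_uniformly_convex:
  assumes "0 < \<epsilon>" "\<epsilon> \<le> 1"
  obtains c where "0 < c"
    "\<And>a b. G \<bar>a - b\<bar> \<le> \<epsilon> * (G \<bar>a\<bar> + G \<bar>b\<bar>) + c * (Phi \<bar>a\<bar> + Phi \<bar>b\<bar> - 2 * Phi \<bar>(a + b) / 2\<bar>)"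
proof -
  obtain c0 where c0: "0 < c0"
    "\<And>m b. 0 \<le> m \<Longrightarrow> m \<le> (1 - \<epsilon> / 2) * b \<Longrightarrow> 0 < b \<Longrightarrow> c0 * G b \<le> Phi b - Phi m - h m * (b - m)"
    using Phi_gap[of "1 - \<epsilon> / 2"] assms by auto
  define c where "c = 2 powr q / c0"
  have c: "0 < c" using c0 by (simp add: c_def)
  define D where "D a b = Phi \<bar>a\<bar> + Phi \<bar>b\<bar> - 2 * Phi \<bar>(a + b) / 2\<bar>" for a b
  have D: "0 \<le> D a b" for a b using Phi_midpoint[of a b] by (simp add: D_def)
  \<comment> \<open>Normal form: b is nonnegative and dominates |a|. A reflection and a swap, which
    leave all terms unchanged, reduce the general case to it.\<close>
  have core: "G \<bar>a - b\<bar> \<le> \<epsilon> * (G \<bar>a\<bar> + G \<bar>b\<bar>) + c * D a b" if ab: "\<bar>a\<bar> \<le> b" for a b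
  proof (cases "b - a \<le> \<epsilon> * b")
    case True
    have "G \<bar>a - b\<bar> \<le> G (\<epsilon> * b)" using ab True by (intro G_mono) auto
    also have "\<dots> \<le> \<epsilon> * G b" using assms ab by (intro G_scale_small) auto
    also have "\<dots> \<le> \<epsilon> * (G \<bar>a\<bar> + G \<bar>b\<bar>)" using assms ab by (intro mult_left_mono) auto
    finally show ?thesis using mult_nonneg_nonneg[of c "D a b"] c D[of a b] by linarith
  next
    case False
    then have b: "0 < b" using ab assms by (cases "b = 0") auto
    define m where "m = (a + b) / 2"
    \<comment> \<open>Here m = b - (b - a)/2 and b - a > \<epsilon> b, which is why
      \<open>Phi_gap\<close> was taken with the ratio 1 - \<epsilon>/2.\<close>
    have m: "0 \<le> m" "m \<le> (1 - \<epsilon> / 2) * b" using ab False by (auto simp: m_def field_simps)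
    \<comment> \<open>Since a - m = -(b - m), the tangent at m towards a supplies exactly the linear
      term in the gap at b.\<close>
    have "h m * (a - m) \<le> h m * (\<bar>a\<bar> - m)" using m by (intro mult_left_mono) auto
    also have "\<dots> \<le> Phi \<bar>a\<bar> - Phi m" using m by (intro Phi_subgrad) auto
    finally have "Phi b - Phi m - h m * (b - m) \<le> D a b"
      using m b ab by (simp add: D_def m_def[symmetric]) (simp add: m_def field_simps)
    then have "c0 * G b \<le> D a b" using c0(2)[OF m b] by linarith
    then have "G b \<le> D a b / c0" using c0(1) by (simp add: field_simps)
    have "G \<bar>a - b\<bar> \<le> G (2 * b)" using ab by (intro G_mono) auto
    also have "\<dots> \<le> 2 powr q * G b" using b by (intro G_scale_upper) auto
    also have "\<dots> \<le> 2 powr q * (D a b / c0)" using \<open>G b \<le> D a b / c0\<close> by (intro mult_left_mono) auto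
    finally have "G \<bar>a - b\<bar> \<le> c * D a b" by (simp add: c_def)
    moreover have "0 \<le> \<epsilon> * (G \<bar>a\<bar> + G \<bar>b\<bar>)" using assms by (intro mult_nonneg_nonneg add_nonneg_nonneg) auto
    ultimately show ?thesis by linarith
  qed
  have core': "G \<bar>a - b\<bar> \<le> \<epsilon> * (G \<bar>a\<bar> + G \<bar>b\<bar>) + c * D a b" if ab: "\<bar>a\<bar> \<le> \<bar>b\<bar>" for a b
  proof (cases "0 \<le> b")
    case False
    then have "G \<bar>(-a) - (-b)\<bar> \<le> \<epsilon> * (G \<bar>-a\<bar> + G \<bar>-b\<bar>) + c * D (-a) (-b)" using ab by (intro core) auto
    moreover have "D (-a) (-b) = D a b"
      using abs_minus_cancel[of "a + b"] by (simp add: D_def add.commute)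
    moreover have "\<bar>(-a) - (-b)\<bar> = \<bar>a - b\<bar>" by linarith
    ultimately show ?thesis by simp
  qed (use core ab in auto)
  have "G \<bar>a - b\<bar> \<le> \<epsilon> * (G \<bar>a\<bar> + G \<bar>b\<bar>) + c * D a b" for a b
  proof (cases "\<bar>a\<bar> \<le> \<bar>b\<bar>")
    case False
    then have "G \<bar>b - a\<bar> \<le> \<epsilon> * (G \<bar>b\<bar> + G \<bar>a\<bar>) + c * D b a" by (intro core') auto
    moreover have "D b a = D a b" by (simp add: D_def add.commute)
    ultimately show ?thesis by (simp add: abs_minus_commute add.commute)
  qed (use core' in auto)
  then show ?thesis using that[of c] c by (simp add: D_def)
qed

lemma Phi_abs_measurable [measurable]: "(\<lambda>t. Phi \<bar>t\<bar>) \<in> borel_measurable borel"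
proof -
  have "mono (\<lambda>t. Phi (max t 0))" by (auto simp: mono_def intro!: Phi_mono)
  then have [measurable]: "(\<lambda>t. Phi (max t 0)) \<in> borel_measurable borel"
    by (rule borel_measurable_mono)
  have "(\<lambda>t. Phi (max \<bar>t\<bar> 0)) \<in> borel_measurable borel" by measurable
  then show ?thesis by simp
qed

end

section \<open>Integrability of powers and test functions\<close>

lemma sigma_finite_lebesgue: "sigma_finite_measure (lebesgue :: 'a::euclidean_space measure)"
proof
  show "\<exists>A::'a set set. countable A \<and> A \<subseteq> sets lebesgue \<and> \<Union> A = space lebesgue \<and> (\<forall>a\<in>A. emeasure lebesgue a \<noteq> \<infinity>)"
  proof (intro exI[of _ "range (\<lambda>n::nat. ball (0::'a) (real n))"] conjI ballI)
    show "\<Union> (range (\<lambda>n::nat. ball (0::'a) (real n))) = space lebesgue"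
      by (auto intro: reals_Archimedean2)
    show "emeasure lebesgue a \<noteq> \<infinity>" if "a \<in> range (\<lambda>n::nat. ball (0::'a) (real n))" for a
      using that emeasure_bounded_finite[of a] by auto
  qed auto
qed

interpretation lebesgue: sigma_finite_measure "lebesgue :: 'a::euclidean_space measure"
  by (rule sigma_finite_lebesgue)

interpretation lebesgue_pair: pair_sigma_finite "lebesgue :: 'a::euclidean_space measure" "lebesgue :: 'b::euclidean_space measure" ..

text \<open>Each y with nonzero integrand is charged to one ball around x on which the constant c j
  dominates there; using full balls instead of annuli overcounts, which is harmless for an upper
  bound.\<close>

lemma nn_integral_shells:
  fixes f :: "'a::euclidean_space \<Rightarrow> ennreal" and r c :: "nat \<Rightarrow> real"
  assumes "\<And>j. 0 \<le> r j" "\<And>j. 0 \<le> c j" "summable (\<lambda>j. c j * r j ^ DIM('a))"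
    and f: "\<And>y. f y \<noteq> 0 \<Longrightarrow> \<exists>j. dist x y \<le> r j \<and> f y \<le> ennreal (c j)"
  shows "(\<integral>\<^sup>+ y. f y \<partial>lebesgue) \<le> ennreal (unit_ball_vol (real DIM('a)) * (\<Sum>j. c j * r j ^ DIM('a)))"
proof -
  have "f y \<le> (\<Sum>j. ennreal (c j) * indicator (cball x (r j)) y)" for y
  proof (cases "f y = 0")
    case False
    then obtain j where j: "dist x y \<le> r j" "f y \<le> ennreal (c j)" using f by blast
    define t :: "nat \<Rightarrow> ennreal" where "t j = ennreal (c j) * indicator (cball x (r j)) y" for j
    have "f y \<le> t j" using j by (simp add: t_def)
    also have "\<dots> \<le> (\<Sum>j. t j)" using sum_le_suminf[of t "{j}"] by simp
    finally show ?thesis by (simp add: t_def)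
  qed simp
  then have "(\<integral>\<^sup>+ y. f y \<partial>lebesgue) \<le> (\<integral>\<^sup>+ y. (\<Sum>j. ennreal (c j) * indicator (cball x (r j)) y) \<partial>lebesgue)"
    by (intro nn_integral_mono) auto
  also have "\<dots> = (\<Sum>j. ennreal (c j) * emeasure lebesgue (cball x (r j)))"
  proof -
    have [measurable]: "cball x (r j) \<in> sets lebesgue" for j
      by (metis borel_closed closed_cball sets_completionI_sets sets_lborel)
    show ?thesis by (subst nn_integral_suminf) (auto simp: nn_integral_cmult_indicator simp del: emeasure_completion)
  qed
  also have "\<dots> = (\<Sum>j. ennreal (unit_ball_vol (real DIM('a)) * (c j * r j ^ DIM('a))))"
    using assms by (auto simp: emeasure_cball ennreal_mult[symmetric] mult_ac intro!: suminf_cong)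
  also have "\<dots> = ennreal (unit_ball_vol (real DIM('a)) * (\<Sum>j. c j * r j ^ DIM('a)))"
    using assms by (subst suminf_ennreal2) (auto simp: suminf_mult intro!: summable_mult)
  finally show ?thesis .
qed

text \<open>Integrability of |x - y|^(a - n) near the diagonal, with a bound independent of x; used
  with a = 1 - s for test functions.\<close>

lemma nn_integral_powr_ball_le:
  assumes a: "0 < a" "a < real DIM('a)" and R: "0 < R"
  obtains C where "\<And>x::'a::euclidean_space.
    (\<integral>\<^sup>+ y. ennreal (dist x y powr a / dist x y ^ DIM('a)) * indicator (cball x R) y \<partial>lebesgue) \<le> ennreal C"
proof -
  define n where "n = DIM('a)"
  \<comment> \<open>\<open>c j\<close> is the value of t^(a-n) at the inner radius R/2^(j+1) of a
    dyadic shell, where this decreasing power is largest; \<open>r j\<close> is the outer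
    radius.\<close>
  define c where "c j = (R / 2 ^ Suc j) powr (a - n)" for j :: nat
  define r where "r j = R / 2 ^ j" for j :: nat
  have e: "c j * r j ^ n = R powr a * 2 powr (n - a) * (2 powr (- a)) ^ j" for j
  proof -
    have r: "r j = R * 2 powr (- real j)" using R by (simp add: r_def powr_minus powr_realpow field_simps)
    then have "r j ^ n = R powr n * 2 powr (- real j * n)"
      using R by (simp add: power_mult_distrib powr_realpow powr_powr powr_power mult_ac)
    moreover have "c j = R powr (a - n) * 2 powr (- (1 + real j) * (a - n))"
    proof -
      have "R / 2 ^ Suc j = R * 2 powr (- (1 + real j))"
        by (simp only: powr_minus of_nat_Suc[symmetric] powr_realpow zero_less_numeral divide_inverse)
      then have "c j = (R * 2 powr (- (1 + real j))) powr (a - n)" by (simp only: c_def)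
      also have "\<dots> = R powr (a - n) * (2 powr (- (1 + real j))) powr (a - n)"
        by (rule powr_mult)
      finally show ?thesis by (simp only: powr_powr)
    qed
    ultimately have "c j * r j ^ n = (R powr (a - n) * R powr n) * (2 powr (- (1 + real j) * (a - n)) * 2 powr (- real j * n))"
      by simp
    also have "\<dots> = R powr a * 2 powr ((n - a) + (- a) * real j)"
      unfolding powr_add[symmetric] by (simp add: algebra_simps)
    also have "\<dots> = R powr a * 2 powr (n - a) * (2 powr (- a)) ^ j"
      by (simp only: powr_add powr_powr[symmetric] powr_realpow[of "2 powr - a"] powr_gt_zero mult.assoc)
    finally show ?thesis .
  qed
  have "2 powr (- a) < 2 powr 0" using a by (intro powr_less_mono) auto
  then have sm: "summable (\<lambda>j. c j * r j ^ n)"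
    unfolding e by (intro summable_mult summable_geometric) auto
  have "(\<integral>\<^sup>+ y. ennreal (dist x y powr a / dist x y ^ n) * indicator (cball x R) y \<partial>lebesgue)
      \<le> ennreal (unit_ball_vol (real DIM('a)) * (\<Sum>j. c j * r j ^ DIM('a)))" for x :: 'a
  proof (rule nn_integral_shells)
    show "summable (\<lambda>j. c j * r j ^ DIM('a))" using sm by (simp add: n_def)
    fix y :: 'a assume "ennreal (dist x y powr a / dist x y ^ n) * indicator (cball x R) y \<noteq> 0"
    then have d: "0 < dist x y" "dist x y \<le> R" by (auto simp: indicator_def split: if_splits)
    obtain m where "R / dist x y < 2 ^ m" using real_arch_pow[of 2 "R / dist x y"] by auto
    then have ex: "r m < dist x y" using d by (simp add: r_def field_simps)
    \<comment> \<open>The first radius below the distance; it is not r 0 = R, so its predecessor i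
      satisfies r (Suc i) < dist x y \<le> r i.\<close>
    define j where "j = (LEAST m. r m < dist x y)"
    have j: "r j < dist x y" unfolding j_def by (rule LeastI, rule ex)
    have "j \<noteq> 0" using j d by (auto simp: r_def intro!: Nat.gr0I)
    then obtain i where i: "j = Suc i" by (cases j) auto
    have "\<not> r i < dist x y" using i not_less_Least[of i "\<lambda>m. r m < dist x y"] by (simp add: j_def)
    then have 1: "dist x y \<le> r i" by simp
    have "dist x y powr a / dist x y ^ n = dist x y powr (a - n)"
      using d by (simp add: powr_diff powr_realpow)
    also have "\<dots> \<le> c i" unfolding c_def
      using j i d R a by (intro powr_mono2') (auto simp: r_def n_def)
    finally show "\<exists>j. dist x y \<le> r j \<and> ennreal (dist x y powr a / dist x y ^ n) * indicator (cball x R) y \<le> ennreal (c j)"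
      using 1 by (intro exI[of _ i]) (auto simp: indicator_def intro!: ennreal_leI)
  qed (use R in \<open>auto simp: r_def c_def\<close>)
  then show ?thesis unfolding n_def by (rule that)
qed

text \<open>Used with a = s: the weight of the nonlocal tail is integrable over the whole
  space.\<close>

lemma nn_integral_powr_tail_finite:
  assumes a: "0 < a"
  shows "(\<integral>\<^sup>+ y. ennreal (1 / (1 + norm (y::'a::euclidean_space)) powr (real DIM('a) + a)) \<partial>lebesgue) < \<infinity>"
proof -
  define n where "n = real DIM('a)"
  \<comment> \<open>On the shell 2^(j-1) \<le> |y| < 2^j the base 1 + |y| is at least
    2^(j-1).\<close>
  define c where "c j = (2 powr (real j - 1)) powr (- (n + a))" for j :: nat
  define r where "r j = (2::real) ^ j" for j :: nat
  have e: "c j * r j ^ DIM('a) = 2 powr (n + a) * (2 powr (- a)) ^ j" for j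
  proof -
    have "r j ^ DIM('a) = 2 powr (real j * n)"
      by (simp add: r_def n_def powr_realpow[symmetric] powr_powr flip: power_mult)
    moreover have "c j = 2 powr ((real j - 1) * (- (n + a)))" by (simp only: c_def powr_powr)
    ultimately have "c j * r j ^ DIM('a) = 2 powr ((real j - 1) * (- (n + a)) + real j * n)"
      by (simp only: powr_add)
    also have "(real j - 1) * (- (n + a)) + real j * n = (n + a) + (- a) * real j"
      by (simp add: algebra_simps)
    also have "2 powr \<dots> = 2 powr (n + a) * (2 powr (- a)) ^ j"
      by (simp only: powr_add powr_powr[symmetric] powr_realpow[of "2 powr - a"] powr_gt_zero)
    finally show ?thesis .
  qed
  have "2 powr (- a) < 2 powr 0" using a by (intro powr_less_mono) auto
  then have sm: "summable (\<lambda>j. c j * r j ^ DIM('a))"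
    unfolding e by (intro summable_mult summable_geometric) auto
  have "(\<integral>\<^sup>+ y. ennreal (1 / (1 + norm (y::'a)) powr (real DIM('a) + a)) \<partial>lebesgue)
      \<le> ennreal (unit_ball_vol (real DIM('a)) * (\<Sum>j. c j * r j ^ DIM('a)))"
  proof (rule nn_integral_shells[where x = 0])
    fix y :: 'a
    obtain m where ex: "norm y < r m" using real_arch_pow[of 2 "norm y"] by (auto simp: r_def)
    define j where "j = (LEAST m. norm y < r m)"
    have j: "norm y < r j" unfolding j_def by (rule LeastI, rule ex)
    have "2 powr (real j - 1) \<le> 1 + norm y"
    proof (cases j)
      case (Suc i)
      have "\<not> norm y < r i" using Suc not_less_Least[of i "\<lambda>m. norm y < r m"] by (simp add: j_def)
      then show ?thesis using Suc by (simp add: r_def powr_realpow)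
    next
      \<comment> \<open>For j = 0 there is no inner radius, but 1 + |y| \<ge> 1 \<ge> 2^(-1) gives
        the same bound.\<close>
      case 0
      have "2 powr (0 - 1) \<le> 2 powr (0::real)" by (intro powr_mono) auto
      also have "\<dots> \<le> 1 + norm y" by simp
      finally show ?thesis using 0 by simp
    qed
    then have "(1 + norm y) powr (- (n + a)) \<le> c j"
      unfolding c_def using a by (intro powr_mono2') (auto simp: n_def)
    then have "1 / (1 + norm y) powr (real DIM('a) + a) \<le> c j" by (simp only: n_def powr_minus_divide)
    then show "\<exists>j. dist 0 y \<le> r j \<and> ennreal (1 / (1 + norm y) powr (real DIM('a) + a)) \<le> ennreal (c j)"
      using j by (intro exI[of _ j]) (auto intro!: ennreal_leI)
  qed (use sm in \<open>auto simp: r_def c_def\<close>)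
  then show ?thesis by (simp add: le_less_trans)
qed

section \<open>Smooth functions with compact support\<close>

lemma smooth_fun_differentiable: "smooth_fun f \<Longrightarrow> f differentiable (at x)"
  by (auto elim: smooth_fun.cases)

lemma smooth_fun_partial: "smooth_fun f \<Longrightarrow> i \<in> Basis \<Longrightarrow> smooth_fun (\<lambda>x. frechet_derivative f (at x) i)"
  by (auto elim: smooth_fun.cases)

lemma smooth_fun_lincomb:
  assumes "smooth_fun f" "smooth_fun h"
  shows "smooth_fun (\<lambda>x. a * f x + b * h x)"
proof -
  \<comment> \<open>The set of all combinations with these coefficients is closed under partial
    derivatives, which makes it a coinduction invariant.\<close>
  define X where "X F \<longleftrightarrow> (\<exists>f h. F = (\<lambda>x. a * f x + b * h x) \<and> smooth_fun f \<and> smooth_fun h)" for F :: "'a \<Rightarrow> real"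
  have "X (\<lambda>x. a * f x + b * h x)" using assms by (auto simp: X_def)
  then show ?thesis
  proof (rule smooth_fun.coinduct[of X])
    fix F assume "X F"
    then obtain f h where F: "F = (\<lambda>x. a * f x + b * h x)" and fh: "smooth_fun f" "smooth_fun h"
      by (auto simp: X_def)
    have d: "(F has_derivative (\<lambda>v. a * frechet_derivative f (at x) v + b * frechet_derivative h (at x) v)) (at x)" for x
      unfolding F using fh[THEN smooth_fun_differentiable, of x]
      by (intro derivative_intros) (auto simp: frechet_derivative_works[symmetric])
    have e: "frechet_derivative F (at x) = (\<lambda>v. a * frechet_derivative f (at x) v + b * frechet_derivative h (at x) v)" for x
      using frechet_derivative_at[OF d[of x]] by simp
    have "X (\<lambda>x. frechet_derivative F (at x) i)" if "i \<in> Basis" for i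
      unfolding X_def e using fh[THEN smooth_fun_partial, OF that]
      by (intro exI[of _ "\<lambda>x. frechet_derivative f (at x) i"] exI[of _ "\<lambda>x. frechet_derivative h (at x) i"]) auto
    moreover have "F differentiable (at x)" for x using d differentiable_def by blast
    ultimately show "\<exists>f. F = f \<and> (\<forall>x. f differentiable (at x)) \<and>
        (\<forall>i\<in>Basis. X (\<lambda>x. frechet_derivative f (at x) i) \<or> smooth_fun (\<lambda>x. frechet_derivative f (at x) i))"
      by blast
  qed
qed

lemma test_fun_lincomb:
  assumes "test_fun \<Omega> f" "test_fun \<Omega> h"
  shows "test_fun \<Omega> (\<lambda>x. a * f x + b * h x)"
proof -
  let ?F = "\<lambda>x. a * f x + b * h x"
  have sub: "closure {x. ?F x \<noteq> 0} \<subseteq> closure {x. f x \<noteq> 0} \<union> closure {x. h x \<noteq> 0}"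
    by (subst closure_Un[symmetric], intro closure_mono) auto
  have "compact (closure {x. f x \<noteq> 0} \<union> closure {x. h x \<noteq> 0})"
    using assms by (auto simp: test_fun_def)
  then have "compact (closure {x. ?F x \<noteq> 0})"
    using bounded_subset[OF _ sub] by (simp add: compact_eq_bounded_closed)
  then show ?thesis using assms sub smooth_fun_lincomb[of f h a b] unfolding test_fun_def by blast
qed

lemma test_fun_continuous: "test_fun \<Omega> f \<Longrightarrow> continuous_on UNIV f"
  unfolding test_fun_def continuous_on_eq_continuous_within
  by (blast intro: differentiable_imp_continuous_within differentiable_at_withinI smooth_fun_differentiable)

lemma test_fun_zero: "test_fun \<Omega> f \<Longrightarrow> x \<notin> \<Omega> \<Longrightarrow> f x = 0"
  unfolding test_fun_def using closure_subset[of "{x. f x \<noteq> 0}"] by auto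

lemma continuous_compact_support_bounded:
  fixes f :: "'a::euclidean_space \<Rightarrow> real"
  assumes "continuous_on UNIV f" "compact K" "\<And>x. x \<notin> K \<Longrightarrow> f x = 0"
  obtains B where "0 \<le> B" "\<And>x. \<bar>f x\<bar> \<le> B"
proof -
  have "bounded (f ` K)"
    using assms by (intro compact_imp_bounded compact_continuous_image) (auto intro: continuous_on_subset)
  then obtain B where B: "\<And>x. x \<in> K \<Longrightarrow> \<bar>f x\<bar> \<le> B" by (auto simp: bounded_iff)
  have "\<bar>f x\<bar> \<le> max B 0" for x using B[of x] assms(3)[of x] by (cases "x \<in> K") auto
  then show ?thesis using that[of "max B 0"] by auto
qed

text \<open>The partial derivatives are again smooth, hence continuous, and vanish off the compact
  support; so they are bounded and the mean value inequality applies.\<close>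

lemma test_fun_lipschitz:
  fixes f :: "'a::euclidean_space \<Rightarrow> real"
  assumes "test_fun \<Omega> f"
  obtains L where "0 \<le> L" "\<And>x y. \<bar>f x - f y\<bar> \<le> L * dist x y"
proof -
  let ?f' = "\<lambda>x. frechet_derivative f (at x)"
  let ?K = "closure {x. f x \<noteq> 0}"
  have sm: "smooth_fun f" and K: "compact ?K" using assms by (auto simp: test_fun_def)
  have d: "(f has_derivative ?f' x) (at x)" for x
    using smooth_fun_differentiable[OF sm, of x] by (simp add: frechet_derivative_works)
  have out: "?f' x i = 0" if "x \<notin> ?K" for x i
  proof -
    have "((\<lambda>x. 0::real) has_derivative (\<lambda>_. 0)) (at x)" by simp
    then have "(f has_derivative (\<lambda>_. 0)) (at x)"
      by (rule has_derivative_transform_within_open[of _ _ _ "UNIV" "- ?K"])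
        (use that closure_subset[of "{x. f x \<noteq> 0}"] in auto)
    then have "(\<lambda>_. 0) = ?f' x" by (rule frechet_derivative_at)
    then show ?thesis by metis
  qed
  have "\<exists>B. 0 \<le> B \<and> (\<forall>x. \<bar>?f' x i\<bar> \<le> B)" if i: "i \<in> Basis" for i
  proof -
    have "continuous_on UNIV (\<lambda>x. ?f' x i)"
      using smooth_fun_partial[OF sm i]
      by (auto intro!: continuous_at_imp_continuous_on differentiable_imp_continuous_within smooth_fun_differentiable)
    from continuous_compact_support_bounded[OF this K out] show ?thesis by metis
  qed
  then obtain B where B: "\<And>i. i \<in> Basis \<Longrightarrow> 0 \<le> B i" "\<And>i x. i \<in> Basis \<Longrightarrow> \<bar>?f' x i\<bar> \<le> B i" by metis
  define L where "L = (\<Sum>i\<in>Basis. B i)"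
  have "norm (?f' x v) \<le> L * norm v" for x v
  proof -
    have lin: "linear (?f' x)" using d[of x] has_derivative_linear by blast
    have "?f' x v = ?f' x (\<Sum>i\<in>Basis. (v \<bullet> i) *\<^sub>R i)" by (simp add: euclidean_representation)
    also have "\<dots> = (\<Sum>i\<in>Basis. (v \<bullet> i) * ?f' x i)"
      by (simp add: linear_sum[OF lin] linear_cmul[OF lin])
    also have "norm \<dots> \<le> (\<Sum>i\<in>Basis. B i * norm v)"
    proof (rule sum_norm_le)
      fix i :: 'a assume "i \<in> Basis"
      then have "\<bar>?f' x i\<bar> * \<bar>v \<bullet> i\<bar> \<le> B i * norm v"
        using B Basis_le_norm by (intro mult_mono) auto
      then show "norm ((v \<bullet> i) * ?f' x i) \<le> B i * norm v" by (simp add: abs_mult mult.commute)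
    qed
    finally show ?thesis by (simp add: L_def sum_distrib_right)
  qed
  then have "onorm (?f' x) \<le> L" for x by (rule onorm_le)
  then have "norm (f x - f y) \<le> L * norm (x - y)" for x y
    using d by (intro differentiable_bound[of UNIV f ?f']) auto
  moreover have "0 \<le> L" using B by (auto simp: L_def intro: sum_nonneg)
  ultimately show ?thesis using that by (auto simp: dist_norm)
qed

section \<open>Modulars\<close>

lemma id_measurable_lebesgue [measurable]: "(\<lambda>x::'a::euclidean_space. x) \<in> lebesgue \<rightarrow>\<^sub>M borel"
  by (simp add: measurable_completion)

lemma AE_pair_fst:
  assumes "AE x in lebesgue. P (x::'a::euclidean_space)"
  shows "AE z in lebesgue \<Otimes>\<^sub>M (lebesgue :: 'b::euclidean_space measure). P (fst z)"
proof -
  obtain N where N: "{x \<in> space lebesgue. \<not> P x} \<subseteq> N" "N \<in> null_sets lebesgue"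
    using assms by (metis AE_E null_setsI)
  \<comment> \<open>Although the second factor has infinite measure, 0 * \<infinity> = 0 makes the
    strip over N a null set.\<close>
  have "emeasure (lebesgue \<Otimes>\<^sub>M (lebesgue :: 'b measure)) (N \<times> UNIV) = emeasure lebesgue N * emeasure (lebesgue :: 'b measure) UNIV"
    using N by (intro lebesgue.emeasure_pair_measure_Times) auto
  then have "N \<times> UNIV \<in> null_sets (lebesgue \<Otimes>\<^sub>M (lebesgue :: 'b measure))"
    using N by (auto simp: null_sets_def)
  then show ?thesis by (rule AE_I') (use N in auto)
qed

lemma AE_pair_snd:
  assumes "AE x in lebesgue. P (x::'a::euclidean_space)"
  shows "AE z in (lebesgue :: 'b::euclidean_space measure) \<Otimes>\<^sub>M lebesgue. P (snd z)"
proof -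
  obtain N where N: "{x \<in> space lebesgue. \<not> P x} \<subseteq> N" "N \<in> null_sets lebesgue"
    using assms by (metis AE_E null_setsI)
  have "emeasure ((lebesgue :: 'b measure) \<Otimes>\<^sub>M lebesgue) (UNIV \<times> N) = emeasure (lebesgue :: 'b measure) UNIV * emeasure lebesgue N"
    using N by (intro lebesgue.emeasure_pair_measure_Times) auto
  then have "UNIV \<times> N \<in> null_sets ((lebesgue :: 'b measure) \<Otimes>\<^sub>M lebesgue)"
    using N by (auto simp: null_sets_def)
  then show ?thesis by (rule AE_I') (use N in auto)
qed

lemma nn_integral_lebesgue_swap:
  fixes f :: "'a::euclidean_space \<times> 'b::euclidean_space \<Rightarrow> ennreal"
  assumes [measurable]: "f \<in> borel_measurable (lebesgue \<Otimes>\<^sub>M lebesgue)"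
  shows "(\<integral>\<^sup>+ z. f (snd z, fst z) \<partial>(lebesgue \<Otimes>\<^sub>M lebesgue)) = (\<integral>\<^sup>+ z. f z \<partial>(lebesgue \<Otimes>\<^sub>M lebesgue))"
  by (subst (2) lebesgue_pair.distr_pair_swap) (simp add: nn_integral_distr case_prod_beta)

lemma nn_integral_lebesgue_times:
  fixes f :: "'a::euclidean_space \<Rightarrow> ennreal" and h :: "'b::euclidean_space \<Rightarrow> ennreal"
  assumes [measurable]: "f \<in> borel_measurable lebesgue" "h \<in> borel_measurable lebesgue"
  shows "(\<integral>\<^sup>+ z. f (fst z) * h (snd z) \<partial>(lebesgue \<Otimes>\<^sub>M lebesgue)) = (\<integral>\<^sup>+ x. f x \<partial>lebesgue) * (\<integral>\<^sup>+ y. h y \<partial>lebesgue)"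
  by (subst lebesgue.nn_integral_fst[symmetric]) (simp_all add: nn_integral_cmult nn_integral_multc)

section \<open>Modulars and Luxemburg norms over an arbitrary measure\<close>

context young_fun
begin

text \<open>An arbitrary measure is allowed so that the same facts serve both the \<open>L^G\<close>
  modular of u and the Gagliardo modular, read as a modular of D u.\<close>

definition rho :: "'b measure \<Rightarrow> ('b \<Rightarrow> real) \<Rightarrow> ennreal" where
  "rho M f = (\<integral>\<^sup>+ x. ennreal (G \<bar>f x\<bar>) \<partial>M)"

lemma rho_add:
  assumes [measurable]: "f \<in> borel_measurable M" "f' \<in> borel_measurable M"
  shows "rho M (\<lambda>x. f x + f' x) \<le> ennreal (2 powr q) * (rho M f + rho M f')"
proof -
  have "rho M (\<lambda>x. f x + f' x) \<le> (\<integral>\<^sup>+ x. ennreal (2 powr q) * (ennreal (G \<bar>f x\<bar>) + ennreal (G \<bar>f' x\<bar>)) \<partial>M)"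
    unfolding rho_def
    by (intro nn_integral_mono) (simp add: G_add ennreal_leI ennreal_mult[symmetric] ennreal_plus[symmetric] del: ennreal_plus)
  then show ?thesis by (simp add: rho_def nn_integral_cmult nn_integral_add)
qed

lemma rho_scale:
  assumes [measurable]: "f \<in> borel_measurable M"
  shows "rho M (\<lambda>x. c * f x) \<le> ennreal (max 1 \<bar>c\<bar> powr q) * rho M f"
proof -
  have "G \<bar>c * t\<bar> \<le> max 1 \<bar>c\<bar> powr q * G \<bar>t\<bar>" for t
  proof -
    have "G \<bar>c * t\<bar> \<le> G (max 1 \<bar>c\<bar> * \<bar>t\<bar>)" by (intro G_mono) (auto simp: abs_mult intro!: mult_right_mono)
    also have "\<dots> \<le> max 1 \<bar>c\<bar> powr q * G \<bar>t\<bar>" by (intro G_scale_upper) auto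
    finally show ?thesis .
  qed
  then have "rho M (\<lambda>x. c * f x) \<le> (\<integral>\<^sup>+ x. ennreal (max 1 \<bar>c\<bar> powr q) * ennreal (G \<bar>f x\<bar>) \<partial>M)"
    unfolding rho_def by (intro nn_integral_mono) (simp add: ennreal_leI ennreal_mult[symmetric])
  then show ?thesis by (simp add: rho_def nn_integral_cmult)
qed

lemma rho_scale_small:
  assumes [measurable]: "f \<in> borel_measurable M" and c: "0 \<le> c" "c \<le> 1"
  shows "rho M (\<lambda>x. c * f x) \<le> ennreal c * rho M f"
proof -
  have "rho M (\<lambda>x. c * f x) \<le> (\<integral>\<^sup>+ x. ennreal c * ennreal (G \<bar>f x\<bar>) \<partial>M)"
    unfolding rho_def using c
    by (intro nn_integral_mono) (simp add: ennreal_leI ennreal_mult[symmetric] abs_mult G_scale_small)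
  then show ?thesis by (simp add: rho_def nn_integral_cmult)
qed

lemma rho_scale_small_p:
  assumes [measurable]: "f \<in> borel_measurable M" and c: "0 < c" "c \<le> 1"
  shows "rho M (\<lambda>x. c * f x) \<le> ennreal (c powr p) * rho M f"
proof -
  have "rho M (\<lambda>x. c * f x) \<le> (\<integral>\<^sup>+ x. ennreal (c powr p) * ennreal (G \<bar>f x\<bar>) \<partial>M)"
    unfolding rho_def using c
    by (intro nn_integral_mono) (simp add: ennreal_leI ennreal_mult[symmetric] abs_mult G_scale_small_p)
  then show ?thesis by (simp add: rho_def nn_integral_cmult)
qed

lemma rho_lincomb_finite:
  assumes [measurable]: "f \<in> borel_measurable M" "f' \<in> borel_measurable M"
    and "rho M f < \<infinity>" "rho M f' < \<infinity>"
  shows "rho M (\<lambda>x. a * f x + b * f' x) < \<infinity>"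
proof -
  have "rho M (\<lambda>x. a * f x) < \<infinity>" "rho M (\<lambda>x. b * f' x) < \<infinity>"
    using rho_scale[of f M a] rho_scale[of f' M b] assms
    by (auto simp: ennreal_mult_less_top elim!: le_less_trans)
  then show ?thesis using rho_add[of "\<lambda>x. a * f x" M "\<lambda>x. b * f' x"]
    by (auto simp: ennreal_mult_less_top elim!: le_less_trans)
qed

definition lux :: "'b measure \<Rightarrow> ('b \<Rightarrow> real) \<Rightarrow> real" where
  "lux M f = Inf {c. 0 < c \<and> rho M (\<lambda>x. f x / c) \<le> 1}"

text \<open>Dividing by e costs at most the factor (1/e)^q in the modular. The witness e also makes
  the set nonempty, without which the real infimum would say nothing about the sign.\<close>

lemma lux_le:
  assumes [measurable]: "f \<in> borel_measurable M"
    and e: "0 < e" "e \<le> 1" and "rho M f \<le> ennreal (e powr q)"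
  shows "0 \<le> lux M f" "lux M f \<le> e"
proof -
  let ?S = "{c. 0 < c \<and> rho M (\<lambda>x. f x / c) \<le> 1}"
  have "rho M (\<lambda>x. f x / e) \<le> ennreal (max 1 \<bar>1 / e\<bar> powr q) * rho M f"
    using rho_scale[of f M "1 / e"] by simp
  also have "\<dots> \<le> ennreal ((1 / e) powr q) * ennreal (e powr q)"
    using assms by (intro mult_mono) (auto simp: max_def)
  also have "\<dots> = 1" using e by (simp add: ennreal_mult[symmetric] powr_mult[symmetric])
  finally have S: "e \<in> ?S" using e by simp
  then show "0 \<le> lux M f" unfolding lux_def by (intro cInf_greatest) auto
  show "lux M f \<le> e" unfolding lux_def using S by (intro cInf_lower bdd_belowI[of _ 0]) auto
qed

text \<open>Convexity gives rho(f/c) \<le> rho(f)/c for c \<ge> 1, so the modular itself, raised to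
  at least 1, is an admissible scale.\<close>

lemma lux_nonneg: 
  assumes [measurable]: "f \<in> borel_measurable M" and "rho M f < \<infinity>"
  shows "0 \<le> lux M f" "\<exists>c. 0 < c \<and> rho M (\<lambda>x. f x / c) \<le> 1"
proof -
  let ?S = "{c. 0 < c \<and> rho M (\<lambda>x. f x / c) \<le> 1}"
  define c where "c = max 1 (enn2real (rho M f))"
  have "rho M (\<lambda>x. f x / c) \<le> ennreal (1 / c) * rho M f"
    using rho_scale_small[of f M "1 / c"] by (simp add: c_def)
  also have "\<dots> \<le> ennreal (1 / c) * ennreal c"
  proof (intro mult_left_mono)
    have "rho M f = ennreal (enn2real (rho M f))" using assms by simp
    also have "\<dots> \<le> ennreal c" by (intro ennreal_leI) (simp add: c_def)
    finally show "rho M f \<le> ennreal c" .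
  qed simp
  also have "\<dots> = 1" by (simp add: ennreal_mult[symmetric] c_def)
  finally have S: "c \<in> ?S" by (simp add: c_def)
  then show "\<exists>c. 0 < c \<and> rho M (\<lambda>x. f x / c) \<le> 1" by blast
  from S show "0 \<le> lux M f" unfolding lux_def by (intro cInf_greatest) auto
qed

text \<open>For an admissible scale c < e \<le> 1, convexity gives rho f \<le> c * rho(f/c) \<le>
  c.\<close>

lemma rho_le_lux:
  assumes [measurable]: "f \<in> borel_measurable M" and fin: "rho M f < \<infinity>"
    and "lux M f < e" "e \<le> 1"
  shows "rho M f \<le> ennreal e"
proof -
  let ?S = "{c. 0 < c \<and> rho M (\<lambda>x. f x / c) \<le> 1}"
  have "?S \<noteq> {}" using lux_nonneg(2)[OF _ fin] by auto
  then obtain c where c: "0 < c" "rho M (\<lambda>x. f x / c) \<le> 1" "c < e"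
    using cInf_lessD[of ?S e] assms by (auto simp: lux_def)
  have "rho M f = rho M (\<lambda>x. c * (f x / c))" using c by simp
  also have "\<dots> \<le> ennreal c * rho M (\<lambda>x. f x / c)"
    using c assms by (intro rho_scale_small) auto
  also have "\<dots> \<le> ennreal c * 1" using c by (intro mult_left_mono) auto
  also have "\<dots> \<le> ennreal e" using c by (auto intro: ennreal_leI)
  finally show ?thesis .
qed

end

section \<open>The obstacle setting written with weighted measures\<close>

locale obst = young_fun G g p q for G g p q +
  fixes s \<Lambda> :: real and k :: "'a::euclidean_space \<Rightarrow> 'a \<Rightarrow> real"
    and \<Omega> \<Omega>' :: "'a set" and \<psi> :: "'a \<Rightarrow> ereal" and \<theta> :: "'a \<Rightarrow> real"
  assumes s: "0 < s" "s < 1"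
    and Lam: "1 \<le> \<Lambda>"
    and kern: "kernel_ok \<Lambda> k"
    and opens: "open \<Omega>" "open \<Omega>'" "bounded \<Omega>" "bounded \<Omega>'"
    and compin: "closure \<Omega> \<subseteq> \<Omega>'"
    and theta: "\<theta> \<in> WsG G s \<Omega> \<Omega>'" "\<theta> \<in> Lgs g s"
begin

lemma Omega_subset: "\<Omega> \<subseteq> \<Omega>'"
  using compin closure_subset by blast

abbreviation leb2 :: "('a \<times> 'a) measure" where "leb2 \<equiv> lebesgue \<Otimes>\<^sub>M lebesgue"
definition D :: "('a \<Rightarrow> real) \<Rightarrow> 'a \<times> 'a \<Rightarrow> real" where "D w z = Ds s w (fst z) (snd z)"
definition d :: "'a \<times> 'a \<Rightarrow> real" where "d z = dist (fst z) (snd z)"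
text \<open>The kernels are put into the measures so that every double integral becomes an integral
  of a function of D w. On the diagonal division by zero gives density 0, so the diagonal carries no
  mass.\<close>

definition \<mu> :: "('a \<times> 'a) measure" where "\<mu> = density leb2 (\<lambda>z. ennreal (1 / d z ^ DIM('a)))"
definition \<kappa> :: "('a \<times> 'a) measure" where "\<kappa> = density leb2 (\<lambda>z. ennreal (k (fst z) (snd z) / d z ^ DIM('a)))"
definition \<nu> :: "('a \<times> 'a) measure" where "\<nu> = density leb2 (\<lambda>z. ennreal (indicator (\<Omega> \<times> \<Omega>') z / d z ^ DIM('a)))"
definition leb\<Omega> :: "'a measure" where "leb\<Omega> = density lebesgue (indicator \<Omega>)"

lemma sets_Omega [measurable]: "\<Omega> \<in> sets lebesgue" "\<Omega>' \<in> sets lebesgue"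
  using opens by auto

lemma D_eq: "D w z = (w (fst z) - w (snd z)) / d z powr s"
  by (simp add: D_def d_def Ds_def)

lemma d_nonneg [simp]: "0 \<le> d z"
  by (simp add: d_def)

lemma d_measurable [measurable]: "d \<in> borel_measurable leb2"
proof -
  have "(\<lambda>z::'a\<times>'a. dist (fst z) (snd z)) \<in> borel_measurable leb2"
    by (intro borel_measurable_dist measurable_compose[OF measurable_fst] measurable_compose[OF measurable_snd]
        id_measurable_lebesgue)
  then show ?thesis by (simp add: d_def[abs_def])
qed

lemma fst_snd_measurable [measurable (raw)]:
  assumes "w \<in> borel_measurable lebesgue"
  shows "(\<lambda>z. w (fst z)) \<in> borel_measurable leb2" "(\<lambda>z. w (snd z)) \<in> borel_measurable leb2"
  using measurable_compose[OF measurable_fst assms] measurable_compose[OF measurable_snd assms] by auto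

lemma D_measurable [measurable]:
  assumes w: "w \<in> borel_measurable lebesgue"
  shows "D w \<in> borel_measurable leb2"
proof -
  have "(\<lambda>z. (w (fst z) - w (snd z)) / d z powr s) \<in> borel_measurable leb2"
    using fst_snd_measurable[OF w] by measurable
  then show ?thesis by (simp add: D_eq[abs_def])
qed

lemma k_measurable [measurable]: "(\<lambda>z. k (fst z) (snd z)) \<in> borel_measurable leb2"
  using kern[unfolded kernel_ok_def, THEN conjunct1] by (simp add: case_prod_beta')

lemma sets_dens [simp, measurable_cong]: "sets \<mu> = sets leb2" "sets \<kappa> = sets leb2" "sets \<nu> = sets leb2" "sets leb\<Omega> = sets lebesgue"
  by (simp_all add: \<mu>_def \<kappa>_def \<nu>_def leb\<Omega>_def)

lemma k_bounds: "AE z in leb2. 1 / \<Lambda> \<le> k (fst z) (snd z) \<and> k (fst z) (snd z) \<le> \<Lambda>"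
  using kern unfolding kernel_ok_def by (auto elim!: eventually_mono)

lemma AE_dens:
  assumes "AE z in leb2. P z"
  shows "AE z in \<mu>. P z" "AE z in \<kappa>. P z" "AE z in \<nu>. P z"
  using assms unfolding \<mu>_def \<kappa>_def \<nu>_def by (subst AE_density; measurable; auto elim!: eventually_mono)+

lemma modG_eq: "u \<in> borel_measurable lebesgue \<Longrightarrow> modG G \<Omega> u = rho leb\<Omega> u"
  unfolding modG_def rho_def leb\<Omega>_def by (subst nn_integral_density) (auto simp: mult.commute)

lemma modGs_eq:
  assumes [measurable]: "u \<in> borel_measurable lebesgue"
  shows "modGs G s \<Omega> \<Omega>' u = rho \<nu> (D u)"
proof -
  let ?f = "\<lambda>z. ennreal (G \<bar>D u z\<bar> / d z ^ DIM('a)) * indicator \<Omega>' (snd z) * indicator \<Omega> (fst z)"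
  have m [measurable]: "?f \<in> borel_measurable leb2" by measurable
  have "modGs G s \<Omega> \<Omega>' u = (\<integral>\<^sup>+ x. (\<integral>\<^sup>+ y. ?f (x, y) \<partial>lebesgue) \<partial>lebesgue)"
    unfolding modGs_def
  proof (intro nn_integral_cong)
    fix x
    have "(\<lambda>y. ennreal (G \<bar>D u (x, y)\<bar> / d (x, y) ^ DIM('a)) * indicator \<Omega>' y) \<in> borel_measurable lebesgue"
      by measurable
    then show "(\<integral>\<^sup>+ y. ennreal (G \<bar>Ds s u x y\<bar> / dist x y ^ DIM('a)) * indicator \<Omega>' y \<partial>lebesgue) * indicator \<Omega> x
       = (\<integral>\<^sup>+ y. ?f (x, y) \<partial>lebesgue)"
      by (simp add: nn_integral_multc D_def d_def)
  qed
  also have "\<dots> = (\<integral>\<^sup>+ z. ?f z \<partial>leb2)" by (rule lebesgue.nn_integral_fst[OF m])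
  also have "\<dots> = rho \<nu> (D u)"
    unfolding rho_def \<nu>_def
    by (subst nn_integral_density) (auto intro!: nn_integral_cong simp: indicator_def ennreal_mult[symmetric])
  finally show ?thesis .
qed

lemma luxG_eq: "u \<in> borel_measurable lebesgue \<Longrightarrow> luxG G \<Omega> u = lux leb\<Omega> u"
  unfolding luxG_def lux_def by (simp add: modG_eq)

lemma luxGs_eq: "u \<in> borel_measurable lebesgue \<Longrightarrow> luxGs G s \<Omega> \<Omega>' u = lux \<nu> (D u)"
proof -
  assume u: "u \<in> borel_measurable lebesgue"
  have "D (\<lambda>x. u x / c) = (\<lambda>z. D u z / c)" for c
    by (auto simp: D_eq diff_divide_distrib divide_divide_eq_left mult.commute)
  then show ?thesis using u unfolding luxGs_def lux_def by (simp add: modGs_eq)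
qed

lemma energy_eq:
  assumes [measurable]: "u \<in> borel_measurable lebesgue" "v \<in> borel_measurable lebesgue"
  shows "energy g s k u v = (\<integral>z. A (D u z) * D v z \<partial>\<kappa>)"
proof -
  have "(\<integral>z. A (D u z) * D v z \<partial>\<kappa>) = (\<integral>z. (k (fst z) (snd z) / d z ^ DIM('a)) *\<^sub>R (A (D u z) * D v z) \<partial>leb2)"
    unfolding \<kappa>_def
  proof (rule integral_density)
    show "AE z in leb2. 0 \<le> k (fst z) (snd z) / d z ^ DIM('a)"
      using k_bounds by eventually_elim (use Lam in \<open>auto intro!: divide_nonneg_nonneg elim: order_trans[rotated]\<close>)
  qed measurable
  also have "\<dots> = energy g s k u v"
    unfolding energy_def
    by (intro Bochner_Integration.integral_cong) (auto simp: D_def d_def A_def)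
  finally show ?thesis by simp
qed

lemma nn_kappa_le:
  assumes [measurable]: "f \<in> borel_measurable leb2"
  shows "(\<integral>\<^sup>+ z. f z \<partial>\<kappa>) \<le> ennreal \<Lambda> * (\<integral>\<^sup>+ z. f z \<partial>\<mu>)"
proof -
  have "(\<integral>\<^sup>+ z. f z \<partial>\<kappa>) = (\<integral>\<^sup>+ z. ennreal (k (fst z) (snd z) / d z ^ DIM('a)) * f z \<partial>leb2)"
    unfolding \<kappa>_def by (rule nn_integral_density) measurable
  also have "\<dots> \<le> (\<integral>\<^sup>+ z. ennreal \<Lambda> * (ennreal (1 / d z ^ DIM('a)) * f z) \<partial>leb2)"
  proof (intro nn_integral_mono_AE)
    show "AE z in leb2. ennreal (k (fst z) (snd z) / d z ^ DIM('a)) * f z \<le> ennreal \<Lambda> * (ennreal (1 / d z ^ DIM('a)) * f z)"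
      using k_bounds
    proof eventually_elim
      case (elim z)
      then have "ennreal (k (fst z) (snd z) / d z ^ DIM('a)) \<le> ennreal (\<Lambda> * (1 / d z ^ DIM('a)))"
        by (intro ennreal_leI) (auto intro!: divide_right_mono)
      also have "\<dots> = ennreal \<Lambda> * ennreal (1 / d z ^ DIM('a))" using Lam by (intro ennreal_mult) auto
      finally show ?case by (metis mult.assoc mult_right_mono zero_le)
    qed
  qed
  also have "\<dots> = ennreal \<Lambda> * (\<integral>\<^sup>+ z. f z \<partial>\<mu>)"
    unfolding \<mu>_def by (simp add: nn_integral_cmult nn_integral_density)
  finally show ?thesis .
qed

lemma nn_mu_nu:
  assumes [measurable]: "f \<in> borel_measurable leb2"
  shows "(\<integral>\<^sup>+ z. f z * indicator (\<Omega> \<times> \<Omega>') z \<partial>\<mu>) = (\<integral>\<^sup>+ z. f z \<partial>\<nu>)"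
proof -
  have [measurable]: "\<Omega> \<times> \<Omega>' \<in> sets leb2" by (intro pair_measureI) auto
  show ?thesis
    unfolding \<mu>_def \<nu>_def
    by (subst (1 2) nn_integral_density) (auto simp: indicator_def intro!: nn_integral_cong)
qed

lemma nn_nu_kappa:
  assumes [measurable]: "f \<in> borel_measurable leb2"
  shows "(\<integral>\<^sup>+ z. f z \<partial>\<nu>) \<le> ennreal \<Lambda> * (\<integral>\<^sup>+ z. f z * indicator (\<Omega> \<times> \<Omega>') z \<partial>\<kappa>)"
proof -
  have [measurable]: "\<Omega> \<times> \<Omega>' \<in> sets leb2" by (intro pair_measureI) auto
  have "(\<integral>\<^sup>+ z. f z \<partial>\<nu>) = (\<integral>\<^sup>+ z. ennreal (1 / d z ^ DIM('a)) * (f z * indicator (\<Omega> \<times> \<Omega>') z) \<partial>leb2)"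
    unfolding \<nu>_def by (subst nn_integral_density) (auto simp: indicator_def intro!: nn_integral_cong)
  also have "\<dots> \<le> (\<integral>\<^sup>+ z. ennreal \<Lambda> * (ennreal (k (fst z) (snd z) / d z ^ DIM('a)) * (f z * indicator (\<Omega> \<times> \<Omega>') z)) \<partial>leb2)"
  proof (intro nn_integral_mono_AE)
    show "AE z in leb2. ennreal (1 / d z ^ DIM('a)) * (f z * indicator (\<Omega> \<times> \<Omega>') z)
       \<le> ennreal \<Lambda> * (ennreal (k (fst z) (snd z) / d z ^ DIM('a)) * (f z * indicator (\<Omega> \<times> \<Omega>') z))"
      using k_bounds
    proof eventually_elim
      case (elim z)
      moreover have "0 < 1 / \<Lambda>" using Lam by simp
      ultimately have "0 \<le> k (fst z) (snd z)" by linarith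
      moreover have "1 \<le> \<Lambda> * k (fst z) (snd z)" using elim Lam by (simp add: field_simps)
      ultimately have *: "1 \<le> \<Lambda> * k (fst z) (snd z)" "0 \<le> k (fst z) (snd z)" by auto
      then have "ennreal (1 / d z ^ DIM('a)) \<le> ennreal (\<Lambda> * (k (fst z) (snd z) / d z ^ DIM('a)))"
        using divide_right_mono[OF *(1), of "d z ^ DIM('a)"] by (intro ennreal_leI) auto
      also have "\<dots> = ennreal \<Lambda> * ennreal (k (fst z) (snd z) / d z ^ DIM('a))"
        using Lam * by (intro ennreal_mult) auto
      finally show ?case by (metis mult.assoc mult_right_mono zero_le)
    qed
  qed
  also have "\<dots> = ennreal \<Lambda> * (\<integral>\<^sup>+ z. f z * indicator (\<Omega> \<times> \<Omega>') z \<partial>\<kappa>)"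
    unfolding \<kappa>_def by (subst nn_integral_density) (auto simp: nn_integral_cmult)
  finally show ?thesis .
qed

end

section \<open>The basic estimates\<close>

context obst
begin

section \<open>Functions vanishing outside \<Omega> and a Poincare inequality\<close>

definition zero_out :: "('a \<Rightarrow> real) \<Rightarrow> bool" where
  "zero_out w \<longleftrightarrow> w \<in> borel_measurable lebesgue \<and> (AE x in lebesgue. x \<notin> \<Omega> \<longrightarrow> w x = 0)"

lemma zero_out_measurable: "zero_out w \<Longrightarrow> w \<in> borel_measurable lebesgue"
  by (simp add: zero_out_def)

lemma zero_out_AE: "zero_out w \<Longrightarrow> AE z in leb2. (fst z \<notin> \<Omega> \<longrightarrow> w (fst z) = 0) \<and> (snd z \<notin> \<Omega> \<longrightarrow> w (snd z) = 0)"
  unfolding zero_out_def using AE_pair_fst[of "\<lambda>x. x \<notin> \<Omega> \<longrightarrow> w x = 0"] AE_pair_snd[of "\<lambda>x. x \<notin> \<Omega> \<longrightarrow> w x = 0"]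
  by auto

lemma zero_out_lincomb:
  assumes "zero_out u" "zero_out w"
  shows "zero_out (\<lambda>x. a * u x + b * w x)"
  using assms unfolding zero_out_def by (auto elim!: eventually_elim2)

text \<open>Since functions vanishing outside \<open>\<Omega>\<close> see a set \<open>\<Omega>' - \<Omega>\<close> of positive measure on which they are
  zero, the Gagliardo modular controls the \<open>L\<^sup>G\<close> modular.\<close>

lemma poincare:
  obtains C where "0 \<le> C" "\<And>w. zero_out w \<Longrightarrow> rho leb\<Omega> w \<le> ennreal C * rho \<nu> (D w)"
proof (cases "\<Omega> = {}")
  case True
  have "AE x in leb\<Omega>. False" unfolding leb\<Omega>_def by (subst AE_density) (auto simp: True)
  then have "rho leb\<Omega> w = (\<integral>\<^sup>+ x. 0 \<partial>leb\<Omega>)" for w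
    unfolding rho_def by (intro nn_integral_cong_AE) (auto elim: eventually_mono)
  then have "rho leb\<Omega> w = 0" for w by simp
  then show ?thesis using that[of 0] by simp
next
  case False
  define U where "U = \<Omega>' - \<Omega>"
  have Ulm: "U \<in> lmeasurable"
    unfolding U_def by (intro fmeasurable.Diff lmeasurable_open opens)
  have Um [measurable]: "U \<in> sets lebesgue" using Ulm by (rule fmeasurableD)
  \<comment> \<open>Otherwise \<Omega>' would be open and closed, hence empty or the whole space;
    \<Omega> being nonempty and \<Omega>' bounded exclude both.\<close>
  have "\<Omega>' - closure \<Omega> \<noteq> {}"
  proof
    assume "\<Omega>' - closure \<Omega> = {}"
    then have "closure \<Omega> = \<Omega>'" using compin by auto
    then have "open \<Omega>'" "closed \<Omega>'" using opens by (auto simp flip: \<open>closure \<Omega> = \<Omega>'\<close>)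
    then have "\<Omega>' = {} \<or> \<Omega>' = UNIV" using clopen by blast
    then show False using False Omega_subset opens not_bounded_UNIV by auto
  qed
  moreover have "open (\<Omega>' - closure \<Omega>)" using opens by auto
  moreover have "\<Omega>' - closure \<Omega> \<subseteq> U" using closure_subset by (auto simp: U_def)
  ultimately have "\<not> negligible U" using open_not_negligible negligible_subset by blast
  then have "emeasure lebesgue U \<noteq> 0" using Um by (auto simp: negligible_iff_emeasure0)
  moreover have "emeasure lebesgue U = ennreal (measure lebesgue U)" using Ulm by (simp add: emeasure_eq_measure2)
  ultimately have Upos: "0 < measure lebesgue U" and Ueq: "emeasure lebesgue U = ennreal (measure lebesgue U)"
    by (auto simp: less_le)
  obtain R0 where R0: "\<And>x y. x \<in> \<Omega>' \<Longrightarrow> y \<in> \<Omega>' \<Longrightarrow> dist x y \<le> R0"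
    using opens(4) bounded_two_points by metis
  define R where "R = max 1 R0"
  have R: "1 \<le> R" "\<And>x y. x \<in> \<Omega>' \<Longrightarrow> y \<in> \<Omega>' \<Longrightarrow> dist x y \<le> R" using R0 by (auto simp: R_def le_max_iff_disj)
  \<comment> \<open>R^q is the price of pulling R out of \<open>G\<close>, and the power R^n that of
    bounding the kernel below by its value at distance R. Taking R \<ge> 1 ensures d^s \<le>
    R.\<close>
  define c where "c = R powr q * R ^ DIM('a)"
  define C where "C = c / measure lebesgue U"
  have c: "0 \<le> c" using R by (auto simp: c_def)
  have "rho leb\<Omega> w \<le> ennreal C * rho \<nu> (D w)" if w: "zero_out w" for w
  proof -
    have [measurable]: "w \<in> borel_measurable lebesgue" using w by (rule zero_out_measurable)
    have [measurable]: "\<Omega> \<times> \<Omega>' \<in> sets leb2" by (intro pair_measureI) auto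
    \<comment> \<open>Each value w x is spread over all y in U, where w y = 0 and therefore |D w (x,
      y)| = |w x| / |x - y|^s.\<close>
    have "rho leb\<Omega> w * emeasure lebesgue U = (\<integral>\<^sup>+ x. ennreal (G \<bar>w x\<bar>) * indicator \<Omega> x \<partial>lebesgue) * (\<integral>\<^sup>+ y. indicator U y \<partial>lebesgue)"
      by (simp add: modG_eq[symmetric] modG_def)
    also have "\<dots> = (\<integral>\<^sup>+ z. (ennreal (G \<bar>w (fst z)\<bar>) * indicator \<Omega> (fst z)) * indicator U (snd z) \<partial>leb2)"
      by (rule nn_integral_lebesgue_times[symmetric]) measurable
    also have "\<dots> \<le> (\<integral>\<^sup>+ z. ennreal c * (ennreal (indicator (\<Omega> \<times> \<Omega>') z / d z ^ DIM('a)) * ennreal (G \<bar>D w z\<bar>)) \<partial>leb2)"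
    proof (rule nn_integral_mono_AE)
      show "AE z in leb2. (ennreal (G \<bar>w (fst z)\<bar>) * indicator \<Omega> (fst z)) * indicator U (snd z)
          \<le> ennreal c * (ennreal (indicator (\<Omega> \<times> \<Omega>') z / d z ^ DIM('a)) * ennreal (G \<bar>D w z\<bar>))"
        using zero_out_AE[OF w]
      proof eventually_elim
        case (elim z)
        show ?case
        proof (cases "fst z \<in> \<Omega> \<and> snd z \<in> U")
          case True
          then have z: "z \<in> \<Omega> \<times> \<Omega>'" "w (snd z) = 0" "0 < d z" "d z \<le> R"
            using elim Omega_subset R(2)[of "fst z" "snd z"] by (auto simp: U_def d_def mem_Times_iff)
          have "d z powr s \<le> R powr s" using z s by (intro powr_mono2) auto
          also have "\<dots> \<le> R powr 1" using R s by (intro powr_mono) auto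
          finally have "d z powr s \<le> R" using R by simp
          then have "\<bar>w (fst z)\<bar> / R \<le> \<bar>D w z\<bar>" using z R by (auto simp: D_eq intro!: divide_left_mono)
          then have "R powr q * G (\<bar>w (fst z)\<bar> / R) \<le> R powr q * G \<bar>D w z\<bar>"
            using R by (intro mult_left_mono G_mono) auto
          moreover have "G \<bar>w (fst z)\<bar> \<le> R powr q * G (\<bar>w (fst z)\<bar> / R)"
            using G_scale_upper[of R "\<bar>w (fst z)\<bar> / R"] R by simp
          ultimately have "G \<bar>w (fst z)\<bar> \<le> R powr q * G \<bar>D w z\<bar>" by linarith
          also have "\<dots> \<le> R powr q * G \<bar>D w z\<bar> * (R ^ DIM('a) / d z ^ DIM('a))"
          proof -
            have "1 \<le> R ^ DIM('a) / d z ^ DIM('a)" using z by (auto simp: power_mono)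
            then have "R powr q * G \<bar>D w z\<bar> * 1 \<le> R powr q * G \<bar>D w z\<bar> * (R ^ DIM('a) / d z ^ DIM('a))"
              by (intro mult_left_mono) auto
            then show ?thesis by simp
          qed
          finally have "G \<bar>w (fst z)\<bar> \<le> c * ((1 / d z ^ DIM('a)) * G \<bar>D w z\<bar>)"
            by (simp add: c_def field_simps)
          then have "ennreal (G \<bar>w (fst z)\<bar>) \<le> ennreal (c * ((1 / d z ^ DIM('a)) * G \<bar>D w z\<bar>))" by (rule ennreal_leI)
          then show ?thesis using True z c by (simp add: ennreal_mult[symmetric])
        qed (auto simp: indicator_def)
      qed
    qed
    also have "\<dots> = ennreal c * rho \<nu> (D w)"
      unfolding rho_def \<nu>_def by (simp add: nn_integral_cmult nn_integral_density)
    finally have le: "rho leb\<Omega> w * ennreal (measure lebesgue U) \<le> ennreal c * rho \<nu> (D w)" by (simp add: Ueq)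
    have "rho leb\<Omega> w = rho leb\<Omega> w * ennreal (measure lebesgue U) * ennreal (1 / measure lebesgue U)"
      using Upos by (simp add: mult.assoc ennreal_mult[symmetric])
    also have "\<dots> \<le> ennreal c * rho \<nu> (D w) * ennreal (1 / measure lebesgue U)"
      by (intro mult_right_mono le) auto
    also have "\<dots> = ennreal C * rho \<nu> (D w)"
      using c Upos by (simp add: C_def ennreal_mult[symmetric] mult_ac divide_inverse)
        (simp add: ennreal_mult mult_ac)
    finally show ?thesis .
  qed
  moreover have "0 \<le> C" using c by (simp add: C_def)
  ultimately show ?thesis using that by blast
qed

section \<open>Nonlocal tails and the pairing estimate\<close>

definition tail :: "('a \<Rightarrow> real) \<Rightarrow> ennreal" where
  "tail u = (\<integral>\<^sup>+ x. ennreal (g (\<bar>u x\<bar> / (1 + norm x) powr s) / (1 + norm x) powr (real DIM('a) + s)) \<partial>lebesgue)"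

text \<open>What the pairing estimate asks of its first argument: membership in \<open>WsG\<close>
  together with a finite tail. Admissible functions inherit it from \<theta>.\<close>

definition base :: "('a \<Rightarrow> real) \<Rightarrow> bool" where
  "base u \<longleftrightarrow> u \<in> borel_measurable lebesgue \<and> rho leb\<Omega> u < \<infinity> \<and> rho \<nu> (D u) < \<infinity> \<and> tail u < \<infinity>"

lemma base_measurable: "base u \<Longrightarrow> u \<in> borel_measurable lebesgue"
  by (simp add: base_def)

lemma norm_measurable_lebesgue [measurable]: "(\<lambda>x::'a. norm x) \<in> borel_measurable lebesgue"
  by (rule measurable_compose[OF id_measurable_lebesgue]) simp

lemma tail_measurable [measurable (raw)]:
  assumes [measurable]: "u \<in> borel_measurable lebesgue"
  shows "(\<lambda>x. g (\<bar>u x\<bar> / (1 + norm x) powr s)) \<in> borel_measurable lebesgue"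
proof -
  have "(\<lambda>x. g \<bar>u x / (1 + norm x) powr s\<bar>) \<in> borel_measurable lebesgue" by measurable
  then show ?thesis by simp
qed

text \<open>\<Omega> and the complement of \<Omega>' have positive distance, so |x - y| dominates a
  multiple of 1 + |y|. The bound then separates into products of a function of x and a function of
  y, and the factors in y are the tail weights.\<close>

lemma far_bound:
  obtains c where "0 \<le> c"
    "\<And>u w x y. x \<in> \<Omega> \<Longrightarrow> y \<notin> \<Omega>' \<Longrightarrow> w y = 0 \<Longrightarrow>
      g \<bar>D u (x, y)\<bar> * \<bar>D w (x, y)\<bar> / d (x, y) ^ DIM('a) \<le>
      c * ((g \<bar>u x\<bar> * \<bar>w x\<bar>) * (1 / (1 + norm y) powr (real DIM('a) + s)) +
           \<bar>w x\<bar> * (g (\<bar>u y\<bar> / (1 + norm y) powr s) / (1 + norm y) powr (real DIM('a) + s)))"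
proof -
  have "compact (closure \<Omega>)" "closed (- \<Omega>')" "closure \<Omega> \<inter> - \<Omega>' = {}"
    using opens compin by auto
  then obtain \<delta> where \<delta>: "0 < \<delta>" "\<And>x y. x \<in> closure \<Omega> \<Longrightarrow> y \<in> - \<Omega>' \<Longrightarrow> \<delta> \<le> dist x y"
    using separate_compact_closed by metis
  obtain R where R: "0 \<le> R" "\<And>x. x \<in> \<Omega> \<Longrightarrow> norm x \<le> R"
    using opens(3) by (metis bounded_pos less_imp_le)
  \<comment> \<open>From 1 + |y| \<le> (1 + |x|) + r with 1 + |x| \<le> 1 + R and r \<ge> \<delta>,
    one gets 1 + |y| \<le> C r.\<close>
  define C where "C = 1 + (1 + R) / \<delta>"
  have C: "1 \<le> C" using \<delta> R by (simp add: C_def)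
  \<comment> \<open>q (2C)^q is the scaling cost of \<open>g\<close>, the 2 coming from splitting
    g(a + b); C^(n+s) comes from the kernel together with the denominator of D w.\<close>
  define c where "c = q * (2 * C) powr q * C powr (real DIM('a) + s)"
  have c: "0 \<le> c" using q_gt1 by (simp add: c_def)
  have "g \<bar>D u (x, y)\<bar> * \<bar>D w (x, y)\<bar> / d (x, y) ^ DIM('a) \<le>
      c * ((g \<bar>u x\<bar> * \<bar>w x\<bar>) * (1 / (1 + norm y) powr (real DIM('a) + s)) +
           \<bar>w x\<bar> * (g (\<bar>u y\<bar> / (1 + norm y) powr s) / (1 + norm y) powr (real DIM('a) + s)))"
    if x: "x \<in> \<Omega>" and y: "y \<notin> \<Omega>'" and wy: "w y = 0" for u w x y
  proof -
    define r where "r = dist x y"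
    define Y where "Y = 1 + norm y"
    have r: "\<delta> \<le> r" "0 < r" using \<delta> x y closure_subset[of \<Omega>] by (force simp: r_def)+
    have Y: "1 \<le> Y" by (simp add: Y_def)
    have "Y \<le> 1 + (norm x + r)"
      unfolding Y_def r_def using norm_triangle_ineq2[of y x] by (simp add: dist_norm norm_minus_commute)
    also have "\<dots> \<le> (1 + R) * (r / \<delta>) + r"
      using R(2)[OF x] mult_left_mono[of 1 "r / \<delta>" "1 + R"] r \<delta> R by simp
    also have "\<dots> = C * r" by (simp add: C_def algebra_simps)
    finally have YC: "Y / C \<le> r" using C by (simp add: field_simps)
    have pw: "1 / r powr e \<le> C powr e / Y powr e" if "0 \<le> e" for e
    proof -
      have "(Y / C) powr e \<le> r powr e" using YC that C Y by (intro powr_mono2) auto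
      then show ?thesis using r Y C by (simp add: powr_divide field_simps)
    qed
    have Ys: "1 \<le> Y powr s" using Y s by (simp add: ge_one_powr_ge_zero)
    have Cs: "C powr s \<le> C" using powr_mono[of s 1 C] C s by simp
    have "1 / r powr s \<le> C / Y powr s"
      using pw[of s] s Cs Ys by (auto elim!: order_trans intro!: divide_right_mono)
    then have "(\<bar>u x\<bar> + \<bar>u y\<bar>) * (1 / r powr s) \<le> (\<bar>u x\<bar> + \<bar>u y\<bar>) * (C / Y powr s)"
      by (intro mult_left_mono) auto
    moreover have "\<bar>D u (x, y)\<bar> \<le> (\<bar>u x\<bar> + \<bar>u y\<bar>) * (1 / r powr s)"
      using r by (simp add: D_eq d_def r_def abs_triangle_ineq4 divide_right_mono)
    moreover have "(\<bar>u x\<bar> + \<bar>u y\<bar>) * (C / Y powr s) \<le> C * \<bar>u x\<bar> + C * (\<bar>u y\<bar> / Y powr s)"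
    proof -
      have "\<bar>u x\<bar> * (C / Y powr s) \<le> \<bar>u x\<bar> * C" using Y Ys C divide_left_mono[of 1 "Y powr s" C] by (intro mult_left_mono) auto
      then show ?thesis by (simp add: algebra_simps)
    qed
    ultimately have "g \<bar>D u (x, y)\<bar> \<le> g (C * \<bar>u x\<bar> + C * (\<bar>u y\<bar> / Y powr s))" by (intro g_mono) auto
    also have "\<dots> \<le> g (2 * (C * \<bar>u x\<bar>)) + g (2 * (C * (\<bar>u y\<bar> / Y powr s)))"
      using C by (intro g_add_le) auto
    also have "\<dots> \<le> q * (2 * C) powr q * g \<bar>u x\<bar> + q * (2 * C) powr q * g (\<bar>u y\<bar> / Y powr s)"
      using g_scale[of "2 * C" "\<bar>u x\<bar>"] g_scale[of "2 * C" "\<bar>u y\<bar> / Y powr s"] C by (simp add: mult.assoc)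
    finally have 1: "g \<bar>D u (x, y)\<bar> \<le> q * (2 * C) powr q * (g \<bar>u x\<bar> + g (\<bar>u y\<bar> / Y powr s))"
      by (simp add: algebra_simps)
    have "\<bar>D w (x, y)\<bar> / r ^ DIM('a) = \<bar>w x\<bar> * (1 / r powr (real DIM('a) + s))"
      using wy r by (simp add: D_eq d_def r_def powr_add powr_realpow)
    also have "\<dots> \<le> \<bar>w x\<bar> * (C powr (real DIM('a) + s) / Y powr (real DIM('a) + s))"
      using s by (intro mult_left_mono pw) auto
    finally have 2: "\<bar>D w (x, y)\<bar> / r ^ DIM('a) \<le> \<bar>w x\<bar> * (C powr (real DIM('a) + s) / Y powr (real DIM('a) + s))" .
    have "g \<bar>D u (x, y)\<bar> * (\<bar>D w (x, y)\<bar> / r ^ DIM('a)) \<le>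
        q * (2 * C) powr q * (g \<bar>u x\<bar> + g (\<bar>u y\<bar> / Y powr s)) * (\<bar>w x\<bar> * (C powr (real DIM('a) + s) / Y powr (real DIM('a) + s)))"
      using 1 2 r q_gt1 by (intro mult_mono) (auto intro!: mult_nonneg_nonneg)
    then show ?thesis unfolding Y_def[symmetric] by (simp add: c_def d_def r_def algebra_simps add_divide_distrib)
  qed
  then show ?thesis using c that by blast
qed

lemma nn_integral_g_mult_le:
  assumes [measurable]: "f \<in> borel_measurable M" "f' \<in> borel_measurable M"
  shows "(\<integral>\<^sup>+ x. ennreal (g \<bar>f x\<bar> * \<bar>f' x\<bar>) \<partial>M) \<le> ennreal q * (rho M f + rho M f')"
proof -
  have "(\<integral>\<^sup>+ x. ennreal (g \<bar>f x\<bar> * \<bar>f' x\<bar>) \<partial>M) \<le> (\<integral>\<^sup>+ x. ennreal q * (ennreal (G \<bar>f x\<bar>) + ennreal (G \<bar>f' x\<bar>)) \<partial>M)"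
    using g_mult_le q_gt1 by (intro nn_integral_mono)
      (simp add: ennreal_plus[symmetric] ennreal_mult[symmetric] ennreal_leI del: ennreal_plus)
  then show ?thesis by (simp add: rho_def nn_integral_cmult nn_integral_add)
qed

text \<open>Pairs in \<Omega> \<times> \<Omega>' are handled by Young's inequality, pairs with y
  outside \<Omega>' by \<open>far_bound\<close>, whose products integrate factor by factor; the
  \<open>L^G\<close> modular of w is then absorbed by the Poincare inequality. The constant a is
  unavoidable in this form because Young's inequality is not homogeneous in w.\<close>

lemma key_bound:
  assumes u: "base u"
  obtains a b where "0 \<le> a" "0 \<le> b"
    "\<And>w. zero_out w \<Longrightarrow> (\<integral>\<^sup>+ z. ennreal (g \<bar>D u z\<bar> * \<bar>D w z\<bar>) \<partial>\<mu>) \<le> ennreal a + ennreal b * rho \<nu> (D w)"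
proof -
  have um [measurable]: "u \<in> borel_measurable lebesgue" using u by (rule base_measurable)
  obtain C where C: "0 \<le> C" "\<And>w. zero_out w \<Longrightarrow> rho leb\<Omega> w \<le> ennreal C * rho \<nu> (D w)" using poincare by blast
  obtain c where c: "0 \<le> c"
    "\<And>u w x y. x \<in> \<Omega> \<Longrightarrow> y \<notin> \<Omega>' \<Longrightarrow> w y = 0 \<Longrightarrow>
      g \<bar>D u (x, y)\<bar> * \<bar>D w (x, y)\<bar> / d (x, y) ^ DIM('a) \<le>
      c * ((g \<bar>u x\<bar> * \<bar>w x\<bar>) * (1 / (1 + norm y) powr (real DIM('a) + s)) +
           \<bar>w x\<bar> * (g (\<bar>u y\<bar> / (1 + norm y) powr s) / (1 + norm y) powr (real DIM('a) + s)))"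
    using far_bound by blast
  define b1 where "b1 y = ennreal (1 / (1 + norm y) powr (real DIM('a) + s))" for y :: 'a
  define b2 where "b2 y = ennreal (g (\<bar>u y\<bar> / (1 + norm y) powr s) / (1 + norm y) powr (real DIM('a) + s))" for y
  have [measurable]: "b1 \<in> borel_measurable lebesgue" "b2 \<in> borel_measurable lebesgue"
    unfolding b1_def[abs_def] b2_def[abs_def] by measurable
  define T where "T = (\<integral>\<^sup>+ y. b1 y \<partial>lebesgue)"
  have T: "T < \<infinity>" unfolding T_def b1_def using nn_integral_powr_tail_finite[OF s(1)] .
  define mO where "mO = emeasure lebesgue \<Omega>"
  have mO: "mO < \<infinity>" unfolding mO_def
    using fmeasurableD2[OF lmeasurable_open[OF opens(3,1)]] by (simp add: less_top del: emeasure_completion)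
  define Nu where "Nu = rho \<nu> (D u)"
  define Mu where "Mu = rho leb\<Omega> u"
  have fin: "Nu < \<infinity>" "Mu < \<infinity>" "tail u < \<infinity>" 
    using u unfolding base_def Nu_def Mu_def by blast+
  \<comment> \<open>\<open>a\<close> and \<open>b\<close> collect the terms without and with the
    modular of w: the first summand is the near part, the second the two far products; 2 comes from
    symmetrising.\<close>
  define a where "a = 2 * (ennreal q * Nu + ennreal c * (ennreal q * Mu * T + mO * tail u))"
  define b where "b = 2 * (ennreal q + ennreal c * (ennreal q * ennreal C * T + ennreal C * tail u))"
  have ab: "a < \<infinity>" "b < \<infinity>" using T mO fin by (auto simp: a_def b_def ennreal_mult_less_top)
  have main: "(\<integral>\<^sup>+ z. ennreal (g \<bar>D u z\<bar> * \<bar>D w z\<bar>) \<partial>\<mu>) \<le> a + b * rho \<nu> (D w)" if w: "zero_out w" for w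
  proof -
    have [measurable]: "w \<in> borel_measurable lebesgue" using w by (rule zero_out_measurable)
    have [measurable]: "\<Omega> \<times> \<Omega>' \<in> sets leb2" by (intro pair_measureI) auto
    define h where "h z = g \<bar>D u z\<bar> * \<bar>D w z\<bar> / d z ^ DIM('a)" for z
    have hm [measurable]: "h \<in> borel_measurable leb2" unfolding h_def[abs_def] by measurable
    have h0: "0 \<le> h z" for z by (simp add: h_def)
    have hsym: "h (snd z, fst z) = h z" for z
      by (simp add: h_def D_eq d_def dist_commute abs_minus_commute)
    define I1 where "I1 = (\<integral>\<^sup>+ z. ennreal (h z) * indicator \<Omega> (fst z) \<partial>leb2)"
    have "(\<integral>\<^sup>+ z. ennreal (g \<bar>D u z\<bar> * \<bar>D w z\<bar>) \<partial>\<mu>) = (\<integral>\<^sup>+ z. ennreal (h z) \<partial>leb2)"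
      unfolding \<mu>_def by (subst nn_integral_density) (auto simp: h_def ennreal_mult[symmetric])
    \<comment> \<open>D w vanishes almost everywhere when both points lie outside \<Omega>; by
      symmetry of the integrand the two remaining terms are equal.\<close>
    also have "\<dots> \<le> (\<integral>\<^sup>+ z. ennreal (h z) * indicator \<Omega> (fst z) + ennreal (h z) * indicator \<Omega> (snd z) \<partial>leb2)"
    proof (rule nn_integral_mono_AE)
      show "AE z in leb2. ennreal (h z) \<le> ennreal (h z) * indicator \<Omega> (fst z) + ennreal (h z) * indicator \<Omega> (snd z)"
        using zero_out_AE[OF w] by eventually_elim (auto simp: indicator_def h_def D_eq)
    qed
    also have "\<dots> = I1 + (\<integral>\<^sup>+ z. ennreal (h z) * indicator \<Omega> (snd z) \<partial>leb2)"
      unfolding I1_def by (rule nn_integral_add) measurable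
    also have "(\<integral>\<^sup>+ z. ennreal (h z) * indicator \<Omega> (snd z) \<partial>leb2) = I1"
      unfolding I1_def using nn_integral_lebesgue_swap[of "\<lambda>z. ennreal (h z) * indicator \<Omega> (fst z)"]
      by (simp add: hsym)
    finally have 1: "(\<integral>\<^sup>+ z. ennreal (g \<bar>D u z\<bar> * \<bar>D w z\<bar>) \<partial>\<mu>) \<le> 2 * I1" by (simp add: mult_2)
    define F1 where "F1 x = ennreal (g \<bar>u x\<bar> * \<bar>w x\<bar>) * indicator \<Omega> x" for x
    define F2 where "F2 x = ennreal \<bar>w x\<bar> * indicator \<Omega> x" for x
    have [measurable]: "F1 \<in> borel_measurable lebesgue" "F2 \<in> borel_measurable lebesgue"
      unfolding F1_def[abs_def] F2_def[abs_def] by measurable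
    \<comment> \<open>With x in \<Omega>, the first summand covers y in \<Omega>' and the products
      cover y outside \<Omega>'.\<close>
    have "I1 \<le> (\<integral>\<^sup>+ z. ennreal (indicator (\<Omega> \<times> \<Omega>') z / d z ^ DIM('a)) * ennreal (g \<bar>D u z\<bar> * \<bar>D w z\<bar>)
        + ennreal c * (F1 (fst z) * b1 (snd z) + F2 (fst z) * b2 (snd z)) \<partial>leb2)"
      unfolding I1_def
    proof (rule nn_integral_mono_AE)
      show "AE z in leb2. ennreal (h z) * indicator \<Omega> (fst z) \<le>
        ennreal (indicator (\<Omega> \<times> \<Omega>') z / d z ^ DIM('a)) * ennreal (g \<bar>D u z\<bar> * \<bar>D w z\<bar>)
        + ennreal c * (F1 (fst z) * b1 (snd z) + F2 (fst z) * b2 (snd z))"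
        using zero_out_AE[OF w]
      proof eventually_elim
        case (elim z)
        obtain x y where z: "z = (x, y)" by (cases z)
        consider "x \<notin> \<Omega>" | "x \<in> \<Omega>" "y \<in> \<Omega>'" | "x \<in> \<Omega>" "y \<notin> \<Omega>'" by blast
        then show ?case
        proof cases
          case 2
          then have "ennreal (h z) * indicator \<Omega> (fst z) = ennreal (indicator (\<Omega> \<times> \<Omega>') z / d z ^ DIM('a)) * ennreal (g \<bar>D u z\<bar> * \<bar>D w z\<bar>)"
            by (simp add: z h_def ennreal_mult[symmetric])
          then show ?thesis by simp
        next
          case 3
          then have "w y = 0" using elim Omega_subset z by auto
          then have "h z \<le> c * ((g \<bar>u x\<bar> * \<bar>w x\<bar>) * (1 / (1 + norm y) powr (real DIM('a) + s)) +
           \<bar>w x\<bar> * (g (\<bar>u y\<bar> / (1 + norm y) powr s) / (1 + norm y) powr (real DIM('a) + s)))"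
            using c(2)[of x y w u] 3 unfolding h_def z by blast
          then have "ennreal (h z) \<le> ennreal (c * ((g \<bar>u x\<bar> * \<bar>w x\<bar>) * (1 / (1 + norm y) powr (real DIM('a) + s)) +
           \<bar>w x\<bar> * (g (\<bar>u y\<bar> / (1 + norm y) powr s) / (1 + norm y) powr (real DIM('a) + s))))"
            by (rule ennreal_leI)
          also have "\<dots> = ennreal c * (ennreal (g \<bar>u x\<bar> * \<bar>w x\<bar>) * b1 y + ennreal \<bar>w x\<bar> * b2 y)"
            unfolding b1_def b2_def using c(1)
            by (simp add: ennreal_plus[symmetric] ennreal_mult[symmetric] del: ennreal_plus)
          finally show ?thesis using 3 by (simp add: z F1_def F2_def add_increasing)
        qed (simp add: z)
      qed
    qed
    also have "\<dots> = (\<integral>\<^sup>+ z. ennreal (indicator (\<Omega> \<times> \<Omega>') z / d z ^ DIM('a)) * ennreal (g \<bar>D u z\<bar> * \<bar>D w z\<bar>) \<partial>leb2)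
       + ennreal c * ((\<integral>\<^sup>+ z. F1 (fst z) * b1 (snd z) \<partial>leb2) + (\<integral>\<^sup>+ z. F2 (fst z) * b2 (snd z) \<partial>leb2))"
      by (simp add: nn_integral_add nn_integral_cmult)
    also have "(\<integral>\<^sup>+ z. ennreal (indicator (\<Omega> \<times> \<Omega>') z / d z ^ DIM('a)) * ennreal (g \<bar>D u z\<bar> * \<bar>D w z\<bar>) \<partial>leb2)
        = (\<integral>\<^sup>+ z. ennreal (g \<bar>D u z\<bar> * \<bar>D w z\<bar>) \<partial>\<nu>)"
      unfolding \<nu>_def by (rule nn_integral_density[symmetric]) measurable
    also have "(\<integral>\<^sup>+ z. F1 (fst z) * b1 (snd z) \<partial>leb2) = (\<integral>\<^sup>+ x. F1 x \<partial>lebesgue) * T"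
      unfolding T_def by (rule nn_integral_lebesgue_times) measurable
    also have "(\<integral>\<^sup>+ z. F2 (fst z) * b2 (snd z) \<partial>leb2) = (\<integral>\<^sup>+ x. F2 x \<partial>lebesgue) * tail u"
      unfolding tail_def b2_def[symmetric] by (rule nn_integral_lebesgue_times) measurable
    finally have I1: "I1 \<le> (\<integral>\<^sup>+ z. ennreal (g \<bar>D u z\<bar> * \<bar>D w z\<bar>) \<partial>\<nu>)
      + ennreal c * ((\<integral>\<^sup>+ x. F1 x \<partial>lebesgue) * T + (\<integral>\<^sup>+ x. F2 x \<partial>lebesgue) * tail u)" .
    have n1: "(\<integral>\<^sup>+ z. ennreal (g \<bar>D u z\<bar> * \<bar>D w z\<bar>) \<partial>\<nu>) \<le> ennreal q * (Nu + rho \<nu> (D w))"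
      unfolding Nu_def by (rule nn_integral_g_mult_le) measurable
    have n2: "(\<integral>\<^sup>+ x. F1 x \<partial>lebesgue) \<le> ennreal q * (Mu + ennreal C * rho \<nu> (D w))"
    proof -
      have "(\<integral>\<^sup>+ x. F1 x \<partial>lebesgue) = (\<integral>\<^sup>+ x. ennreal (g \<bar>u x\<bar> * \<bar>w x\<bar>) \<partial>leb\<Omega>)"
        unfolding F1_def leb\<Omega>_def by (subst nn_integral_density) (auto simp: mult.commute)
      also have "\<dots> \<le> ennreal q * (rho leb\<Omega> u + rho leb\<Omega> w)"
        by (rule nn_integral_g_mult_le) measurable
      also have "\<dots> \<le> ennreal q * (Mu + ennreal C * rho \<nu> (D w))"
        unfolding Mu_def by (intro mult_left_mono add_left_mono C(2)[OF w]) auto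
      finally show ?thesis .
    qed
    \<comment> \<open>The second far product contains |w| to the first power; t \<le> 1 + G t bounds
      it by |\<Omega>| plus the modular.\<close>
    have n3: "(\<integral>\<^sup>+ x. F2 x \<partial>lebesgue) \<le> mO + ennreal C * rho \<nu> (D w)"
    proof -
      have "(\<integral>\<^sup>+ x. F2 x \<partial>lebesgue) \<le> (\<integral>\<^sup>+ x. indicator \<Omega> x + ennreal (G \<bar>w x\<bar>) * indicator \<Omega> x \<partial>lebesgue)"
      proof (rule nn_integral_mono)
        fix x
        have "ennreal \<bar>w x\<bar> \<le> ennreal (1 + G \<bar>w x\<bar>)" by (intro ennreal_leI le_G) auto
        then show "F2 x \<le> indicator \<Omega> x + ennreal (G \<bar>w x\<bar>) * indicator \<Omega> x"
          by (simp add: F2_def indicator_def)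
      qed
      also have "\<dots> = mO + rho leb\<Omega> w"
        by (subst nn_integral_add) (simp_all add: mO_def modG_eq[symmetric] modG_def)
      also have "\<dots> \<le> mO + ennreal C * rho \<nu> (D w)" by (intro add_left_mono C(2)[OF w])
      finally show ?thesis .
    qed
    have "2 * I1 \<le> 2 * (ennreal q * (Nu + rho \<nu> (D w)) + ennreal c * (ennreal q * (Mu + ennreal C * rho \<nu> (D w)) * T + (mO + ennreal C * rho \<nu> (D w)) * tail u))"
      by (intro mult_left_mono order_trans[OF I1] add_mono mult_mono n1 n2 n3) auto
    also have "\<dots> = a + b * rho \<nu> (D w)"
      by (simp add: a_def b_def algebra_simps)
    finally show ?thesis using 1 by (rule order_trans[rotated])
  qed
  show ?thesis
  proof (rule that[of "enn2real a" "enn2real b"])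
    show "(\<integral>\<^sup>+ z. ennreal (g \<bar>D u z\<bar> * \<bar>D w z\<bar>) \<partial>\<mu>) \<le> ennreal (enn2real a) + ennreal (enn2real b) * rho \<nu> (D w)"
      if "zero_out w" for w using main[OF that] ab by simp
  qed auto
qed

end

section \<open>The spaces and the constraint set\<close>

context obst
begin

lemma D_lincomb: "D (\<lambda>x. a * u x + b * w x) = (\<lambda>z. a * D u z + b * D w z)"
  by (auto simp: D_eq algebra_simps add_divide_distrib diff_divide_distrib)

lemma D_add: "D (\<lambda>x. u x + w x) = (\<lambda>z. D u z + D w z)"
  using D_lincomb[of 1 u 1 w] by simp

lemma D_diff: "D (\<lambda>x. u x - w x) = (\<lambda>z. D u z - D w z)"
  using D_lincomb[of 1 u "-1" w] by simp

lemma WsG_iff: "u \<in> WsG G s \<Omega> \<Omega>' \<longleftrightarrow> u \<in> borel_measurable lebesgue \<and> rho leb\<Omega> u < \<infinity> \<and> rho \<nu> (D u) < \<infinity>"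
  by (auto simp: WsG_def modG_eq modGs_eq)

lemma rho_leb\<Omega>_finite:
  assumes "zero_out w" "rho \<nu> (D w) < \<infinity>"
  shows "rho leb\<Omega> w < \<infinity>"
proof -
  obtain C where "0 \<le> C" "\<And>w. zero_out w \<Longrightarrow> rho leb\<Omega> w \<le> ennreal C * rho \<nu> (D w)" using poincare by blast
  then have "rho leb\<Omega> w \<le> ennreal C * rho \<nu> (D w)" using assms by blast
  also have "\<dots> < \<infinity>" using assms by (simp add: ennreal_mult_less_top)
  finally show ?thesis .
qed

lemma emeasure_Omega_finite: "emeasure lebesgue \<Omega> < \<infinity>"
  using fmeasurableD2[OF lmeasurable_open[OF opens(3,1)]] by (simp add: less_top del: emeasure_completion)

text \<open>Altering a function inside \<Omega> changes its tail only by an integral over \<Omega>,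
  where the weights are at most 1 and g \<le> g 1 + q G applies.\<close>

lemma base_change:
  assumes v: "base v" and um [measurable]: "u \<in> borel_measurable lebesgue"
    and fin: "rho leb\<Omega> u < \<infinity>" "rho \<nu> (D u) < \<infinity>"
    and eq: "AE x in lebesgue. x \<notin> \<Omega> \<longrightarrow> u x = v x"
  shows "base u"
proof -
  have [measurable]: "v \<in> borel_measurable lebesgue" using v by (rule base_measurable)
  let ?t = "\<lambda>u x. g (\<bar>u x\<bar> / (1 + norm x) powr s) / (1 + norm x) powr (real DIM('a) + s)"
  have "tail u \<le> (\<integral>\<^sup>+ x. ennreal (?t v x) + (ennreal (g 1) * indicator \<Omega> x + ennreal q * (ennreal (G \<bar>u x\<bar>) * indicator \<Omega> x)) \<partial>lebesgue)"
    unfolding tail_def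
  proof (rule nn_integral_mono_AE)
    show "AE x in lebesgue. ennreal (?t u x) \<le> ennreal (?t v x) + (ennreal (g 1) * indicator \<Omega> x + ennreal q * (ennreal (G \<bar>u x\<bar>) * indicator \<Omega> x))"
      using eq
    proof eventually_elim
      case (elim x)
      show ?case
      proof (cases "x \<in> \<Omega>")
        case True
        have p: "1 \<le> (1 + norm x) powr s" "1 \<le> (1 + norm x) powr (real DIM('a) + s)"
          using s by (auto intro!: ge_one_powr_ge_zero)
        have "1 + norm x \<noteq> 0" using norm_ge_zero[of x] by linarith
        have "?t u x \<le> g (\<bar>u x\<bar> / (1 + norm x) powr s) / 1"
          using p by (intro divide_left_mono) auto
        also have "\<dots> \<le> g \<bar>u x\<bar>" using p \<open>1 + norm x \<noteq> 0\<close> divide_left_mono[of 1 "(1 + norm x) powr s" "\<bar>u x\<bar>"] by (auto intro!: g_mono)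
        also have "\<dots> \<le> g 1 + q * G \<bar>u x\<bar>" by (rule g_le_G) auto
        finally have "ennreal (?t u x) \<le> ennreal (g 1 + q * G \<bar>u x\<bar>)" by (rule ennreal_leI)
        also have "\<dots> = ennreal (g 1) + ennreal q * ennreal (G \<bar>u x\<bar>)" using q_gt1 by (simp add: ennreal_mult)
        finally show ?thesis using True by (simp add: add_increasing)
      qed (use elim in simp)
    qed
  qed
  also have "\<dots> = tail v + (ennreal (g 1) * emeasure lebesgue \<Omega> + ennreal q * rho leb\<Omega> u)"
    by (simp add: nn_integral_add nn_integral_cmult tail_def nn_integral_cmult_indicator modG_eq[symmetric] modG_def
        del: emeasure_completion)
  also have "\<dots> < \<infinity>" using v fin emeasure_Omega_finite by (auto simp: base_def ennreal_mult_less_top)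
  finally show ?thesis using um fin by (simp add: base_def)
qed

lemma base_theta: "base \<theta>"
  using theta unfolding base_def WsG_iff Lgs_def tail_def by blast

lemma base_add:
  assumes "base u" "zero_out w" "rho \<nu> (D w) < \<infinity>"
  shows "base (\<lambda>x. u x + w x)"
proof -
  have [measurable]: "u \<in> borel_measurable lebesgue" "w \<in> borel_measurable lebesgue"
    using assms by (auto intro: base_measurable zero_out_measurable)
  show ?thesis
  proof (rule base_change[OF assms(1)])
    show "rho leb\<Omega> (\<lambda>x. u x + w x) < \<infinity>"
    proof -
      have "rho leb\<Omega> u < \<infinity>" using assms(1) unfolding base_def by blast
      then show ?thesis using rho_lincomb_finite[of u leb\<Omega> w 1 1] rho_leb\<Omega>_finite[OF assms(2,3)] by simp
    qed
    show "rho \<nu> (D (\<lambda>x. u x + w x)) < \<infinity>"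
    proof -
      have "rho \<nu> (D u) < \<infinity>" using assms(1) unfolding base_def by blast
      then show ?thesis using rho_lincomb_finite[of "D u" \<nu> "D w" 1 1] assms(3) by (simp add: D_add)
    qed
    show "AE x in lebesgue. x \<notin> \<Omega> \<longrightarrow> u x + w x = u x"
      using assms(2) unfolding zero_out_def by (auto elim: eventually_mono)
  qed measurable
qed

section \<open>Test functions and the space of zero boundary values\<close>

lemma test_zero_out: "test_fun \<Omega> \<phi> \<Longrightarrow> zero_out \<phi>"
  using borel_measurable_continuous_onI[OF test_fun_continuous] test_fun_zero
  by (auto simp: zero_out_def intro!: measurable_completion AE_I2)

text \<open>A Lipschitz function has |D \<phi>| \<le> L r^(1-s) at distance r. Convexity of
  \<open>G\<close> makes G(|D \<phi>|) at most linear in r^(1-s), so the integrand is dominated by a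
  multiple of r^(1-s-n), integrable near the diagonal.\<close>

lemma test_rho_finite:
  assumes \<phi>: "test_fun \<Omega> \<phi>"
  shows "rho \<nu> (D \<phi>) < \<infinity>"
proof -
  have [measurable]: "\<phi> \<in> borel_measurable lebesgue" using test_zero_out[OF \<phi>] by (rule zero_out_measurable)
  obtain L where L: "0 \<le> L" "\<And>x y. \<bar>\<phi> x - \<phi> y\<bar> \<le> L * dist x y" using test_fun_lipschitz[OF \<phi>] by blast
  obtain R0 where R0: "\<And>x y. x \<in> \<Omega>' \<Longrightarrow> y \<in> \<Omega>' \<Longrightarrow> dist x y \<le> R0"
    using opens(4) bounded_two_points by metis
  define R where "R = max 1 R0"
  have R: "0 < R" "\<And>x y. x \<in> \<Omega>' \<Longrightarrow> y \<in> \<Omega>' \<Longrightarrow> dist x y \<le> R" using R0 by (auto simp: R_def le_max_iff_disj)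
  have "1 - s < real DIM('a)" using s DIM_positive[where 'a='a] by linarith
  then obtain C where C: "\<And>x::'a. (\<integral>\<^sup>+ y. ennreal (dist x y powr (1 - s) / dist x y ^ DIM('a)) * indicator (cball x R) y \<partial>lebesgue) \<le> ennreal C"
    using nn_integral_powr_ball_le[of "1 - s" R] s R by auto
  \<comment> \<open>From L r^(1-s) = (r/R)^(1-s) * (L R^(1-s)) with r \<le> R: the first factor can
    be pulled out of \<open>G\<close>.\<close>
  define K where "K = G (L * R powr (1 - s)) / R powr (1 - s)"
  have K: "0 \<le> K" using L by (simp add: K_def)
  have pt: "G \<bar>Ds s \<phi> x y\<bar> / dist x y ^ DIM('a) \<le> K * (dist x y powr (1 - s) / dist x y ^ DIM('a))"
    if "x \<in> \<Omega>'" "y \<in> \<Omega>'" for x y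
  proof (cases "x = y")
    case False
    define r where "r = dist x y"
    have r: "0 < r" "r \<le> R" using False R that by (auto simp: r_def)
    have "\<bar>Ds s \<phi> x y\<bar> \<le> L * r / r powr s"
      using L(2)[of x y] by (simp add: Ds_def r_def divide_right_mono)
    also have "\<dots> = (r / R) powr (1 - s) * (L * R powr (1 - s))"
      using r R by (simp add: powr_diff powr_divide field_simps)
    finally have "G \<bar>Ds s \<phi> x y\<bar> \<le> G ((r / R) powr (1 - s) * (L * R powr (1 - s)))" by (intro G_mono) auto
    also have "\<dots> \<le> (r / R) powr (1 - s) * G (L * R powr (1 - s))"
      using r R s L by (intro G_scale_small) (auto intro: powr_le1)
    also have "\<dots> = K * r powr (1 - s)" using r R by (simp add: K_def powr_divide)
    finally show ?thesis unfolding r_def[symmetric] using r by (simp add: divide_right_mono)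
  qed (simp add: Ds_def)
  have inner: "(\<integral>\<^sup>+ y. ennreal (G \<bar>Ds s \<phi> x y\<bar> / dist x y ^ DIM('a)) * indicator \<Omega>' y \<partial>lebesgue) \<le> ennreal K * ennreal C"
    if x: "x \<in> \<Omega>" for x
  proof -
    have [measurable]: "(\<lambda>y. dist x y) \<in> borel_measurable lebesgue"
      by (rule measurable_compose[OF id_measurable_lebesgue]) simp
    have [measurable]: "cball x R \<in> sets lebesgue"
      by (metis borel_closed closed_cball sets_completionI_sets sets_lborel)
    have "(\<integral>\<^sup>+ y. ennreal (G \<bar>Ds s \<phi> x y\<bar> / dist x y ^ DIM('a)) * indicator \<Omega>' y \<partial>lebesgue)
       \<le> (\<integral>\<^sup>+ y. ennreal K * (ennreal (dist x y powr (1 - s) / dist x y ^ DIM('a)) * indicator (cball x R) y) \<partial>lebesgue)"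
    proof (rule nn_integral_mono)
      fix y
      show "ennreal (G \<bar>Ds s \<phi> x y\<bar> / dist x y ^ DIM('a)) * indicator \<Omega>' y
        \<le> ennreal K * (ennreal (dist x y powr (1 - s) / dist x y ^ DIM('a)) * indicator (cball x R) y)"
        using pt[of x y] R(2)[of x y] x Omega_subset K
        by (cases "y \<in> \<Omega>'") (auto simp: ennreal_mult[symmetric] intro!: ennreal_leI)
    qed
    also have "\<dots> = ennreal K * (\<integral>\<^sup>+ y. ennreal (dist x y powr (1 - s) / dist x y ^ DIM('a)) * indicator (cball x R) y \<partial>lebesgue)"
      by (rule nn_integral_cmult) measurable
    also have "\<dots> \<le> ennreal K * ennreal C" by (intro mult_left_mono C) auto
    finally show ?thesis .
  qed
  have "rho \<nu> (D \<phi>) = modGs G s \<Omega> \<Omega>' \<phi>" by (simp add: modGs_eq)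
  also have "\<dots> \<le> (\<integral>\<^sup>+ x. ennreal K * ennreal C * indicator \<Omega> x \<partial>lebesgue)"
    unfolding modGs_def using inner by (intro nn_integral_mono) (auto simp: indicator_def)
  also have "\<dots> = ennreal K * ennreal C * emeasure lebesgue \<Omega>" by (rule nn_integral_cmult_indicator) simp
  also have "\<dots> < \<infinity>" using emeasure_Omega_finite by (simp add: ennreal_mult_less_top del: emeasure_completion)
  finally show ?thesis .
qed

text \<open>\<open>WsG0\<close> in modular form. Approximation is demanded for the Gagliardo modular
  alone, since the Poincare inequality supplies the \<open>L^G\<close> part.\<close>

definition W0 :: "('a \<Rightarrow> real) \<Rightarrow> bool" where
  "W0 w \<longleftrightarrow> zero_out w \<and> rho \<nu> (D w) < \<infinity> \<and>
     (\<forall>e>0. \<exists>\<phi>. test_fun \<Omega> \<phi> \<and> rho \<nu> (D (\<lambda>x. w x - \<phi> x)) \<le> ennreal e)"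

lemma W0_zero_out: "W0 w \<Longrightarrow> zero_out w" and W0_finite: "W0 w \<Longrightarrow> rho \<nu> (D w) < \<infinity>"
  by (auto simp: W0_def)

lemma zero_out_diff: "zero_out u \<Longrightarrow> zero_out w \<Longrightarrow> zero_out (\<lambda>x. u x - w x)"
  using zero_out_lincomb[of u w 1 "-1"] by simp

lemma rho_D_diff_finite:
  assumes "zero_out u" "zero_out w" "rho \<nu> (D u) < \<infinity>" "rho \<nu> (D w) < \<infinity>"
  shows "rho \<nu> (D (\<lambda>x. u x - w x)) < \<infinity>"
proof -
  have [measurable]: "u \<in> borel_measurable lebesgue" "w \<in> borel_measurable lebesgue"
    using assms by (auto intro: zero_out_measurable)
  show ?thesis using rho_lincomb_finite[of "D u" \<nu> "D w" 1 "-1"] assms by (simp add: D_diff)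
qed

text \<open>A norm below e \<le> 1 forces the modular below e, and a modular below e^q forces the
  Luxemburg norm below e, so approximation in norm and in modular agree.\<close>

lemma WsG0_iff: "w \<in> WsG0 G s \<Omega> \<Omega>' \<longleftrightarrow> W0 w"
proof
  assume "w \<in> WsG0 G s \<Omega> \<Omega>'"
  then obtain \<phi> :: "nat \<Rightarrow> 'a \<Rightarrow> real" where w: "w \<in> WsG G s \<Omega> \<Omega>'" "AE x in lebesgue. x \<notin> \<Omega> \<longrightarrow> w x = 0"
    and \<phi>: "\<And>j. test_fun \<Omega> (\<phi> j)" and lim: "(\<lambda>j. WsG_norm G s \<Omega> \<Omega>' (\<lambda>x. w x - \<phi> j x)) \<longlonglongrightarrow> 0"
    by (auto simp: WsG0_def)
  have z: "zero_out w" and fin: "rho \<nu> (D w) < \<infinity>" using w by (auto simp: WsG_iff zero_out_def)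
  have "\<exists>\<phi>. test_fun \<Omega> \<phi> \<and> rho \<nu> (D (\<lambda>x. w x - \<phi> x)) \<le> ennreal e" if e: "0 < e" for e
  proof -
    have "eventually (\<lambda>j. WsG_norm G s \<Omega> \<Omega>' (\<lambda>x. w x - \<phi> j x) < min e 1) sequentially"
      using lim e by (intro order_tendstoD) auto
    then obtain j where j: "WsG_norm G s \<Omega> \<Omega>' (\<lambda>x. w x - \<phi> j x) < min e 1"
      by (auto dest: eventually_happens)
    let ?v = "\<lambda>x. w x - \<phi> j x"
    have v: "zero_out ?v" "rho \<nu> (D ?v) < \<infinity>"
      by (intro zero_out_diff rho_D_diff_finite z fin test_zero_out test_rho_finite \<phi>)+
    have [measurable]: "?v \<in> borel_measurable lebesgue" using v by (intro zero_out_measurable)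
    have vO: "rho leb\<Omega> ?v < \<infinity>" using v by (rule rho_leb\<Omega>_finite)
    have "0 \<le> lux leb\<Omega> ?v" by (rule lux_nonneg(1)) (use vO in auto)
    then have "lux \<nu> (D ?v) < min e 1" using j by (simp add: WsG_norm_def luxG_eq luxGs_eq)
    then have "rho \<nu> (D ?v) \<le> ennreal (min e 1)" using v by (intro rho_le_lux) auto
    also have "\<dots> \<le> ennreal e" by (intro ennreal_leI) auto
    finally show ?thesis using \<phi> by blast
  qed
  then show "W0 w" using z fin by (simp add: W0_def)
next
  assume W: "W0 w"
  then have z: "zero_out w" and fin: "rho \<nu> (D w) < \<infinity>" by (auto simp: W0_def)
  have [measurable]: "w \<in> borel_measurable lebesgue" using z by (rule zero_out_measurable)
  obtain C where C: "0 \<le> C" "\<And>w. zero_out w \<Longrightarrow> rho leb\<Omega> w \<le> ennreal C * rho \<nu> (D w)" using poincare by blast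
  define t where "t j = 1 / real (Suc j)" for j
  have t: "0 < t j" "t j \<le> 1" for j by (auto simp: t_def)
  \<comment> \<open>Chosen so that both e j and C * e j are at most t j powr q; the second is needed
    for the \<open>L^G\<close> part.\<close>
  define e where "e j = t j powr q / (C + 1)" for j
  have "0 < e j" for j using t[of j] C by (simp add: e_def)
  then have "\<forall>j. \<exists>\<phi>. test_fun \<Omega> \<phi> \<and> rho \<nu> (D (\<lambda>x. w x - \<phi> x)) \<le> ennreal (e j)" using W by (simp add: W0_def)
  then obtain \<phi> where \<phi>: "\<And>j. test_fun \<Omega> (\<phi> j)" "\<And>j. rho \<nu> (D (\<lambda>x. w x - \<phi> j x)) \<le> ennreal (e j)" by metis
  have nb: "0 \<le> WsG_norm G s \<Omega> \<Omega>' (\<lambda>x. w x - \<phi> j x) \<and> WsG_norm G s \<Omega> \<Omega>' (\<lambda>x. w x - \<phi> j x) \<le> 2 * t j" for j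
  proof -
    let ?v = "\<lambda>x. w x - \<phi> j x"
    have v: "zero_out ?v" by (rule zero_out_diff[OF z test_zero_out[OF \<phi>(1)]])
    have [measurable]: "?v \<in> borel_measurable lebesgue" using v by (intro zero_out_measurable)
    have "e j \<le> t j powr q" using C by (simp add: e_def field_simps)
    then have 1: "rho \<nu> (D ?v) \<le> ennreal (t j powr q)" using \<phi>(2)[of j] by (meson ennreal_leI order_trans)
    have "rho leb\<Omega> ?v \<le> ennreal C * rho \<nu> (D ?v)" using C(2) v by blast
    also have "\<dots> \<le> ennreal C * ennreal (e j)" using \<phi>(2)[of j] by (intro mult_left_mono) auto
    also have "\<dots> = ennreal (C * e j)" using C \<open>\<And>j. 0 < e j\<close>[of j] by (intro ennreal_mult[symmetric]) auto
    also have "\<dots> \<le> ennreal (t j powr q)" using C by (intro ennreal_leI) (simp add: e_def field_simps)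
    finally have 2: "rho leb\<Omega> ?v \<le> ennreal (t j powr q)" .
    have "0 \<le> lux leb\<Omega> ?v" "lux leb\<Omega> ?v \<le> t j" by (rule lux_le[OF _ t 2]; simp)+
    moreover have "0 \<le> lux \<nu> (D ?v)" "lux \<nu> (D ?v) \<le> t j" by (rule lux_le[OF _ t 1]; simp)+
    ultimately show ?thesis by (simp add: WsG_norm_def luxG_eq luxGs_eq)
  qed
  have "t \<longlonglongrightarrow> 0" unfolding t_def using LIMSEQ_inverse_real_of_nat by (simp add: inverse_eq_divide)
  then have "(\<lambda>j. 2 * t j) \<longlonglongrightarrow> 2 * 0" by (rule tendsto_mult_left)
  then have lim: "(\<lambda>j. 2 * t j) \<longlonglongrightarrow> 0" by simp
  have "(\<lambda>j. WsG_norm G s \<Omega> \<Omega>' (\<lambda>x. w x - \<phi> j x)) \<longlonglongrightarrow> 0"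
    by (rule tendsto_sandwich[OF _ _ tendsto_const lim]; rule always_eventually; use nb in blast)
  moreover have "w \<in> WsG G s \<Omega> \<Omega>'" using z fin rho_leb\<Omega>_finite by (simp add: WsG_iff)
  ultimately show "w \<in> WsG0 G s \<Omega> \<Omega>'" using z \<phi>(1) by (auto simp: WsG0_def zero_out_def)
qed

lemma W0_test: "test_fun \<Omega> \<phi> \<Longrightarrow> W0 \<phi>"
proof -
  assume \<phi>: "test_fun \<Omega> \<phi>"
  have "rho \<nu> (D (\<lambda>x. \<phi> x - \<phi> x)) = 0" by (simp add: D_eq rho_def)
  then have "rho \<nu> (D (\<lambda>x. \<phi> x - \<phi> x)) \<le> ennreal e" for e by simp
  then show ?thesis unfolding W0_def using test_zero_out[OF \<phi>] test_rho_finite[OF \<phi>] \<phi> by blast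
qed

lemma rho_D_triangle:
  assumes "zero_out u" "zero_out v" "zero_out w"
  shows "rho \<nu> (D (\<lambda>x. u x - w x)) \<le> ennreal (2 powr q) * (rho \<nu> (D (\<lambda>x. u x - v x)) + rho \<nu> (D (\<lambda>x. v x - w x)))"
proof -
  have [measurable]: "u \<in> borel_measurable lebesgue" "v \<in> borel_measurable lebesgue" "w \<in> borel_measurable lebesgue"
    using assms by (auto intro: zero_out_measurable)
  show ?thesis using rho_add[of "D (\<lambda>x. u x - v x)" \<nu> "D (\<lambda>x. v x - w x)"] by (simp add: D_diff)
qed

text \<open>The quasi-triangle inequality lets a diagonal choice replace w' by a test function; both
  errors are taken as e / (2 * 2^q).\<close>

lemma W0_closed:
  assumes z: "zero_out w" and fin: "rho \<nu> (D w) < \<infinity>"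
    and ap: "\<And>e. 0 < e \<Longrightarrow> \<exists>w'. W0 w' \<and> rho \<nu> (D (\<lambda>x. w x - w' x)) \<le> ennreal e"
  shows "W0 w"
proof -
  have "\<exists>\<phi>. test_fun \<Omega> \<phi> \<and> rho \<nu> (D (\<lambda>x. w x - \<phi> x)) \<le> ennreal e" if e: "0 < e" for e
  proof -
    define e' where "e' = e / (2 * 2 powr q)"
    have e': "0 < e'" using e by (simp add: e'_def)
    obtain w' where w': "W0 w'" "rho \<nu> (D (\<lambda>x. w x - w' x)) \<le> ennreal e'" using ap[OF e'] by blast
    obtain \<phi> where \<phi>: "test_fun \<Omega> \<phi>" "rho \<nu> (D (\<lambda>x. w' x - \<phi> x)) \<le> ennreal e'" using w' e' by (auto simp: W0_def)
    have "rho \<nu> (D (\<lambda>x. w x - \<phi> x)) \<le> ennreal (2 powr q) * (rho \<nu> (D (\<lambda>x. w x - w' x)) + rho \<nu> (D (\<lambda>x. w' x - \<phi> x)))"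
      by (rule rho_D_triangle[OF z W0_zero_out[OF w'(1)] test_zero_out[OF \<phi>(1)]])
    also have "\<dots> \<le> ennreal (2 powr q) * (ennreal e' + ennreal e')"
      using w' \<phi> by (intro mult_left_mono add_mono) auto
    also have "\<dots> = ennreal e" using e' by (simp add: ennreal_plus[symmetric] ennreal_mult[symmetric] e'_def del: ennreal_plus)
    finally show ?thesis using \<phi> by blast
  qed
  then show ?thesis using z fin by (simp add: W0_def)
qed

lemma W0_lincomb:
  assumes "W0 u" "W0 w"
  shows "W0 (\<lambda>x. a * u x + b * w x)"
proof -
  have z: "zero_out u" "zero_out w" using assms by (auto intro: W0_zero_out)
  have [measurable]: "u \<in> borel_measurable lebesgue" "w \<in> borel_measurable lebesgue"
    using z by (auto intro: zero_out_measurable)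
  have fin: "rho \<nu> (D (\<lambda>x. a * u x + b * w x)) < \<infinity>"
    unfolding D_lincomb
    by (rule rho_lincomb_finite[OF _ _ W0_finite[OF assms(1)] W0_finite[OF assms(2)]]) measurable
  \<comment> \<open>Approximants are the same combinations of test functions;
    \<open>W0_closed\<close> then finishes, each coefficient costing its q-th power or at most
    1.\<close>
  have "\<exists>w'. W0 w' \<and> rho \<nu> (D (\<lambda>x. (a * u x + b * w x) - w' x)) \<le> ennreal e" if e: "0 < e" for e
  proof -
    define M where "M = max 1 \<bar>a\<bar> powr q + max 1 \<bar>b\<bar> powr q"
    have M: "0 < M" by (simp add: M_def add_pos_pos)
    define e' where "e' = e / (2 powr q * M)"
    have e': "0 < e'" using e M by (simp add: e'_def)
    obtain \<phi>1 where 1: "test_fun \<Omega> \<phi>1" "rho \<nu> (D (\<lambda>x. u x - \<phi>1 x)) \<le> ennreal e'" using assms(1) e' by (auto simp: W0_def)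
    obtain \<phi>2 where 2: "test_fun \<Omega> \<phi>2" "rho \<nu> (D (\<lambda>x. w x - \<phi>2 x)) \<le> ennreal e'" using assms(2) e' by (auto simp: W0_def)
    have [measurable]: "\<phi>1 \<in> borel_measurable lebesgue" "\<phi>2 \<in> borel_measurable lebesgue"
      using 1 2 by (auto intro!: zero_out_measurable test_zero_out)
    have eq: "D (\<lambda>x. (a * u x + b * w x) - (a * \<phi>1 x + b * \<phi>2 x)) = (\<lambda>z. a * D (\<lambda>x. u x - \<phi>1 x) z + b * D (\<lambda>x. w x - \<phi>2 x) z)"
      using D_lincomb[of a "\<lambda>x. u x - \<phi>1 x" b "\<lambda>x. w x - \<phi>2 x"] by (simp add: algebra_simps)
    have "rho \<nu> (D (\<lambda>x. (a * u x + b * w x) - (a * \<phi>1 x + b * \<phi>2 x)))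
       \<le> ennreal (2 powr q) * (rho \<nu> (\<lambda>z. a * D (\<lambda>x. u x - \<phi>1 x) z) + rho \<nu> (\<lambda>z. b * D (\<lambda>x. w x - \<phi>2 x) z))"
      unfolding eq by (rule rho_add) measurable
    also have "\<dots> \<le> ennreal (2 powr q) * (ennreal (max 1 \<bar>a\<bar> powr q) * rho \<nu> (D (\<lambda>x. u x - \<phi>1 x)) + ennreal (max 1 \<bar>b\<bar> powr q) * rho \<nu> (D (\<lambda>x. w x - \<phi>2 x)))"
      by (intro mult_left_mono add_mono rho_scale) auto
    also have "\<dots> \<le> ennreal (2 powr q) * (ennreal (max 1 \<bar>a\<bar> powr q) * ennreal e' + ennreal (max 1 \<bar>b\<bar> powr q) * ennreal e')"
      using 1 2 by (intro mult_left_mono add_mono) auto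
    also have "\<dots> = ennreal (2 powr q * (M * e'))"
      using e' by (simp add: ennreal_plus[symmetric] ennreal_mult[symmetric] M_def algebra_simps del: ennreal_plus)
    also have "2 powr q * (M * e') = e" using M by (simp add: e'_def)
    finally show ?thesis using W0_test[OF test_fun_lincomb[OF 1(1) 2(1), of a b]] by blast
  qed
  then show ?thesis using W0_closed zero_out_lincomb[OF z] fin by blast
qed

lemma W0_add: "W0 u \<Longrightarrow> W0 w \<Longrightarrow> W0 (\<lambda>x. u x + w x)"
  using W0_lincomb[of u w 1 1] by simp

lemma W0_diff: "W0 u \<Longrightarrow> W0 w \<Longrightarrow> W0 (\<lambda>x. u x - w x)"
  using W0_lincomb[of u w 1 "-1"] by simp

lemma base_add_W0: "base u \<Longrightarrow> W0 w \<Longrightarrow> base (\<lambda>x. u x + w x)"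
  by (intro base_add W0_zero_out W0_finite)

section \<open>The constraint set\<close>

abbreviation K :: "('a \<Rightarrow> real) set" where "K \<equiv> Kclass G s \<Omega> \<Omega>' \<psi> \<theta>"

text \<open>Membership in \<open>WsG\<close> comes for free: \<theta> lies in it, and adding a
  function from \<open>W0\<close> preserves the two finite modulars.\<close>

lemma K_iff: "u \<in> K \<longleftrightarrow> W0 (\<lambda>x. u x - \<theta> x) \<and> (AE x in lebesgue. x \<in> \<Omega> \<longrightarrow> \<psi> x \<le> ereal (u x))"
proof -
  have "u \<in> WsG G s \<Omega> \<Omega>'" if "W0 (\<lambda>x. u x - \<theta> x)"
    using base_add_W0[OF base_theta that] by (simp add: base_def WsG_iff)
  then show ?thesis by (auto simp: Kclass_def WsG0_iff)
qed

lemma K_base: "u \<in> K \<Longrightarrow> base u"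
  using base_add_W0[OF base_theta, of "\<lambda>x. u x - \<theta> x"] by (simp add: K_iff)

lemma K_diff: "u \<in> K \<Longrightarrow> v \<in> K \<Longrightarrow> W0 (\<lambda>x. u x - v x)"
  using W0_diff[of "\<lambda>x. u x - \<theta> x" "\<lambda>x. v x - \<theta> x"] by (simp add: K_iff)

lemma K_convex:
  assumes "u \<in> K" "v \<in> K" "0 \<le> t" "t \<le> 1"
  shows "(\<lambda>x. u x + t * (v x - u x)) \<in> K"
proof -
  have "W0 (\<lambda>x. 1 * (u x - \<theta> x) + t * (v x - u x))"
    using assms K_diff[of v u] by (intro W0_lincomb) (auto simp: K_iff)
  moreover have "AE x in lebesgue. x \<in> \<Omega> \<longrightarrow> \<psi> x \<le> ereal (u x) \<and> \<psi> x \<le> ereal (v x)"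
    using assms by (auto simp: K_iff elim: eventually_elim2)
  then have "AE x in lebesgue. x \<in> \<Omega> \<longrightarrow> \<psi> x \<le> ereal (u x + t * (v x - u x))"
  proof eventually_elim
    case (elim x)
    \<comment> \<open>Comparing with the minimum avoids arithmetic with the extended real value of
      the obstacle.\<close>
    have "min (u x) (v x) \<le> u x + t * (v x - u x)"
    proof (cases "u x \<le> v x")
      case True
      then have "0 \<le> t * (v x - u x)" using assms by (intro mult_nonneg_nonneg) auto
      then show ?thesis by simp
    next
      case False
      then have "1 * (v x - u x) \<le> t * (v x - u x)" using assms by (intro mult_right_mono_neg) auto
      then show ?thesis by simp
    qed
    then show ?case using elim by (auto simp: min_def split: if_splits intro: order_trans)
  qed
  ultimately show ?thesis by (simp add: K_iff algebra_simps)
qed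

end

section \<open>The functional\<close>

text \<open>The infima of \<open>P\<close> over the shrinking sublevel sets of \<open>J\<close>
  increase to a finite limit. Midpoints of two selected points stay in the sublevel set, so
  \<open>P\<close> cannot drop much at the midpoint, and the gap tends to 0 by minimality.\<close>

lemma two_level_minimising_sequence:
  fixes J P :: "'b \<Rightarrow> real" and mid :: "'b \<Rightarrow> 'b \<Rightarrow> 'b"
  assumes ne: "K \<noteq> {}"
    and mid: "\<And>u v. u \<in> K \<Longrightarrow> v \<in> K \<Longrightarrow> mid u v \<in> K"
      "\<And>u v. u \<in> K \<Longrightarrow> v \<in> K \<Longrightarrow> 2 * J (mid u v) \<le> J u + J v"
    and lower: "\<And>u. u \<in> K \<Longrightarrow> m \<le> J u"
    and P0: "\<And>u. u \<in> K \<Longrightarrow> 0 \<le> P u"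
    and bounded: "\<And>B. \<exists>C. \<forall>u\<in>K. J u \<le> B \<longrightarrow> P u \<le> C"
  obtains u :: "nat \<Rightarrow> 'b" and C where "\<And>n. u n \<in> K" "(\<lambda>n. J (u n)) \<longlonglongrightarrow> Inf (J ` K)" "\<And>n. P (u n) \<le> C"
    "\<And>e. 0 < e \<Longrightarrow> \<exists>M. \<forall>i\<ge>M. \<forall>j\<ge>M. P (u i) + P (u j) - 2 * P (mid (u i) (u j)) < e"
proof -
  define I where "I = Inf (J ` K)"
  have bdd: "bdd_below (J ` K)" using lower by (auto intro!: bdd_belowI[of _ m])
  have I_le: "I \<le> J u" if "u \<in> K" for u using that bdd unfolding I_def by (intro cInf_lower) auto
  define \<tau> where "\<tau> n = 1 / real (Suc n)" for n
  have \<tau>: "0 < \<tau> n" "\<tau> n \<le> 1" for n by (auto simp: \<tau>_def)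
  have \<tau>_mono: "\<tau> n \<le> \<tau> m" if "m \<le> n" for m n using that by (simp add: \<tau>_def frac_le)
  have \<tau>_lim: "\<tau> \<longlonglongrightarrow> 0" unfolding \<tau>_def using LIMSEQ_inverse_real_of_nat by (simp add: inverse_eq_divide)
  define S where "S n = {v \<in> K. J v \<le> I + \<tau> n}" for n
  have S_ne: "S n \<noteq> {}" for n
  proof -
    have "\<exists>y\<in>J ` K. y < I + \<tau> n" using ne \<tau>[of n] by (intro cInf_lessD) (auto simp: I_def)
    then show ?thesis by (auto simp: S_def intro: less_imp_le)
  qed
  have S_mono: "S n \<subseteq> S m" if "m \<le> n" for m n using \<tau>_mono[OF that] by (auto simp: S_def)
  obtain C where C: "\<And>u. u \<in> K \<Longrightarrow> J u \<le> I + 1 \<Longrightarrow> P u \<le> C" using bounded[of "I + 1"] by blast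
  have SC: "P u \<le> C" if "u \<in> S n" for u n using that \<tau>[of n] C[of u] by (simp add: S_def)
  define \<alpha> where "\<alpha> n = Inf (P ` S n)" for n
  have bddP: "bdd_below (P ` S n)" for n using P0 by (auto simp: S_def intro!: bdd_belowI[of _ 0])
  have \<alpha>_le: "\<alpha> n \<le> P u" if "u \<in> S n" for u n using that bddP unfolding \<alpha>_def by (intro cInf_lower) auto
  have "\<exists>v\<in>S n. P v \<le> \<alpha> n + \<tau> n" for n
  proof -
    have "\<exists>y\<in>P ` S n. y < \<alpha> n + \<tau> n" using S_ne \<tau>[of n] by (intro cInf_lessD) (auto simp: \<alpha>_def)
    then show ?thesis by (auto intro: less_imp_le)
  qed
  then obtain u where u: "\<And>n. u n \<in> S n" "\<And>n. P (u n) \<le> \<alpha> n + \<tau> n" by metis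
  have inc: "incseq \<alpha>"
    unfolding incseq_def \<alpha>_def using S_ne S_mono bddP by (auto intro!: cInf_superset_mono image_mono)
  have "\<alpha> n \<le> C" for n using \<alpha>_le[OF u(1)] SC[OF u(1)] by (rule order_trans)
  then obtain a where a: "\<alpha> \<longlonglongrightarrow> a" "\<And>n. \<alpha> n \<le> a" using incseq_convergent[OF inc, of C] by blast
  show ?thesis
  proof (rule that[of u C])
    show "u n \<in> K" for n using u(1)[of n] by (simp add: S_def)
    show "P (u n) \<le> C" for n using u(1) by (rule SC)
    have "(\<lambda>n. I + \<tau> n) \<longlonglongrightarrow> I + 0" by (intro tendsto_add tendsto_const \<tau>_lim)
    then have *: "(\<lambda>n. I + \<tau> n) \<longlonglongrightarrow> I" by simp
    have "I \<le> J (u n) \<and> J (u n) \<le> I + \<tau> n" for n using u(1)[of n] I_le[of "u n"] by (simp add: S_def)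
    then show "(\<lambda>n. J (u n)) \<longlonglongrightarrow> Inf (J ` K)"
      unfolding I_def[symmetric]
      by (intro tendsto_sandwich[OF always_eventually always_eventually tendsto_const *]) blast+
    show "\<exists>M. \<forall>i\<ge>M. \<forall>j\<ge>M. P (u i) + P (u j) - 2 * P (mid (u i) (u j)) < e" if e: "0 < e" for e
    proof -
      have "eventually (\<lambda>n. a - e / 4 < \<alpha> n) sequentially" using a e by (intro order_tendstoD) auto
      moreover have "eventually (\<lambda>n. \<tau> n < e / 4) sequentially" using \<tau>_lim e by (intro order_tendstoD) auto
      ultimately have "eventually (\<lambda>n. a - e / 4 < \<alpha> n \<and> \<tau> n < e / 4) sequentially" by eventually_elim simp
      then obtain M where M: "a - e / 4 < \<alpha> M" "\<tau> M < e / 4" by (auto dest: eventually_happens)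
      have "P (u i) + P (u j) - 2 * P (mid (u i) (u j)) < e" if ij: "M \<le> i" "M \<le> j" for i j
      proof -
        have "u i \<in> S M" "u j \<in> S M" using u(1) S_mono ij by blast+
        \<comment> \<open>This is where midpoint convexity of \<open>J\<close> is used. The values
          at the ends are below a + e/4 and the midpoint value is above a - e/4, so the gap is below
          e.\<close>
        then have "mid (u i) (u j) \<in> S M" using mid[of "u i" "u j"] by (auto simp: S_def)
        then have "\<alpha> M \<le> P (mid (u i) (u j))" by (rule \<alpha>_le)
        moreover have "P (u i) \<le> a + \<tau> M" "P (u j) \<le> a + \<tau> M"
          using u(2)[of i] u(2)[of j] a(2)[of i] a(2)[of j] \<tau>_mono[OF ij(1)] \<tau>_mono[OF ij(2)] by linarith+
        ultimately show ?thesis using M by linarith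
      qed
      then show ?thesis by blast
    qed
  qed
qed

context obst
begin

text \<open>Approximability by test functions, the remaining part of \<open>W0\<close>, is kept
  apart, since the estimates and the completeness argument only concern vanishing outside \<Omega>
  and finite modular.\<close>

definition V :: "('a \<Rightarrow> real) \<Rightarrow> bool" where "V w \<longleftrightarrow> zero_out w \<and> rho \<nu> (D w) < \<infinity>"
definition N :: "('a \<Rightarrow> real) \<Rightarrow> real" where "N w = enn2real (rho \<nu> (D w))"

lemma V_measurable: "V w \<Longrightarrow> w \<in> borel_measurable lebesgue"
  by (simp add: V_def zero_out_measurable)

lemma N_eq: "V w \<Longrightarrow> rho \<nu> (D w) = ennreal (N w)"
  by (simp add: V_def N_def)

lemma N_nonneg [simp]: "0 \<le> N w"
  by (simp add: N_def)

lemma W0_V: "W0 w \<Longrightarrow> V w"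
  by (simp add: W0_def V_def)

lemma V_lincomb: "V u \<Longrightarrow> V w \<Longrightarrow> V (\<lambda>x. a * u x + b * w x)"
  unfolding V_def D_lincomb
  by (intro conjI zero_out_lincomb rho_lincomb_finite) (auto dest: zero_out_measurable)

lemma V_diff: "V u \<Longrightarrow> V w \<Longrightarrow> V (\<lambda>x. u x - w x)"
  using V_lincomb[of u w 1 "-1"] by simp

lemma V_scale: "V u \<Longrightarrow> V (\<lambda>x. a * u x)"
  using V_lincomb[of u u a 0] by simp

lemma D_scale: "D (\<lambda>x. a * u x) = (\<lambda>z. a * D u z)"
  using D_lincomb[of a u 0 u] by simp

lemma N_scale_small:
  assumes w: "V w" and c: "0 < c" "c \<le> 1"
  shows "N (\<lambda>x. c * w x) \<le> c powr p * N w"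
proof -
  have [measurable]: "w \<in> borel_measurable lebesgue" using w by (rule V_measurable)
  have "ennreal (N (\<lambda>x. c * w x)) \<le> ennreal (c powr p) * ennreal (N w)"
    using rho_scale_small_p[of "D w" \<nu> c] c w by (simp add: N_eq[symmetric] V_scale D_scale)
  then show ?thesis using c by (simp add: ennreal_mult[symmetric])
qed

lemma N_scale_large:
  assumes w: "V w" and c: "1 \<le> c"
  shows "N (\<lambda>x. c * w x) \<le> c powr q * N w"
proof -
  have [measurable]: "w \<in> borel_measurable lebesgue" using w by (rule V_measurable)
  have "ennreal (N (\<lambda>x. c * w x)) \<le> ennreal (c powr q) * ennreal (N w)"
    using rho_scale[of "D w" \<nu> c] c w by (simp add: N_eq[symmetric] V_scale D_scale max_def)
  then show ?thesis using c by (simp add: ennreal_mult[symmetric])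
qed

section \<open>The energy pairing and its bounds\<close>

definition Q :: "('a \<Rightarrow> real) \<Rightarrow> ('a \<Rightarrow> real) \<Rightarrow> real" where
  "Q u w = (\<integral>z. g \<bar>D u z\<bar> * \<bar>D w z\<bar> \<partial>\<kappa>)"

lemma Q_bound:
  assumes u: "base u"
  obtains a b where "0 \<le> a" "0 \<le> b" "\<And>w. V w \<Longrightarrow> integrable \<kappa> (\<lambda>z. g \<bar>D u z\<bar> * \<bar>D w z\<bar>)"
    "\<And>w. V w \<Longrightarrow> Q u w \<le> a + b * N w"
proof -
  have [measurable]: "u \<in> borel_measurable lebesgue" using u by (rule base_measurable)
  obtain a b where ab: "0 \<le> a" "0 \<le> b"
    "\<And>w. zero_out w \<Longrightarrow> (\<integral>\<^sup>+ z. ennreal (g \<bar>D u z\<bar> * \<bar>D w z\<bar>) \<partial>\<mu>) \<le> ennreal a + ennreal b * rho \<nu> (D w)"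
    using key_bound[OF u] by blast
  have le: "(\<integral>\<^sup>+ z. ennreal (g \<bar>D u z\<bar> * \<bar>D w z\<bar>) \<partial>\<kappa>) \<le> ennreal (\<Lambda> * a + \<Lambda> * b * N w)" if w: "V w" for w
  proof -
    have [measurable]: "w \<in> borel_measurable lebesgue" using w by (rule V_measurable)
    have "(\<integral>\<^sup>+ z. ennreal (g \<bar>D u z\<bar> * \<bar>D w z\<bar>) \<partial>\<kappa>) \<le> ennreal \<Lambda> * (\<integral>\<^sup>+ z. ennreal (g \<bar>D u z\<bar> * \<bar>D w z\<bar>) \<partial>\<mu>)"
      by (rule nn_kappa_le) measurable
    also have "\<dots> \<le> ennreal \<Lambda> * (ennreal a + ennreal b * ennreal (N w))"
      using ab(3)[of w] w by (intro mult_left_mono) (auto simp: N_eq[symmetric] V_def)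
    also have "\<dots> = ennreal (\<Lambda> * a + \<Lambda> * b * N w)"
      using ab Lam by (simp add: ennreal_plus[symmetric] ennreal_mult[symmetric] algebra_simps del: ennreal_plus)
    finally show ?thesis .
  qed
  show ?thesis
  proof (rule that[of "\<Lambda> * a" "\<Lambda> * b"])
    fix w assume w: "V w"
    have [measurable]: "w \<in> borel_measurable lebesgue" using w by (rule V_measurable)
    show int: "integrable \<kappa> (\<lambda>z. g \<bar>D u z\<bar> * \<bar>D w z\<bar>)"
      using le[OF w] by (intro integrableI_nonneg) (auto elim: le_less_trans)
    have "ennreal (Q u w) = (\<integral>\<^sup>+ z. ennreal (g \<bar>D u z\<bar> * \<bar>D w z\<bar>) \<partial>\<kappa>)"
      unfolding Q_def by (rule nn_integral_eq_integral[symmetric, OF int]) auto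
    then have "ennreal (Q u w) \<le> ennreal (\<Lambda> * a + \<Lambda> * b * N w)" using le[OF w] by (simp only:)
    moreover have "0 \<le> \<Lambda> * a + \<Lambda> * b * N w" using ab Lam by simp
    ultimately show "Q u w \<le> \<Lambda> * a + \<Lambda> * b * N w" using ennreal_le_iff by blast
  qed (use ab Lam in auto)
qed

lemma Q_integrable: "base u \<Longrightarrow> V w \<Longrightarrow> integrable \<kappa> (\<lambda>z. g \<bar>D u z\<bar> * \<bar>D w z\<bar>)"
  using Q_bound by metis

lemma Q_scale: "0 \<le> c \<Longrightarrow> Q u (\<lambda>x. c * w x) = c * Q u w"
  unfolding Q_def D_scale by (simp add: abs_mult mult.left_commute)

definition E :: "('a \<Rightarrow> real) \<Rightarrow> ('a \<Rightarrow> real) \<Rightarrow> real" where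
  "E u w = (\<integral>z. A (D u z) * D w z \<partial>\<kappa>)"

lemma E_integrable:
  assumes "base u" "V w"
  shows "integrable \<kappa> (\<lambda>z. A (D u z) * D w z)"
proof -
  have [measurable]: "u \<in> borel_measurable lebesgue" "w \<in> borel_measurable lebesgue"
    using assms by (auto intro: base_measurable V_measurable)
  show ?thesis
    by (rule Bochner_Integration.integrable_bound[OF Q_integrable[OF assms]]) (auto simp: abs_mult abs_A)
qed

lemma E_le_Q: "base u \<Longrightarrow> V w \<Longrightarrow> \<bar>E u w\<bar> \<le> Q u w"
  unfolding E_def Q_def
  by (rule integral_abs_bound[THEN order_trans]) (simp add: abs_mult abs_A)

lemma E_scale: "E u (\<lambda>x. c * w x) = c * E u w"
  unfolding E_def D_scale by (simp add: mult.left_commute)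

text \<open>Apply the bound to c w with c small: the left side scales by c and the modular by at
  most c^p, so after division the coefficient of N w is b c^(p-1).\<close>

lemma Q_coercive:
  assumes u: "base u" and e: "0 < e"
  obtains C where "\<And>w. V w \<Longrightarrow> Q u w \<le> C + e * N w"
proof -
  obtain a b where ab: "0 \<le> a" "0 \<le> b" "\<And>w. V w \<Longrightarrow> Q u w \<le> a + b * N w" using Q_bound[OF u] by metis
  \<comment> \<open>Solves (b + 1) c^(p-1) = e, capped at 1 because the scaling of \<open>N\<close>
    requires c \<le> 1; b + 1 also covers b = 0.\<close>
  define c where "c = min 1 ((e / (b + 1)) powr (1 / (p - 1)))"
  have c: "0 < c" "c \<le> 1" using e ab by (auto simp: c_def)
  have "c powr (p - 1) \<le> ((e / (b + 1)) powr (1 / (p - 1))) powr (p - 1)"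
    using c p_gt1 by (intro powr_mono2) (auto simp: c_def)
  also have "\<dots> = e / (b + 1)" using e ab p_gt1 by (simp add: powr_powr)
  finally have cp: "(b + 1) * c powr (p - 1) \<le> e" using ab by (simp add: field_simps)
  have "Q u w \<le> a / c + e * N w" if w: "V w" for w
  proof -
    have "c * Q u w \<le> a + b * N (\<lambda>x. c * w x)" using ab(3)[OF V_scale[OF w, of c]] c by (simp add: Q_scale)
    also have "\<dots> \<le> a + b * (c powr p * N w)" using ab N_scale_small[OF w c] by (intro add_left_mono mult_left_mono) auto
    finally have "Q u w \<le> (a + b * (c powr p * N w)) / c" using c by (simp add: field_simps)
    also have "\<dots> = a / c + b * c powr (p - 1) * N w" using c by (simp add: powr_diff field_simps)
    also have "\<dots> \<le> a / c + e * N w"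
    proof -
      have "b * c powr (p - 1) \<le> (b + 1) * c powr (p - 1)" by (intro mult_right_mono) auto
      then show ?thesis using cp by (intro add_left_mono mult_right_mono) auto
    qed
    finally show ?thesis .
  qed
  then show ?thesis using that by blast
qed

text \<open>The rescaling is now by a large c: |E u w| \<le> a/c + b c^(q-1) N w. First c makes a/c
  small, then the modular of w n makes the second term small.\<close>

lemma E_continuous:
  assumes u: "base u" and w: "\<And>n. V (w n)" and lim: "(\<lambda>n. N (w n)) \<longlonglongrightarrow> 0"
  shows "(\<lambda>n. E u (w n)) \<longlonglongrightarrow> 0"
proof -
  obtain a b where ab: "0 \<le> a" "0 \<le> b" "\<And>w. V w \<Longrightarrow> Q u w \<le> a + b * N w" using Q_bound[OF u] by metis
  have le: "\<bar>E u v\<bar> \<le> (a + b * (c powr q * N v)) / c" if v: "V v" and c: "1 \<le> c" for v c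
  proof -
    have "c * \<bar>E u v\<bar> \<le> c * Q u v" using E_le_Q[OF u v] c by (intro mult_left_mono) auto
    also have "\<dots> \<le> a + b * N (\<lambda>x. c * v x)" using ab(3)[OF V_scale[OF v, of c]] c by (simp add: Q_scale)
    also have "\<dots> \<le> a + b * (c powr q * N v)" using ab N_scale_large[OF v c] by (intro add_left_mono mult_left_mono) auto
    finally show ?thesis using c by (simp add: field_simps)
  qed
  show ?thesis
  proof (rule LIMSEQ_I)
    fix r :: real assume r: "0 < r"
    \<comment> \<open>Ensures a < r * c, so the limit a / c of the bounds lies below r.\<close>
    define c where "c = max 1 (2 * (a + 1) / r)"
    have c: "1 \<le> c" "2 * (a + 1) / r \<le> c" by (auto simp: c_def)
    have "(\<lambda>n. (a + b * (c powr q * N (w n))) / c) \<longlonglongrightarrow> (a + b * (c powr q * 0)) / c"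
      using c by (intro tendsto_intros lim) auto
    moreover have "(a + b * (c powr q * 0)) / c < r"
    proof -
      have "a < r * c" using c(2) r ab by (simp add: field_simps)
      then show ?thesis using c by (simp add: field_simps)
    qed
    ultimately have "eventually (\<lambda>n. (a + b * (c powr q * N (w n))) / c < r) sequentially"
      by (rule order_tendstoD(2))
    then show "\<exists>no. \<forall>n\<ge>no. norm (E u (w n) - 0) < r"
      unfolding eventually_sequentially using le[OF w c(1)] by (auto intro: le_less_trans)
  qed
qed

lemma nu_kappa_integral:
  assumes [measurable]: "f \<in> borel_measurable leb2" and fin: "rho \<nu> f < \<infinity>"
  shows "integrable \<kappa> (\<lambda>z. indicator (\<Omega> \<times> \<Omega>') z * G \<bar>f z\<bar>)"
    "enn2real (rho \<nu> f) / \<Lambda> \<le> (\<integral>z. indicator (\<Omega> \<times> \<Omega>') z * G \<bar>f z\<bar> \<partial>\<kappa>)"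
proof -
  have [measurable]: "\<Omega> \<times> \<Omega>' \<in> sets leb2" by (intro pair_measureI) auto
  let ?h = "\<lambda>z. indicator (\<Omega> \<times> \<Omega>') z * G \<bar>f z\<bar>"
  have eq: "ennreal (?h z) = ennreal (G \<bar>f z\<bar>) * indicator (\<Omega> \<times> \<Omega>') z" for z by (simp add: indicator_def)
  have "(\<integral>\<^sup>+ z. ennreal (?h z) \<partial>\<kappa>) \<le> ennreal \<Lambda> * (\<integral>\<^sup>+ z. ennreal (?h z) \<partial>\<mu>)" by (rule nn_kappa_le) measurable
  also have "(\<integral>\<^sup>+ z. ennreal (?h z) \<partial>\<mu>) = rho \<nu> f" unfolding eq rho_def by (rule nn_mu_nu) measurable
  also have "ennreal \<Lambda> * rho \<nu> f < \<infinity>" using fin by (simp add: ennreal_mult_less_top)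
  finally show int: "integrable \<kappa> ?h" by (intro integrableI_nonneg) auto
  have "rho \<nu> f \<le> ennreal \<Lambda> * (\<integral>\<^sup>+ z. ennreal (?h z) \<partial>\<kappa>)" unfolding eq rho_def by (rule nn_nu_kappa) measurable
  also have "(\<integral>\<^sup>+ z. ennreal (?h z) \<partial>\<kappa>) = ennreal (\<integral>z. ?h z \<partial>\<kappa>)" by (rule nn_integral_eq_integral[OF int]) auto
  also have "ennreal \<Lambda> * ennreal (\<integral>z. ?h z \<partial>\<kappa>) = ennreal (\<Lambda> * (\<integral>z. ?h z \<partial>\<kappa>))"
    using Lam by (intro ennreal_mult[symmetric]) (auto intro!: integral_nonneg_AE)
  finally have "enn2real (rho \<nu> f) \<le> \<Lambda> * (\<integral>z. ?h z \<partial>\<kappa>)"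
    using Lam by (intro enn2real_leI) (auto intro!: mult_nonneg_nonneg integral_nonneg_AE)
  then show "enn2real (rho \<nu> f) / \<Lambda> \<le> (\<integral>z. ?h z \<partial>\<kappa>)" using Lam by (simp add: field_simps)
qed

text \<open>The difference is at most (g(|D v|) + g(|D u|)) |D (v - u)|, and the pairing estimate
  applies to both terms because v - u vanishes outside \<Omega>.\<close>

lemma G_diff_integrable:
  assumes u: "base u" and v: "base v" and w: "V (\<lambda>x. v x - u x)"
  shows "integrable \<kappa> (\<lambda>z. G \<bar>D v z\<bar> - G \<bar>D u z\<bar>)"
proof -
  have [measurable]: "u \<in> borel_measurable lebesgue" "v \<in> borel_measurable lebesgue"
    using assms by (auto intro: base_measurable)
  have "integrable \<kappa> (\<lambda>z. g \<bar>D v z\<bar> * \<bar>D (\<lambda>x. v x - u x) z\<bar> + g \<bar>D u z\<bar> * \<bar>D (\<lambda>x. v x - u x) z\<bar>)"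
    using Q_integrable[OF v w] Q_integrable[OF u w] by (rule Bochner_Integration.integrable_add)
  then show ?thesis
  proof (rule Bochner_Integration.integrable_bound)
    show "AE z in \<kappa>. norm (G \<bar>D v z\<bar> - G \<bar>D u z\<bar>) \<le>
       norm (g \<bar>D v z\<bar> * \<bar>D (\<lambda>x. v x - u x) z\<bar> + g \<bar>D u z\<bar> * \<bar>D (\<lambda>x. v x - u x) z\<bar>)"
    proof (rule AE_I2)
      fix z
      have "\<bar>G \<bar>D v z\<bar> - G \<bar>D u z\<bar>\<bar> \<le> (g \<bar>D v z\<bar> + g \<bar>D u z\<bar>) * \<bar>D v z - D u z\<bar>" by (rule G_diff_le)
      then show "norm (G \<bar>D v z\<bar> - G \<bar>D u z\<bar>) \<le>
       norm (g \<bar>D v z\<bar> * \<bar>D (\<lambda>x. v x - u x) z\<bar> + g \<bar>D u z\<bar> * \<bar>D (\<lambda>x. v x - u x) z\<bar>)"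
        by (simp add: D_diff distrib_right abs_of_nonneg)
    qed
  qed measurable
qed

text \<open>The integral of \<open>G(|D v|)\<close> over the whole space is infinite in general (only \<open>g(|\<theta>|)\<close>, not
  \<open>G(|\<theta>|)\<close>, is integrable at infinity), hence the renormalisation by \<open>\<theta>\<close>.\<close>

definition J :: "('a \<Rightarrow> real) \<Rightarrow> real" where
  "J v = (\<integral>z. G \<bar>D v z\<bar> - G \<bar>D \<theta> z\<bar> \<partial>\<kappa>)"

section \<open>Subgradients and coercivity of \<open>J\<close>\<close>

lemma K_V: "u \<in> K \<Longrightarrow> V (\<lambda>x. u x - \<theta> x)"
  by (simp add: K_iff W0_V)

lemma K_diff_V: "u \<in> K \<Longrightarrow> v \<in> K \<Longrightarrow> V (\<lambda>x. u x - v x)"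
  by (intro W0_V K_diff)

text \<open>The \<theta>-terms cancel in J v - J u, after which the pointwise subgradient inequality
  for G(|t|) is integrated.\<close>

lemma J_subgrad:
  assumes "u \<in> K" "v \<in> K"
  shows "E u (\<lambda>x. v x - u x) \<le> J v - J u"
proof -
  have "integrable \<kappa> (\<lambda>z. G \<bar>D v z\<bar> - G \<bar>D \<theta> z\<bar>)" "integrable \<kappa> (\<lambda>z. G \<bar>D u z\<bar> - G \<bar>D \<theta> z\<bar>)"
    using assms by (auto intro!: G_diff_integrable base_theta K_base K_V)
  then have "J v - J u = (\<integral>z. (G \<bar>D v z\<bar> - G \<bar>D \<theta> z\<bar>) - (G \<bar>D u z\<bar> - G \<bar>D \<theta> z\<bar>) \<partial>\<kappa>)"
    unfolding J_def by (rule Bochner_Integration.integral_diff[symmetric])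
  also have "\<dots> = (\<integral>z. G \<bar>D v z\<bar> - G \<bar>D u z\<bar> \<partial>\<kappa>)" by simp
  also have "\<dots> \<ge> E u (\<lambda>x. v x - u x)"
    unfolding E_def
  proof (rule integral_mono)
    show "integrable \<kappa> (\<lambda>z. A (D u z) * D (\<lambda>x. v x - u x) z)"
      using assms by (intro E_integrable K_base K_diff_V)
    show "integrable \<kappa> (\<lambda>z. G \<bar>D v z\<bar> - G \<bar>D u z\<bar>)"
      using assms by (intro G_diff_integrable K_base K_diff_V)
  qed (simp add: D_diff A_subgrad)
  finally show ?thesis .
qed

text \<open>On \<Omega> \<times> \<Omega>' the quasi-triangle inequality produces the modular of v -
  \<theta>. On all other pairs linearising at \<theta> loses at most Q \<theta> (v - \<theta>),
  which \<open>Q_coercive\<close> bounds by a small multiple of the same modular.\<close>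

lemma J_coercive:
  obtains c C where "0 < c" "\<And>v. v \<in> K \<Longrightarrow> c * N (\<lambda>x. v x - \<theta> x) - C \<le> J v"
proof -
  \<comment> \<open>The modular enters with coefficient 2^(-q)/\<Lambda> = 2 e; one e absorbs the
    loss, the other survives.\<close>
  define e where "e = 2 powr (- q) / (2 * \<Lambda>)"
  have e: "0 < e" using Lam by (simp add: e_def)
  obtain C1 where C1: "\<And>w. V w \<Longrightarrow> Q \<theta> w \<le> C1 + e * N w" using Q_coercive[OF base_theta e] by blast
  define T where "T = (\<integral>z. indicator (\<Omega> \<times> \<Omega>') z * G \<bar>D \<theta> z\<bar> \<partial>\<kappa>)"
  have [measurable]: "\<theta> \<in> borel_measurable lebesgue" using base_theta by (rule base_measurable)
  have th: "integrable \<kappa> (\<lambda>z. indicator (\<Omega> \<times> \<Omega>') z * G \<bar>D \<theta> z\<bar>)"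
    using base_theta by (intro nu_kappa_integral) (auto simp: base_def)
  have "e * N (\<lambda>x. v x - \<theta> x) - (2 * T + C1) \<le> J v" if v: "v \<in> K" for v
  proof -
    let ?w = "\<lambda>x. v x - \<theta> x"
    have w: "V ?w" using v by (rule K_V)
    have [measurable]: "?w \<in> borel_measurable lebesgue" using w by (rule V_measurable)
    have fin: "rho \<nu> (D ?w) < \<infinity>" using w by (simp add: V_def)
    have iw: "integrable \<kappa> (\<lambda>z. indicator (\<Omega> \<times> \<Omega>') z * G \<bar>D ?w z\<bar>)"
      "N ?w / \<Lambda> \<le> (\<integral>z. indicator (\<Omega> \<times> \<Omega>') z * G \<bar>D ?w z\<bar> \<partial>\<kappa>)"
      using nu_kappa_integral[of "D ?w"] fin by (auto simp: N_def)
    have Qi: "integrable \<kappa> (\<lambda>z. g \<bar>D \<theta> z\<bar> * \<bar>D ?w z\<bar>)" by (rule Q_integrable[OF base_theta w])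
    \<comment> \<open>One pointwise minorant for all pairs. The factor 2 before the \<theta>-term
      joins the one from the quasi-triangle inequality with the one subtracted in
      \<open>J\<close>.\<close>
    let ?l = "\<lambda>z. 2 powr (- q) * (indicator (\<Omega> \<times> \<Omega>') z * G \<bar>D ?w z\<bar>) - 2 * (indicator (\<Omega> \<times> \<Omega>') z * G \<bar>D \<theta> z\<bar>)
        - g \<bar>D \<theta> z\<bar> * \<bar>D ?w z\<bar>"
    have il: "integrable \<kappa> ?l"
      by (intro Bochner_Integration.integrable_diff integrable_mult_right iw th Qi)
    have "(\<integral>z. ?l z \<partial>\<kappa>) \<le> J v"
      unfolding J_def
    proof (rule integral_mono[OF il])
      show "integrable \<kappa> (\<lambda>z. G \<bar>D v z\<bar> - G \<bar>D \<theta> z\<bar>)" using v by (intro G_diff_integrable base_theta K_base K_V)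
      fix z
      show "?l z \<le> G \<bar>D v z\<bar> - G \<bar>D \<theta> z\<bar>"
      proof (cases "z \<in> \<Omega> \<times> \<Omega>'")
        case True
        have "G \<bar>D ?w z\<bar> \<le> 2 powr q * (G \<bar>D v z\<bar> + G \<bar>D \<theta> z\<bar>)" unfolding D_diff by (rule G_diff)
        then have "2 powr (- q) * G \<bar>D ?w z\<bar> \<le> G \<bar>D v z\<bar> + G \<bar>D \<theta> z\<bar>"
          by (simp add: powr_minus field_simps)
        moreover have "0 \<le> g \<bar>D \<theta> z\<bar> * \<bar>D ?w z\<bar>" by simp
        moreover have "indicator (\<Omega> \<times> \<Omega>') z = (1::real)" using True by simp
        ultimately show ?thesis by (simp only:)
      next
        case False
        have "A (D \<theta> z) * (D v z - D \<theta> z) \<le> G \<bar>D v z\<bar> - G \<bar>D \<theta> z\<bar>" by (rule A_subgrad)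
        moreover have "\<bar>A (D \<theta> z) * (D v z - D \<theta> z)\<bar> = g \<bar>D \<theta> z\<bar> * \<bar>D ?w z\<bar>"
          by (simp add: abs_mult abs_A D_diff)
        ultimately show ?thesis using False by simp
      qed
    qed
    moreover have "(\<integral>z. ?l z \<partial>\<kappa>) = 2 powr (- q) * (\<integral>z. indicator (\<Omega> \<times> \<Omega>') z * G \<bar>D ?w z\<bar> \<partial>\<kappa>) - 2 * T - Q \<theta> ?w"
      using iw(1) th Qi by (simp add: T_def Q_def)
    moreover have "2 powr (- q) * (N ?w / \<Lambda>) \<le> 2 powr (- q) * (\<integral>z. indicator (\<Omega> \<times> \<Omega>') z * G \<bar>D ?w z\<bar> \<partial>\<kappa>)"
      by (intro mult_left_mono iw) auto
    moreover have "2 powr (- q) * (N ?w / \<Lambda>) = 2 * (e * N ?w)" by (simp add: e_def)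
    ultimately show ?thesis using C1[OF w] by linarith
  qed
  then show ?thesis using e that by blast
qed

end

section \<open>Existence of a minimiser\<close>

context obst
begin

text \<open>The Poincare inequality passes the Cauchy property to the \<open>L^G\<close> modular on
  \<Omega>; a subsequence with summable increments converges almost everywhere, and Fatou returns to
  the Gagliardo modular of the full sequence.\<close>

lemma N_cauchy_complete:
  fixes w :: "nat \<Rightarrow> 'a \<Rightarrow> real"
  assumes w: "\<And>n. V (w n)"
    and cauchy: "\<And>e. 0 < e \<Longrightarrow> \<exists>M. \<forall>i\<ge>M. \<forall>j\<ge>M. N (\<lambda>x. w i x - w j x) \<le> e"
  obtains v and r :: "nat \<Rightarrow> nat" where "V v" "AE x in lebesgue. (\<lambda>k. w (r k) x) \<longlonglongrightarrow> v x"
    "(\<lambda>n. N (\<lambda>x. w n x - v x)) \<longlonglongrightarrow> 0"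
proof -
  have wm [measurable]: "w n \<in> borel_measurable lebesgue" for n using w by (rule V_measurable)
  obtain C where C: "0 \<le> C" "\<And>w. zero_out w \<Longrightarrow> rho leb\<Omega> w \<le> ennreal C * rho \<nu> (D w)" using poincare by blast
  \<comment> \<open>With the factor 2^k inside the modular, t \<le> 1 + G t turns the bound 1 into
    an L^1 bound of order 2^(-k) for the increments.\<close>
  have "\<exists>M. \<forall>i\<ge>M. \<forall>j\<ge>M. rho leb\<Omega> (\<lambda>x. 2 ^ k * (w i x - w j x)) \<le> 1" for k :: nat
  proof -
    define S where "S = (2 ^ k) powr q * (C + 1)"
    have S: "0 < S" using C by (simp add: S_def)
    obtain M where M: "\<And>i j. M \<le> i \<Longrightarrow> M \<le> j \<Longrightarrow> N (\<lambda>x. w i x - w j x) \<le> 1 / S"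
      using cauchy[of "1 / S"] S by auto
    have "rho leb\<Omega> (\<lambda>x. 2 ^ k * (w i x - w j x)) \<le> 1" if ij: "M \<le> i" "M \<le> j" for i j
    proof -
      have d: "V (\<lambda>x. w i x - w j x)" by (rule V_diff[OF w w])
      have "rho leb\<Omega> (\<lambda>x. 2 ^ k * (w i x - w j x)) \<le> ennreal (max 1 \<bar>2 ^ k\<bar> powr q) * rho leb\<Omega> (\<lambda>x. w i x - w j x)"
        by (rule rho_scale) measurable
      also have "\<dots> \<le> ennreal ((2 ^ k) powr q) * (ennreal C * ennreal (N (\<lambda>x. w i x - w j x)))"
        using C(2)[of "\<lambda>x. w i x - w j x"] d by (intro mult_mono) (auto simp: max_def V_def N_eq[OF d, symmetric])
      also have "\<dots> = ennreal ((2 ^ k) powr q * (C * N (\<lambda>x. w i x - w j x)))" using C by (simp add: ennreal_mult[symmetric])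
      also have "\<dots> \<le> ennreal ((2 ^ k) powr q * ((C + 1) * (1 / S)))"
        using M[OF ij] C by (intro ennreal_leI mult_left_mono mult_mono) auto
      also have "(2 ^ k) powr q * ((C + 1) * (1 / S)) = 1" using C by (simp add: S_def)
      finally show ?thesis by simp
    qed
    then show ?thesis by blast
  qed
  then obtain M where M: "\<And>k i j. M k \<le> i \<Longrightarrow> M k \<le> j \<Longrightarrow> rho leb\<Omega> (\<lambda>x. 2 ^ k * (w i x - w j x)) \<le> 1" by metis
  \<comment> \<open>The sum puts r k above M k, and adding k makes r strictly increasing.\<close>
  define r where "r k = (\<Sum>i\<le>k. M i) + k" for k
  have r: "strict_mono r" by (rule strict_monoI_Suc) (simp add: r_def)
  have rM: "M k \<le> r k" for k unfolding r_def by (rule trans_le_add1, rule member_le_sum) auto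
  define f where "f k x = \<bar>w (r (Suc k)) x - w (r k) x\<bar>" for k x
  have [measurable]: "f k \<in> borel_measurable lebesgue" for k unfolding f_def[abs_def] by measurable
  have "(\<integral>\<^sup>+ x. (\<Sum>k. ennreal (f k x)) \<partial>leb\<Omega>) = (\<Sum>k. \<integral>\<^sup>+ x. ennreal (f k x) \<partial>leb\<Omega>)"
    by (rule nn_integral_suminf) measurable
  also have "\<dots> \<le> (\<Sum>k. ennreal ((1 / 2) ^ k) * (emeasure lebesgue \<Omega> + 1))"
  proof (rule suminf_le)
    fix k
    have "(\<integral>\<^sup>+ x. ennreal (f k x) \<partial>leb\<Omega>) \<le> (\<integral>\<^sup>+ x. ennreal ((1 / 2) ^ k) * (1 + ennreal (G \<bar>2 ^ k * (w (r (Suc k)) x - w (r k) x)\<bar>)) \<partial>leb\<Omega>)"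
    proof (rule nn_integral_mono)
      fix x
      let ?y = "w (r (Suc k)) x - w (r k) x"
      have "f k x = (1 / 2) ^ k * \<bar>2 ^ k * ?y\<bar>" by (simp add: f_def abs_mult power_one_over)
      also have "\<dots> \<le> (1 / 2) ^ k * (1 + G \<bar>2 ^ k * ?y\<bar>)" by (intro mult_left_mono le_G) auto
      finally have "ennreal (f k x) \<le> ennreal ((1 / 2) ^ k * (1 + G \<bar>2 ^ k * ?y\<bar>))" by (rule ennreal_leI)
      also have "\<dots> = ennreal ((1 / 2) ^ k) * (1 + ennreal (G \<bar>2 ^ k * ?y\<bar>))"
        by (subst ennreal_mult) auto
      finally show "ennreal (f k x) \<le> ennreal ((1 / 2) ^ k) * (1 + ennreal (G \<bar>2 ^ k * ?y\<bar>))" .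
    qed
    also have "\<dots> = ennreal ((1 / 2) ^ k) * ((\<integral>\<^sup>+ x. 1 \<partial>leb\<Omega>) + rho leb\<Omega> (\<lambda>x. 2 ^ k * (w (r (Suc k)) x - w (r k) x)))"
      unfolding rho_def by (subst nn_integral_cmult, measurable, subst nn_integral_add) auto
    also have "(\<integral>\<^sup>+ x. 1 \<partial>leb\<Omega>) = emeasure lebesgue \<Omega>"
      unfolding leb\<Omega>_def by (subst nn_integral_density) auto
    also have "ennreal ((1 / 2) ^ k) * (emeasure lebesgue \<Omega> + rho leb\<Omega> (\<lambda>x. 2 ^ k * (w (r (Suc k)) x - w (r k) x)))
       \<le> ennreal ((1 / 2) ^ k) * (emeasure lebesgue \<Omega> + 1)"
    proof (intro mult_left_mono add_left_mono M)
      show "M k \<le> r (Suc k)" using rM[of k] strict_mono_less_eq[OF r, of k "Suc k"] by simp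
    qed (use rM in auto)
    finally show "(\<integral>\<^sup>+ x. ennreal (f k x) \<partial>leb\<Omega>) \<le> ennreal ((1 / 2) ^ k) * (emeasure lebesgue \<Omega> + 1)" .
  qed auto
  also have "\<dots> = (\<Sum>k. ennreal ((1 / 2) ^ k)) * (emeasure lebesgue \<Omega> + 1)" by (rule ennreal_suminf_multc)
  also have "(\<Sum>k. ennreal ((1 / 2) ^ k)) = ennreal (\<Sum>k. (1 / 2) ^ k)"
    by (rule suminf_ennreal2) (auto intro: summable_geometric)
  finally have "(\<integral>\<^sup>+ x. (\<Sum>k. ennreal (f k x)) \<partial>leb\<Omega>) < \<infinity>"
    using emeasure_Omega_finite by (auto simp: ennreal_mult_less_top elim!: le_less_trans simp del: emeasure_completion)
  then have "AE x in leb\<Omega>. (\<Sum>k. ennreal (f k x)) \<noteq> \<infinity>" by (intro nn_integral_PInf_AE) auto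
  then have "AE x in lebesgue. x \<in> \<Omega> \<longrightarrow> (\<Sum>k. ennreal (f k x)) \<noteq> \<infinity>"
    unfolding leb\<Omega>_def by (subst (asm) AE_density) (auto simp: indicator_def elim!: eventually_mono)
  moreover have "AE x in lebesgue. \<forall>n. x \<notin> \<Omega> \<longrightarrow> w n x = 0"
    using w unfolding AE_all_countable V_def zero_out_def by blast
  ultimately have ae: "AE x in lebesgue. convergent (\<lambda>k. w (r k) x) \<and> (x \<notin> \<Omega> \<longrightarrow> lim (\<lambda>k. w (r k) x) = 0)"
  proof eventually_elim
    case (elim x)
    show ?case
    proof (cases "x \<in> \<Omega>")
      case True
      then have "(\<Sum>k. ennreal (f k x)) \<noteq> top" using elim by simp
      then have "summable (\<lambda>k. f k x)" by (intro summable_suminf_not_top) (auto simp: f_def)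
      then have "summable (\<lambda>k. w (r (Suc k)) x - w (r k) x)" unfolding f_def by (rule summable_rabs_cancel)
      then have "convergent (\<lambda>n. \<Sum>k<n. w (r (Suc k)) x - w (r k) x)" by (simp add: summable_iff_convergent)
      then have "convergent (\<lambda>n. w (r n) x - w (r 0) x)" by (subst (asm) sum_lessThan_telescope)
      then have "convergent (\<lambda>n. (w (r n) x - w (r 0) x) + w (r 0) x)" by (intro convergent_add convergent_const)
      then show ?thesis using True by simp
    next
      case False
      then have "(\<lambda>k. w (r k) x) = (\<lambda>_. 0)" using elim by auto
      then show ?thesis by (simp add: convergent_const)
    qed
  qed
  define v where "v x = lim (\<lambda>k. w (r k) x)" for x
  have vm [measurable]: "v \<in> borel_measurable lebesgue" unfolding v_def[abs_def] by (rule borel_measurable_lim_metric) measurable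
  have zv: "zero_out v" unfolding zero_out_def v_def using vm[unfolded v_def[abs_def]] ae by (auto elim: eventually_mono)
  have conv: "AE x in lebesgue. (\<lambda>k. w (r k) x) \<longlonglongrightarrow> v x"
    using ae by eventually_elim (simp add: v_def convergent_LIMSEQ_iff)
  have Dconv: "AE z in \<nu>. (\<lambda>k. D (w (r k)) z) \<longlonglongrightarrow> D v z"
  proof (rule AE_dens)
    show "AE z in leb2. (\<lambda>k. D (w (r k)) z) \<longlonglongrightarrow> D v z"
      using AE_pair_fst[OF conv] AE_pair_snd[OF conv]
    proof eventually_elim
      case (elim z)
      then show ?case unfolding D_eq divide_inverse by (intro tendsto_mult_right tendsto_diff)
    qed
  qed
  \<comment> \<open>The Cauchy bound is uniform in the second index, which runs along the
    subsequence to v.\<close>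
  have fatou: "rho \<nu> (D (\<lambda>x. w n x - v x)) \<le> ennreal e"
    if e: "\<And>i j. M \<le> i \<Longrightarrow> M \<le> j \<Longrightarrow> N (\<lambda>x. w i x - w j x) \<le> e" and n: "M \<le> n" for n M e
  proof -
    have "rho \<nu> (D (\<lambda>x. w n x - v x)) = (\<integral>\<^sup>+ z. liminf (\<lambda>k. ennreal (G \<bar>D (\<lambda>x. w n x - w (r k) x) z\<bar>)) \<partial>\<nu>)"
      unfolding rho_def
    proof (rule nn_integral_cong_AE)
      show "AE z in \<nu>. ennreal (G \<bar>D (\<lambda>x. w n x - v x) z\<bar>) = liminf (\<lambda>k. ennreal (G \<bar>D (\<lambda>x. w n x - w (r k) x) z\<bar>))"
        using Dconv
      proof eventually_elim
        case (elim z)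
        then have "(\<lambda>k. D (w n) z - D (w (r k)) z) \<longlonglongrightarrow> D (w n) z - D v z" by (intro tendsto_diff tendsto_const)
        then have "(\<lambda>k. G \<bar>D (w n) z - D (w (r k)) z\<bar>) \<longlonglongrightarrow> G \<bar>D (w n) z - D v z\<bar>"
          by (rule continuous_on_tendsto_compose[OF G_abs_continuous]) auto
        then have "(\<lambda>k. ennreal (G \<bar>D (w n) z - D (w (r k)) z\<bar>)) \<longlonglongrightarrow> ennreal (G \<bar>D (w n) z - D v z\<bar>)"
          by (rule tendsto_ennrealI)
        then show ?case unfolding D_diff by (rule lim_imp_Liminf[symmetric, rotated]) simp
      qed
    qed
    also have "\<dots> \<le> liminf (\<lambda>k. \<integral>\<^sup>+ z. ennreal (G \<bar>D (\<lambda>x. w n x - w (r k) x) z\<bar>) \<partial>\<nu>)"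
      by (rule nn_integral_liminf) measurable
    also have "\<dots> \<le> ennreal e"
    proof (rule Liminf_le)
      show "eventually (\<lambda>k. (\<integral>\<^sup>+ z. ennreal (G \<bar>D (\<lambda>x. w n x - w (r k) x) z\<bar>) \<partial>\<nu>) \<le> ennreal e) sequentially"
        unfolding eventually_sequentially
      proof (intro exI allI impI)
        fix k assume "M \<le> k"
        then have "M \<le> r k" using seq_suble[OF r, of k] by linarith
        then have "N (\<lambda>x. w n x - w (r k) x) \<le> e" using e n by blast
        then show "(\<integral>\<^sup>+ z. ennreal (G \<bar>D (\<lambda>x. w n x - w (r k) x) z\<bar>) \<partial>\<nu>) \<le> ennreal e"
          using N_eq[OF V_diff[OF w w], of n "r k"] by (simp add: rho_def[symmetric] ennreal_leI)
      qed
    qed simp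
    finally show ?thesis .
  qed
  obtain M1 where "\<And>i j. M1 \<le> i \<Longrightarrow> M1 \<le> j \<Longrightarrow> N (\<lambda>x. w i x - w j x) \<le> 1" using cauchy[of 1] by auto
  then have "rho \<nu> (D (\<lambda>x. w M1 x - v x)) \<le> ennreal 1" by (rule fatou) auto
  also have "\<dots> < \<infinity>" by simp
  finally have "V (\<lambda>x. w M1 x - v x)"
    using zero_out_diff[of "w M1" v] w[of M1] zv unfolding V_def by blast
  then have "V (\<lambda>x. w M1 x - (w M1 x - v x))" by (rule V_diff[OF w])
  then have Vv: "V v" by simp
  show ?thesis
  proof (rule that[OF Vv conv LIMSEQ_I])
    fix e :: real assume e: "0 < e"
    then have "0 < e / 2" by simp
    then obtain M where M: "\<And>i j. M \<le> i \<Longrightarrow> M \<le> j \<Longrightarrow> N (\<lambda>x. w i x - w j x) \<le> e / 2" using cauchy by blast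
    have "N (\<lambda>x. w n x - v x) \<le> e / 2" if "M \<le> n" for n
      using fatou[OF M that] N_eq[OF V_diff[OF w Vv]] e by simp
    then show "\<exists>M. \<forall>n\<ge>M. norm (N (\<lambda>x. w n x - v x) - 0) < e"
      using e by (intro exI[of _ M]) fastforce
  qed
qed

section \<open>The uniformly convex companion modular\<close>

definition P :: "('a \<Rightarrow> real) \<Rightarrow> real" where "P w = (\<integral>z. Phi \<bar>D w z\<bar> \<partial>\<nu>)"

lemma N_integral:
  assumes w: "V w"
  shows "integrable \<nu> (\<lambda>z. G \<bar>D w z\<bar>)" "N w = (\<integral>z. G \<bar>D w z\<bar> \<partial>\<nu>)"
proof -
  have [measurable]: "w \<in> borel_measurable lebesgue" using w by (rule V_measurable)
  show int: "integrable \<nu> (\<lambda>z. G \<bar>D w z\<bar>)"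
    using w by (intro integrableI_nonneg) (auto simp: V_def rho_def)
  show "N w = (\<integral>z. G \<bar>D w z\<bar> \<partial>\<nu>)"
    unfolding N_def rho_def by (subst nn_integral_eq_integral[OF int]) (auto intro!: enn2real_ennreal integral_nonneg_AE)
qed

lemma P_integrable:
  assumes w: "V w"
  shows "integrable \<nu> (\<lambda>z. Phi \<bar>D w z\<bar>)"
proof -
  have [measurable]: "w \<in> borel_measurable lebesgue" using w by (rule V_measurable)
  show ?thesis
    by (rule Bochner_Integration.integrable_bound[OF N_integral(1)[OF w]]) (auto simp: Phi_le_G)
qed

lemma P_le_N: "V w \<Longrightarrow> P w \<le> N w"
  unfolding P_def by (subst N_integral(2)) (auto intro!: integral_mono P_integrable N_integral(1) Phi_le_G)

lemma N_le_P: "V w \<Longrightarrow> N w \<le> 2 powr q * P w"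
proof -
  assume w: "V w"
  have "N w \<le> (\<integral>z. 2 powr q * Phi \<bar>D w z\<bar> \<partial>\<nu>)"
    unfolding N_integral(2)[OF w]
    by (intro integral_mono N_integral(1) integrable_mult_right P_integrable w G_le_Phi) auto
  then show ?thesis by (simp add: P_def)
qed

lemma N_uniformly_convex:
  assumes "0 < \<epsilon>" "\<epsilon> \<le> 1"
  obtains c where "0 < c" "\<And>u w. V u \<Longrightarrow> V w \<Longrightarrow>
    N (\<lambda>x. u x - w x) \<le> \<epsilon> * (N u + N w) + c * (P u + P w - 2 * P (\<lambda>x. (u x + w x) / 2))"
proof -
  obtain c where c: "0 < c"
    "\<And>a b. G \<bar>a - b\<bar> \<le> \<epsilon> * (G \<bar>a\<bar> + G \<bar>b\<bar>) + c * (Phi \<bar>a\<bar> + Phi \<bar>b\<bar> - 2 * Phi \<bar>(a + b) / 2\<bar>)"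
    using Phi_uniformly_convex[OF assms] by blast
  have "N (\<lambda>x. u x - w x) \<le> \<epsilon> * (N u + N w) + c * (P u + P w - 2 * P (\<lambda>x. (u x + w x) / 2))"
    if u: "V u" and w: "V w" for u w
  proof -
    have m: "V (\<lambda>x. (u x + w x) / 2)" using V_lincomb[OF u w, of "1/2" "1/2"] by (simp add: add_divide_distrib)
    have dm: "D (\<lambda>x. (u x + w x) / 2) = (\<lambda>z. (D u z + D w z) / 2)"
      using D_lincomb[of "1/2" u "1/2" w] by (simp add: add_divide_distrib)
    note int = N_integral(1)[OF u] N_integral(1)[OF w] P_integrable[OF u] P_integrable[OF w] P_integrable[OF m, unfolded dm]
    have "N (\<lambda>x. u x - w x) = (\<integral>z. G \<bar>D u z - D w z\<bar> \<partial>\<nu>)" using N_integral(2)[OF V_diff[OF u w]] by (simp add: D_diff)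
    also have "\<dots> \<le> (\<integral>z. \<epsilon> * (G \<bar>D u z\<bar> + G \<bar>D w z\<bar>) + c * (Phi \<bar>D u z\<bar> + Phi \<bar>D w z\<bar> - 2 * Phi \<bar>(D u z + D w z) / 2\<bar>) \<partial>\<nu>)"
    proof (rule integral_mono)
      show "integrable \<nu> (\<lambda>z. G \<bar>D u z - D w z\<bar>)" using N_integral(1)[OF V_diff[OF u w]] by (simp add: D_diff)
      show "integrable \<nu> (\<lambda>z. \<epsilon> * (G \<bar>D u z\<bar> + G \<bar>D w z\<bar>) + c * (Phi \<bar>D u z\<bar> + Phi \<bar>D w z\<bar> - 2 * Phi \<bar>(D u z + D w z) / 2\<bar>))"
        by (intro Bochner_Integration.integrable_add Bochner_Integration.integrable_diff integrable_mult_right int)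
    qed (rule c(2))
    also have "\<dots> = \<epsilon> * (N u + N w) + c * (P u + P w - 2 * P (\<lambda>x. (u x + w x) / 2))"
      using int unfolding N_integral(2)[OF u] N_integral(2)[OF w] P_def dm by simp
    finally show ?thesis .
  qed
  then show ?thesis using c(1) that by blast
qed

lemma minimiser_exists:
  assumes ne: "K \<noteq> {}"
  obtains u where "u \<in> K" "\<And>v. v \<in> K \<Longrightarrow> J u \<le> J v"
proof -
  define mid where "mid u v = (\<lambda>x. (u x + v x) / 2)" for u v :: "'a \<Rightarrow> real"
  define P' where "P' u = P (\<lambda>x. u x - \<theta> x)" for u
  obtain c0 C0 where C0: "0 < c0" "\<And>v. v \<in> K \<Longrightarrow> c0 * N (\<lambda>x. v x - \<theta> x) - C0 \<le> J v" using J_coercive by blast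
  have mid_K: "mid u v \<in> K" if "u \<in> K" "v \<in> K" for u v
  proof -
    have "(\<lambda>x. u x + 1/2 * (v x - u x)) = mid u v" by (auto simp: mid_def field_simps)
    then show ?thesis using K_convex[OF that, of "1/2"] by simp
  qed
  obtain u :: "nat \<Rightarrow> 'a \<Rightarrow> real" and C where u: "\<And>n. u n \<in> K" "(\<lambda>n. J (u n)) \<longlonglongrightarrow> Inf (J ` K)" "\<And>n. P' (u n) \<le> C"
    "\<And>e. 0 < e \<Longrightarrow> \<exists>M. \<forall>i\<ge>M. \<forall>j\<ge>M. P' (u i) + P' (u j) - 2 * P' (mid (u i) (u j)) < e"
  proof (rule two_level_minimising_sequence[OF ne, of mid J "- C0" P'])
    fix u v assume uv: "u \<in> K" "v \<in> K"
    \<comment> \<open>Midpoint convexity: the subgradient inequalities at the midpoint in the two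
      opposite directions u - mid and v - mid are added, and their linear terms cancel.\<close>
    have "E (mid u v) (\<lambda>x. u x - mid u v x) \<le> J u - J (mid u v)" "E (mid u v) (\<lambda>x. v x - mid u v x) \<le> J v - J (mid u v)"
      using uv mid_K by (auto intro!: J_subgrad)
    moreover have "E (mid u v) (\<lambda>x. v x - mid u v x) = - E (mid u v) (\<lambda>x. u x - mid u v x)"
    proof -
      have "(\<lambda>x. v x - mid u v x) = (\<lambda>x. (- 1) * (u x - mid u v x))" by (auto simp: mid_def field_simps)
      then show ?thesis using E_scale[of "mid u v" "- 1" "\<lambda>x. u x - mid u v x"] by simp
    qed
    ultimately show "2 * J (mid u v) \<le> J u + J v" by linarith
  next
    fix u assume "u \<in> K"
    moreover have "0 \<le> c0 * N (\<lambda>x. u x - \<theta> x)" using C0(1) by simp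
    ultimately show "- C0 \<le> J u" using C0(2)[of u] by linarith
  next
    fix u assume "u \<in> K"
    then show "0 \<le> P' u" unfolding P'_def P_def by (intro integral_nonneg_AE) auto
  next
    fix B
    have "P' u \<le> (B + C0) / c0" if "u \<in> K" "J u \<le> B" for u
    proof -
      have "c0 * N (\<lambda>x. u x - \<theta> x) \<le> B + C0" using C0(2)[of u] that by simp
      then have "N (\<lambda>x. u x - \<theta> x) \<le> (B + C0) / c0" using C0(1) by (simp add: field_simps)
      then show ?thesis using P_le_N[OF K_V[OF that(1)]] by (simp add: P'_def)
    qed
    then show "\<exists>C. \<forall>u\<in>K. J u \<le> B \<longrightarrow> P' u \<le> C" by blast
  qed (use mid_K in auto)
  define w where "w n = (\<lambda>x. u n x - \<theta> x)" for n
  have w: "V (w n)" for n unfolding w_def by (rule K_V[OF u(1)])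
  define B where "B = 2 powr q * \<bar>C\<bar>"
  have NB: "N (w n) \<le> B" for n
  proof -
    have "N (w n) \<le> 2 powr q * P (w n)" by (rule N_le_P[OF w])
    also have "\<dots> \<le> B" unfolding B_def using u(3)[of n] by (intro mult_left_mono) (auto simp: P'_def w_def)
    finally show ?thesis .
  qed
  have B: "0 \<le> B" by (simp add: B_def)
  have cauchy: "\<exists>M. \<forall>i\<ge>M. \<forall>j\<ge>M. N (\<lambda>x. w i x - w j x) \<le> e" if e: "0 < e" for e
  proof -
    \<comment> \<open>Half of e pays for \<epsilon> (N + N) \<le> 2 B \<epsilon>, the other half for
      the convexity gap; B + 1 avoids dividing by 0.\<close>
    define \<epsilon> where "\<epsilon> = min 1 (e / (4 * (B + 1)))"
    have \<epsilon>: "0 < \<epsilon>" "\<epsilon> \<le> 1" using e B by (auto simp: \<epsilon>_def)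
    have "\<epsilon> * (2 * B) \<le> e / (4 * (B + 1)) * (2 * B)" using B by (intro mult_right_mono) (auto simp: \<epsilon>_def)
    also have "\<dots> \<le> e / 2" using B e by (simp add: field_simps)
    finally have \<epsilon>B: "\<epsilon> * (2 * B) \<le> e / 2" .
    obtain c where c: "0 < c" "\<And>u w. V u \<Longrightarrow> V w \<Longrightarrow>
      N (\<lambda>x. u x - w x) \<le> \<epsilon> * (N u + N w) + c * (P u + P w - 2 * P (\<lambda>x. (u x + w x) / 2))"
      using N_uniformly_convex[OF \<epsilon>] by blast
    obtain M where M: "\<And>i j. M \<le> i \<Longrightarrow> M \<le> j \<Longrightarrow> P' (u i) + P' (u j) - 2 * P' (mid (u i) (u j)) < e / (2 * c)"
    proof -
      have "0 < e / (2 * c)" using e c by simp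
      then show ?thesis using u(4) that by blast
    qed
    have "N (\<lambda>x. w i x - w j x) \<le> e" if ij: "M \<le> i" "M \<le> j" for i j
    proof -
      have eq: "(\<lambda>x. (w i x + w j x) / 2) = (\<lambda>x. mid (u i) (u j) x - \<theta> x)"
        by (auto simp: w_def mid_def field_simps)
      have "c * (P (w i) + P (w j) - 2 * P (\<lambda>x. (w i x + w j x) / 2)) \<le> c * (e / (2 * c))"
        using M[OF ij] c(1) unfolding eq by (intro mult_left_mono) (auto simp: P'_def w_def)
      moreover have "\<epsilon> * (N (w i) + N (w j)) \<le> \<epsilon> * (2 * B)"
        using NB[of i] NB[of j] \<epsilon> by (intro mult_left_mono) auto
      ultimately show ?thesis using c(2)[OF w w, of i j] \<epsilon>B c(1) by simp
    qed
    then show ?thesis by blast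
  qed
  obtain v and r :: "nat \<Rightarrow> nat" where v: "V v" "AE x in lebesgue. (\<lambda>k. w (r k) x) \<longlonglongrightarrow> v x"
    "(\<lambda>n. N (\<lambda>x. w n x - v x)) \<longlonglongrightarrow> 0"
    using N_cauchy_complete[OF w cauchy] by blast
  define u0 where "u0 x = \<theta> x + v x" for x
  have W0v: "W0 v"
  proof (rule W0_closed)
    show "zero_out v" "rho \<nu> (D v) < \<infinity>" using v(1) by (auto simp: V_def)
    fix e :: real assume "0 < e"
    then have "eventually (\<lambda>n. N (\<lambda>x. w n x - v x) < e) sequentially" using v(3) by (intro order_tendstoD)
    then obtain n where n: "N (\<lambda>x. w n x - v x) \<le> e" unfolding eventually_sequentially using less_imp_le by blast
    have "D (\<lambda>x. v x - w n x) = (\<lambda>z. - D (\<lambda>x. w n x - v x) z)" by (simp add: D_diff)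
    then have "rho \<nu> (D (\<lambda>x. v x - w n x)) = rho \<nu> (D (\<lambda>x. w n x - v x))" by (simp add: rho_def)
    also have "\<dots> \<le> ennreal e" using n N_eq[OF V_diff[OF w v(1)]] by (simp add: ennreal_leI)
    finally show "\<exists>w'. W0 w' \<and> rho \<nu> (D (\<lambda>x. v x - w' x)) \<le> ennreal e"
      using u(1)[of n] by (intro exI[of _ "w n"]) (simp add: w_def K_iff)
  qed
  have "AE x in lebesgue. \<forall>n. x \<in> \<Omega> \<longrightarrow> \<psi> x \<le> ereal (u n x)"
    using u(1) unfolding AE_all_countable K_iff by blast
  then have "AE x in lebesgue. x \<in> \<Omega> \<longrightarrow> \<psi> x \<le> ereal (u0 x)"
    using v(2)
  proof eventually_elim
    case (elim x)
    have "(\<lambda>k. \<theta> x + w (r k) x) \<longlonglongrightarrow> u0 x" unfolding u0_def by (intro tendsto_add tendsto_const elim(2))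
    then have "(\<lambda>k. ereal (u (r k) x)) \<longlonglongrightarrow> ereal (u0 x)" by (simp add: w_def)
    then show ?case using elim(1) by (auto intro: LIMSEQ_le_const)
  qed
  then have u0: "u0 \<in> K" using W0v by (simp add: K_iff u0_def)
  \<comment> \<open>Lower semicontinuity: the subgradient inequality at u0 bounds J u0 by J (u n) up
    to this null sequence.\<close>
  have "(\<lambda>n. E u0 (\<lambda>x. w n x - v x)) \<longlonglongrightarrow> 0"
    by (intro E_continuous K_base u0 V_diff w v(1) v(3))
  then have lim: "(\<lambda>n. J (u n) - E u0 (\<lambda>x. w n x - v x)) \<longlonglongrightarrow> Inf (J ` K) - 0"
    by (intro tendsto_diff u(2))
  have "J u0 \<le> J (u n) - E u0 (\<lambda>x. w n x - v x)" for n
  proof -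
    have "(\<lambda>x. u n x - u0 x) = (\<lambda>x. w n x - v x)" by (auto simp: w_def u0_def)
    then show ?thesis using J_subgrad[OF u0 u(1)[of n]] by simp
  qed
  then have le: "J u0 \<le> Inf (J ` K)" using LIMSEQ_le_const[OF lim] by auto
  have bdd: "bdd_below (J ` K)"
  proof (rule bdd_belowI2)
    fix v assume "v \<in> K"
    moreover have "0 \<le> c0 * N (\<lambda>x. v x - \<theta> x)" using C0(1) by simp
    ultimately show "- C0 \<le> J v" using C0(2)[of v] by linarith
  qed
  have "J u0 \<le> J v" if "v \<in> K" for v
    using le cInf_lower[OF imageI[OF that] bdd] by linarith
  then show ?thesis using that u0 by blast
qed

end

section \<open>Variational inequality, uniqueness, supersolutions\<close>

context obst
begin

text \<open>At the intermediate point ut the subgradient inequality towards the minimiser u reads -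
  t E ut (v - u) \<le> J u - J ut \<le> 0. So E ut (v - u) is nonnegative for every t, and t tends
  to 0 in the pairing without differentiating \<open>J\<close>.\<close>

lemma minimiser_variational_inequality:
  assumes u: "u \<in> K" and min: "\<And>v. v \<in> K \<Longrightarrow> J u \<le> J v" and v: "v \<in> K"
  shows "0 \<le> E u (\<lambda>x. v x - u x)"
proof -
  let ?w = "\<lambda>x. v x - u x"
  have w: "V ?w" using v u by (rule K_diff_V)
  have [measurable]: "u \<in> borel_measurable lebesgue" "v \<in> borel_measurable lebesgue"
    using u v by (auto intro!: base_measurable K_base)
  define t where "t n = 1 / real (Suc n)" for n
  have t: "0 < t n" "t n \<le> 1" for n by (auto simp: t_def)
  have t_lim: "t \<longlonglongrightarrow> 0" unfolding t_def using LIMSEQ_inverse_real_of_nat by (simp add: inverse_eq_divide)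
  define ut where "ut n x = u x + t n * ?w x" for n x
  have ut: "ut n \<in> K" for n unfolding ut_def using K_convex[OF u v] t[of n] by (simp add: less_imp_le)
  have [measurable]: "ut n \<in> borel_measurable lebesgue" for n using ut by (intro base_measurable K_base)
  have Dut: "D (ut n) z = D u z + t n * D ?w z" for n z
    using D_lincomb[of 1 u "t n" ?w] by (simp add: ut_def[abs_def])
  have pos: "0 \<le> E (ut n) ?w" for n
  proof -
    have "E (ut n) (\<lambda>x. u x - ut n x) \<le> J u - J (ut n)" by (rule J_subgrad[OF ut u])
    also have "\<dots> \<le> 0" using min[OF ut, of n] by simp
    also have "(\<lambda>x. u x - ut n x) = (\<lambda>x. (- t n) * ?w x)" by (auto simp: ut_def)
    finally have "- t n * E (ut n) ?w \<le> 0" by (simp only: E_scale)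
    then have "0 \<le> t n * E (ut n) ?w" by simp
    then show ?thesis using t(1)[of n] by (simp add: zero_le_mult_iff)
  qed
  \<comment> \<open>Independent of n: |D (ut n)| \<le> |D u| + |D v|, and splitting g(a + b) with
    arguments doubled gives q * 2^q.\<close>
  define b where "b z = q * 2 powr q * (g \<bar>D u z\<bar> * \<bar>D ?w z\<bar> + g \<bar>D v z\<bar> * \<bar>D ?w z\<bar>)" for z
  have "(\<lambda>n. E (ut n) ?w) \<longlonglongrightarrow> E u ?w"
    unfolding E_def
  proof (rule integral_dominated_convergence[where w = b])
    show "integrable \<kappa> b" unfolding b_def
      by (intro integrable_mult_right Bochner_Integration.integrable_add Q_integrable w K_base u v)
    show "AE z in \<kappa>. (\<lambda>n. A (D (ut n) z) * D ?w z) \<longlonglongrightarrow> A (D u z) * D ?w z"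
    proof (rule AE_I2)
      fix z
      have "(\<lambda>n. D u z + t n * D ?w z) \<longlonglongrightarrow> D u z + 0 * D ?w z"
        by (intro tendsto_add tendsto_const tendsto_mult_right t_lim)
      then have "(\<lambda>n. D (ut n) z) \<longlonglongrightarrow> D u z" unfolding Dut by simp
      then have "(\<lambda>n. A (D (ut n) z)) \<longlonglongrightarrow> A (D u z)" by (rule isCont_tendsto_compose[OF A_isCont])
      then show "(\<lambda>n. A (D (ut n) z) * D ?w z) \<longlonglongrightarrow> A (D u z) * D ?w z" by (rule tendsto_mult_right)
    qed
    fix n
    show "AE z in \<kappa>. norm (A (D (ut n) z) * D ?w z) \<le> b z"
    proof (rule AE_I2)
      fix z
      have "D (ut n) z = (1 - t n) * D u z + t n * D v z" by (simp add: Dut D_diff algebra_simps)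
      then have "\<bar>D (ut n) z\<bar> \<le> (1 - t n) * \<bar>D u z\<bar> + t n * \<bar>D v z\<bar>"
        using abs_triangle_ineq[of "(1 - t n) * D u z" "t n * D v z"] t[of n] by (simp add: abs_mult)
      also have "\<dots> \<le> 1 * \<bar>D u z\<bar> + 1 * \<bar>D v z\<bar>"
        using t[of n] by (intro add_mono mult_right_mono) auto
      finally have "g \<bar>D (ut n) z\<bar> \<le> g (\<bar>D u z\<bar> + \<bar>D v z\<bar>)" by (intro g_mono) auto
      also have "\<dots> \<le> g (2 * \<bar>D u z\<bar>) + g (2 * \<bar>D v z\<bar>)" by (intro g_add_le) auto
      also have "\<dots> \<le> q * 2 powr q * g \<bar>D u z\<bar> + q * 2 powr q * g \<bar>D v z\<bar>"
        by (intro add_mono g_scale) auto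
      finally have "g \<bar>D (ut n) z\<bar> * \<bar>D ?w z\<bar> \<le> (q * 2 powr q * g \<bar>D u z\<bar> + q * 2 powr q * g \<bar>D v z\<bar>) * \<bar>D ?w z\<bar>"
        by (rule mult_right_mono) simp
      then show "norm (A (D (ut n) z) * D ?w z) \<le> b z" by (simp add: abs_mult abs_A b_def algebra_simps)
    qed
  qed measurable
  then show ?thesis by (rule LIMSEQ_le_const) (use pos in auto)
qed

lemma obstacle_solution_iff:
  "obstacle_solution G g s k \<Omega> \<Omega>' \<psi> \<theta> u \<longleftrightarrow> u \<in> K \<and> (\<forall>v\<in>K. 0 \<le> E u (\<lambda>x. v x - u x))"
proof -
  have "energy g s k u (\<lambda>x. v x - u x) = E u (\<lambda>x. v x - u x)" if "u \<in> K" "v \<in> K" for v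
    unfolding E_def
    by (rule energy_eq[OF base_measurable[OF K_base[OF that(1)]] V_measurable[OF K_diff_V[OF that(2,1)]]])
  then show ?thesis unfolding obstacle_solution_def by auto
qed

lemma obstacle_solution_exists:
  assumes "K \<noteq> {}"
  obtains u where "obstacle_solution G g s k \<Omega> \<Omega>' \<psi> \<theta> u"
  using minimiser_exists[OF assms] minimiser_variational_inequality unfolding obstacle_solution_iff by metis

text \<open>A vanishing difference quotient makes w almost everywhere equal to a constant, and w is
  0 on the complement of \<Omega>, which is not a null set because \<Omega> has finite
  measure.\<close>

lemma AE_eq_of_D_zero:
  assumes w: "V w" and D0: "AE z in \<kappa>. D w z = 0"
  shows "AE x in lebesgue. w x = 0"
proof -
  have [measurable]: "w \<in> borel_measurable lebesgue" using w by (rule V_measurable)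
  have "AE z in leb2. 0 < ennreal (k (fst z) (snd z) / d z ^ DIM('a)) \<longrightarrow> D w z = 0"
    using D0 unfolding \<kappa>_def by (subst (asm) AE_density) auto
  then have "AE z in leb2. w (fst z) = w (snd z)"
    using k_bounds
  proof eventually_elim
    case (elim z)
    show ?case
    proof (cases "d z = 0")
      case True
      then show ?thesis by (simp add: d_def)
    next
      case False
      then have dz: "0 < d z" using d_nonneg[of z] by linarith
      have "0 < 1 / \<Lambda>" using Lam by simp
      then have "0 < k (fst z) (snd z)" using elim(2) by linarith
      with dz have "0 < k (fst z) (snd z) / d z ^ DIM('a)" "0 < d z powr s" by auto
      then show ?thesis using elim(1) by (auto simp: D_eq)
    qed
  qed
  then have 1: "AE x in lebesgue. AE y in lebesgue. w x = w y"
    by (rule lebesgue_pair.AE_pair[of "\<lambda>z. w (fst z) = w (snd z)", simplified])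
  have out: "AE y in lebesgue. y \<notin> \<Omega> \<longrightarrow> w y = 0" using w by (simp add: V_def zero_out_def)
  have big: "\<not> (AE y in lebesgue. y \<in> \<Omega>)"
  proof
    assume "AE y in lebesgue. y \<in> \<Omega>"
    then have "emeasure lebesgue (UNIV :: 'a set) = emeasure lebesgue \<Omega>"
      by (intro emeasure_eq_AE) auto
    then show False using emeasure_Omega_finite by simp
  qed
  show ?thesis
    using 1
  proof eventually_elim
    case (elim x)
    show ?case
    proof (rule ccontr)
      assume "w x \<noteq> 0"
      have "AE y in lebesgue. y \<in> \<Omega>"
        using elim out by eventually_elim (use \<open>w x \<noteq> 0\<close> in auto)
      then show False using big by simp
    qed
  qed
qed

text \<open>Each solution is the competitor in the other's inequality. The sum forces the integral
  of the nonnegative (A(D u) - A(D v)) (D u - D v) to be 0, and strict monotonicity of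
  \<open>A\<close> gives D u = D v.\<close>

lemma obstacle_solution_unique:
  assumes "obstacle_solution G g s k \<Omega> \<Omega>' \<psi> \<theta> u" "obstacle_solution G g s k \<Omega> \<Omega>' \<psi> \<theta> v"
  shows "AE x in lebesgue. u x = v x"
proof -
  have u: "u \<in> K" and v: "v \<in> K" and uv: "0 \<le> E u (\<lambda>x. v x - u x)" and vu: "0 \<le> E v (\<lambda>x. u x - v x)"
    using assms by (auto simp: obstacle_solution_iff)
  let ?w = "\<lambda>x. u x - v x"
  have w: "V ?w" using u v by (rule K_diff_V)
  have eq: "(A (D u z) * D ?w z - A (D v z) * D ?w z) = (A (D u z) - A (D v z)) * (D u z - D v z)" for z
    by (simp add: D_diff algebra_simps)
  have int: "integrable \<kappa> (\<lambda>z. A (D u z) * D ?w z)" "integrable \<kappa> (\<lambda>z. A (D v z) * D ?w z)"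
    by (auto intro!: E_integrable K_base u v w)
  have int': "integrable \<kappa> (\<lambda>z. (A (D u z) - A (D v z)) * (D u z - D v z))"
    using Bochner_Integration.integrable_diff[OF int] unfolding eq .
  have "E u (\<lambda>x. v x - u x) = - E u ?w" using E_scale[of u "- 1" ?w] by simp
  moreover have "(\<integral>z. (A (D u z) - A (D v z)) * (D u z - D v z) \<partial>\<kappa>) = E u ?w - E v ?w"
    unfolding E_def eq[symmetric] by (rule Bochner_Integration.integral_diff[OF int])
  ultimately have "(\<integral>z. (A (D u z) - A (D v z)) * (D u z - D v z) \<partial>\<kappa>) \<le> 0" using uv vu by linarith
  moreover have "0 \<le> (\<integral>z. (A (D u z) - A (D v z)) * (D u z - D v z) \<partial>\<kappa>)"
    by (intro integral_nonneg_AE AE_I2 A_monotone(1))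
  ultimately have "(\<integral>z. (A (D u z) - A (D v z)) * (D u z - D v z) \<partial>\<kappa>) = 0" by linarith
  then have "AE z in \<kappa>. (A (D u z) - A (D v z)) * (D u z - D v z) = 0"
    using integral_nonneg_eq_0_iff_AE[OF int'] A_monotone(1) by blast
  then have "AE z in \<kappa>. D ?w z = 0"
  proof eventually_elim
    case (elim z)
    show ?case using A_monotone(2)[OF elim] by (simp add: D_diff)
  qed
  from AE_eq_of_D_zero[OF w this] show ?thesis by (rule eventually_mono) simp
qed

text \<open>Local integrability is checked separately inside \<Omega>, from the modular, and
  outside, where u coincides with \<theta>.\<close>

lemma base_in_Lgs:
  assumes u: "base u" and eq: "AE x in lebesgue. x \<notin> \<Omega> \<longrightarrow> u x = \<theta> x"
  shows "(\<lambda>x. max (- u x) 0) \<in> Lgs g s"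
proof -
  have [measurable]: "u \<in> borel_measurable lebesgue" "\<theta> \<in> borel_measurable lebesgue"
    using u base_theta by (auto intro: base_measurable)
  let ?u = "\<lambda>x. max (- u x) 0"
  have le: "\<bar>?u x\<bar> \<le> \<bar>u x\<bar>" for x by auto
  have "(\<integral>\<^sup>+ x. ennreal (g \<bar>?u x\<bar>) * indicator C x \<partial>lebesgue) < \<infinity>" if C: "compact C" for C
  proof -
    have [measurable]: "C \<in> sets lebesgue" using C by (metis borel_compact sets_completionI_sets sets_lborel)
    have "(\<integral>\<^sup>+ x. ennreal (g \<bar>?u x\<bar>) * indicator C x \<partial>lebesgue) \<le>
      (\<integral>\<^sup>+ x. ennreal (g \<bar>\<theta> x\<bar>) * indicator C x + (ennreal (g 1) * indicator \<Omega> x + ennreal q * (ennreal (G \<bar>u x\<bar>) * indicator \<Omega> x)) \<partial>lebesgue)"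
    proof (rule nn_integral_mono_AE)
      show "AE x in lebesgue. ennreal (g \<bar>?u x\<bar>) * indicator C x \<le>
         ennreal (g \<bar>\<theta> x\<bar>) * indicator C x + (ennreal (g 1) * indicator \<Omega> x + ennreal q * (ennreal (G \<bar>u x\<bar>) * indicator \<Omega> x))"
        using eq
      proof eventually_elim
        case (elim x)
        have g: "ennreal (g \<bar>?u x\<bar>) \<le> ennreal (g \<bar>u x\<bar>)" by (intro ennreal_leI g_mono le) auto
        show ?case
        proof (cases "x \<in> \<Omega>")
          case True
          have "ennreal (g \<bar>u x\<bar>) \<le> ennreal (g 1 + q * G \<bar>u x\<bar>)" by (intro ennreal_leI g_le_G) auto
          also have "\<dots> = ennreal (g 1) + ennreal q * ennreal (G \<bar>u x\<bar>)" using q_gt1 by (simp add: ennreal_mult)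
          finally have "ennreal (g \<bar>?u x\<bar>) \<le> ennreal (g 1) + ennreal q * ennreal (G \<bar>u x\<bar>)" using g by (rule order_trans[rotated])
          then show ?thesis using True by (cases "x \<in> C") (simp_all add: add_increasing)
        next
          case False
          then show ?thesis using g elim by (cases "x \<in> C") auto
        qed
      qed
    qed
    also have "\<dots> = (\<integral>\<^sup>+ x. ennreal (g \<bar>\<theta> x\<bar>) * indicator C x \<partial>lebesgue) + (ennreal (g 1) * emeasure lebesgue \<Omega> + ennreal q * rho leb\<Omega> u)"
      by (simp add: nn_integral_add nn_integral_cmult nn_integral_cmult_indicator modG_eq[symmetric] modG_def
          del: emeasure_completion)
    also have "\<dots> < \<infinity>"
    proof -
      have "(\<integral>\<^sup>+ x. ennreal (g \<bar>\<theta> x\<bar>) * indicator C x \<partial>lebesgue) < \<infinity>" using theta(2) C unfolding Lgs_def by blast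
      moreover have "rho leb\<Omega> u < \<infinity>" using u unfolding base_def by blast
      ultimately show ?thesis using emeasure_Omega_finite by (simp add: ennreal_mult_less_top del: emeasure_completion)
    qed
    finally show ?thesis .
  qed
  moreover have "(\<integral>\<^sup>+ x. ennreal (g (\<bar>?u x\<bar> / (1 + norm x) powr s) / (1 + norm x) powr (real DIM('a) + s)) \<partial>lebesgue) \<le> tail u"
    unfolding tail_def
    by (intro nn_integral_mono ennreal_leI divide_right_mono g_mono le) auto
  then have "(\<integral>\<^sup>+ x. ennreal (g (\<bar>?u x\<bar> / (1 + norm x) powr s) / (1 + norm x) powr (real DIM('a) + s)) \<partial>lebesgue) < \<infinity>"
    using u unfolding base_def by (meson le_less_trans)
  ultimately show ?thesis unfolding Lgs_def by simp
qed

text \<open>Adding a nonnegative test function respects both the obstacle and the boundary values,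
  so u + \<phi> is a competitor with difference \<phi>.\<close>

lemma obstacle_solution_supersolution:
  assumes sol: "obstacle_solution G g s k \<Omega> \<Omega>' \<psi> \<theta> u"
  shows "supersolution G g s k \<Omega> u"
proof -
  have u: "u \<in> K" using sol by (simp add: obstacle_solution_iff)
  have bu: "base u" using u by (rule K_base)
  have um: "u \<in> borel_measurable lebesgue" using bu by (rule base_measurable)
  have "modG G B u < \<infinity> \<and> modGs G s B B u < \<infinity>" if B: "closure B \<subseteq> \<Omega>" for B
  proof -
    have sub: "B \<subseteq> \<Omega>" "B \<subseteq> \<Omega>'" using B closure_subset[of B] Omega_subset by auto
    have "modG G B u \<le> modG G \<Omega> u" unfolding modG_def
      using sub by (intro nn_integral_mono mult_left_mono) (auto simp: indicator_def)
    moreover have "modGs G s B B u \<le> modGs G s \<Omega> \<Omega>' u" unfolding modGs_def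
      using sub by (intro nn_integral_mono mult_mono mult_left_mono) (auto simp: indicator_def)
    moreover have "modG G \<Omega> u < \<infinity>" "modGs G s \<Omega> \<Omega>' u < \<infinity>"
      using bu unfolding modG_eq[OF um] modGs_eq[OF um] base_def by blast+
    ultimately show ?thesis by (meson le_less_trans)
  qed
  then have loc: "u \<in> WsG_loc G s \<Omega>" using um by (simp add: WsG_loc_def)
  have "AE x in lebesgue. x \<notin> \<Omega> \<longrightarrow> u x = \<theta> x"
    using K_V[OF u] by (auto simp: V_def zero_out_def elim: eventually_mono)
  then have Lgs: "(\<lambda>x. max (- u x) 0) \<in> Lgs g s" by (rule base_in_Lgs[OF bu])
  have "0 \<le> energy g s k u \<phi>" if \<phi>: "test_fun \<Omega> \<phi>" "\<forall>x. 0 \<le> \<phi> x" for \<phi>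
  proof -
    have "W0 (\<lambda>x. (u x - \<theta> x) + \<phi> x)" 
      using W0_add[OF _ W0_test[OF \<phi>(1)]] u by (simp add: K_iff)
    moreover have "AE x in lebesgue. x \<in> \<Omega> \<longrightarrow> \<psi> x \<le> ereal (u x)" using u by (simp add: K_iff)
    then have "AE x in lebesgue. x \<in> \<Omega> \<longrightarrow> \<psi> x \<le> ereal (u x + \<phi> x)"
    proof eventually_elim
      case (elim x)
      have "ereal (u x) \<le> ereal (u x + \<phi> x)" using \<phi> by simp
      then show ?case using elim by (blast intro: order_trans)
    qed
    ultimately have uK: "(\<lambda>x. u x + \<phi> x) \<in> K" by (simp add: K_iff algebra_simps)
    have "\<forall>v\<in>K. 0 \<le> energy g s k u (\<lambda>x. v x - u x)" using sol by (simp add: obstacle_solution_def)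
    from bspec[OF this uK] show ?thesis by simp
  qed
  then show ?thesis using loc Lgs by (simp add: supersolution_def)
qed

end

theorem theorem4p3:
  fixes G g :: "real \<Rightarrow> real" and p q s \<Lambda> :: real
    and k :: "'a::euclidean_space \<Rightarrow> 'a \<Rightarrow> real"
    and \<Omega> \<Omega>' :: "'a set" and \<psi> :: "'a \<Rightarrow> ereal" and \<theta> :: "'a \<Rightarrow> real"
  assumes young: "young_data G g p q"
    and s: "0 < s" "s < 1"
    and Lam: "1 \<le> \<Lambda>"
    and kern: "kernel_ok \<Lambda> k"
    and noninc: "\<forall>t1 t2. 0 < t1 \<and> t1 \<le> t2 \<longrightarrow> g t2 / t2 powr (q - 1) \<le> g t1 / t1 powr (q - 1)"
    and opens: "open \<Omega>" "open \<Omega>'" "bounded \<Omega>" "bounded \<Omega>'"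
    and compin: "closure \<Omega> \<subseteq> \<Omega>'"
    and theta: "\<theta> \<in> WsG G s \<Omega> \<Omega>'" "\<theta> \<in> Lgs g s"
    and nonempty: "Kclass G s \<Omega> \<Omega>' \<psi> \<theta> \<noteq> {}"
  shows "(\<exists>u. obstacle_solution G g s k \<Omega> \<Omega>' \<psi> \<theta> u) \<and>
         (\<forall>u1 u2. obstacle_solution G g s k \<Omega> \<Omega>' \<psi> \<theta> u1 \<and> obstacle_solution G g s k \<Omega> \<Omega>' \<psi> \<theta> u2
                  \<longrightarrow> (AE x in lebesgue. u1 x = u2 x)) \<and>
         (\<forall>u. obstacle_solution G g s k \<Omega> \<Omega>' \<psi> \<theta> u \<longrightarrow> supersolution G g s k \<Omega> u)"
proof -
  interpret obst G g p q s \<Lambda> k \<Omega> \<Omega>' \<psi> \<theta>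
    using assms by unfold_locales auto
  show ?thesis
    using obstacle_solution_exists[OF nonempty] obstacle_solution_unique obstacle_solution_supersolution by metis
qed

end
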